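(* Let $k$ be a field, $n\ge1$, $P=(p_1,\dots,p_n)$ and $Q=(q_1,\dots,q_n)$ in $(k^\times)^n$ with $p_i\ne q_i$ for all $i$, and let $\Gamma=(\gamma_{ij})\in M_n(k^\times)$ be multiplicatively antisymmetric. Let $\Lambda$ be the multiplicatively antisymmetric $2n\times2n$ matrix over $k$ made of $2\times2$ blocks $B_{ij}$ ($1\le i,j\le n$) with $$B_{ii}=\begin{pmatrix} 1 & q_i^{-1} \\ {} q_i & 1 \end{pmatrix},\qquad B_{ij}=\begin{pmatrix} \gamma_{ij} & q_i^{-1}\gamma_{ji} \\ {} p_j\gamma_{ji} & q_ip_j^{-1}\gamma_{ij} \end{pmatrix}\ (i<j),\qquad B_{ij}=\begin{pmatrix} \gamma_{ij} & p_i^{-1}\gamma_{ji} \\ {} q_j\gamma_{ji} & q_j^{-1}p_i\gamma_{ij} \end{pmatrix}\ (i>j).$$ Then $$\operatorname{Fract}K_{n,\Gamma}^{P,Q}(k)\cong\operatorname{Fract}\mathcal O_\Lambda(k^{2n}).$$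
   Context: $k$ has arbitrary characteristic. A matrix $(\lambda_{ij})$ over $k^\times$ is multiplicatively antisymmetric if $\lambda_{ii}=1$ and $\lambda_{ji}=\lambda_{ij}^{-1}$. $K_{n,\Gamma}^{P,Q}(k)$ is the $k$-algebra with generators $x_i,y_i$ ($1\le i\le n$) and relations $y_iy_j=\gamma_{ij}y_jy_i$ (all $i,j$); $x_ix_j=q_ip_j^{-1}\gamma_{ij}x_jx_i$ ($i<j$); $x_iy_j=p_j\gamma_{ji}y_jx_i$ ($i<j$); $x_iy_j=q_j\gamma_{ji}y_jx_i$ ($i>j$); $x_iy_i=q_iy_ix_i+\sum_{\ell<i}(q_\ell-p_\ell)y_\ell x_\ell$ (all $i$). For multiplicatively antisymmetric $\boldsymbol\lambda\in M_N(k^\times)$, $\mathcal O_{\boldsymbol\lambda}(k^N)$ is the $k$-algebra with generators $z_1,\dots,z_N$ and relations $z_iz_j=\lambda_{ij}z_jz_i$. $\operatorname{Fract}$ is the division ring of fractions. *)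

theory Defs
  imports "HOL-Algebra.QuotRing" "HOL-Algebra.Module" "HOL-Library.Poly_Mapping"
begin

section \<open>Algebras over a field\<close>

text \<open>
  The ground field is a type of class \<^class>\<open>field\<close>. A not necessarily commutative algebra over it
  is a \<^type>\<open>module\<close> record, that is, a ring together with a scalar multiplication. (The
  \<open>algebra\<close> locale of the library only covers commutative algebras.)
\<close>

locale k_algebra = ring A for A :: "('k::field, 'a) module" (structure) +
  assumes smult_closed: "a \<in> carrier A \<Longrightarrow> c \<odot> a \<in> carrier A"
    and smult_l_distr: "a \<in> carrier A \<Longrightarrow> (c + d) \<odot> a = c \<odot> a \<oplus> d \<odot> a"
    and smult_r_distr: "\<lbrakk>a \<in> carrier A; b \<in> carrier A\<rbrakk> \<Longrightarrow> c \<odot> (a \<oplus> b) = c \<odot> a \<oplus> c \<odot> b"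
    and smult_assoc: "a \<in> carrier A \<Longrightarrow> (c * d) \<odot> a = c \<odot> (d \<odot> a)"
    and smult_one: "a \<in> carrier A \<Longrightarrow> 1 \<odot> a = a"
    and smult_mult_l: "\<lbrakk>a \<in> carrier A; b \<in> carrier A\<rbrakk> \<Longrightarrow> (c \<odot> a) \<otimes> b = c \<odot> (a \<otimes> b)"
    and smult_mult_r: "\<lbrakk>a \<in> carrier A; b \<in> carrier A\<rbrakk> \<Longrightarrow> a \<otimes> (c \<odot> b) = c \<odot> (a \<otimes> b)"

definition k_linear :: "('k, 'a) module \<Rightarrow> ('k, 'b) module \<Rightarrow> ('a \<Rightarrow> 'b) \<Rightarrow> bool" where
  "k_linear A B f \<longleftrightarrow> (\<forall>c. \<forall>a\<in>carrier A. f (c \<odot>\<^bsub>A\<^esub> a) = c \<odot>\<^bsub>B\<^esub> f a)"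

definition k_algebra_isomorphic :: "('k, 'a) module \<Rightarrow> ('k, 'b) module \<Rightarrow> bool"
    (infix \<open>\<simeq>\<^sub>k\<close> 50) where
  "A \<simeq>\<^sub>k B \<longleftrightarrow> (\<exists>f \<in> ring_iso A B. k_linear A B f)"


section \<open>Algebras given by generators and relations\<close>

text \<open>
  Words form the free monoid; it is written additively because the convolution product of
  \<^type>\<open>poly_mapping\<close> expects an additive monoid of exponents. Thus \<open>'g word \<Rightarrow>\<^sub>0 'k\<close> is the
  free algebra on \<open>'g\<close>, the monoid algebra of the free monoid.
\<close>

datatype 'g word = Word (letters: "'g list")

instantiation word :: (type) monoid_add
begin

definition zero_word :: "'a word" where "0 = Word []"

definition plus_word :: "'a word \<Rightarrow> 'a word \<Rightarrow> 'a word" where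
  "v + w = Word (letters v @ letters w)"

instance
  by standard (simp_all add: zero_word_def plus_word_def)

end

definition gen :: "'g \<Rightarrow> ('g word \<Rightarrow>\<^sub>0 'k::field)" where
  "gen g = Poly_Mapping.single (Word [g]) 1"

definition scalar :: "'k \<Rightarrow> ('g word \<Rightarrow>\<^sub>0 'k::field)" where
  "scalar c = Poly_Mapping.single 0 c"

definition free_algebra :: "'g set \<Rightarrow> ('g word \<Rightarrow>\<^sub>0 'k::field) ring" where
  "free_algebra S =
     \<lparr>carrier = {f. \<forall>w \<in> Poly_Mapping.keys f. set (letters w) \<subseteq> S},
      mult = (*), one = 1, zero = 0, add = (+)\<rparr>"

text \<open>Ideals of \<^theory>\<open>HOL-Algebra.Ideal\<close> are two-sided.\<close>

definition presented_algebra ::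
    "'g set \<Rightarrow> ('g word \<Rightarrow>\<^sub>0 'k::field) set \<Rightarrow> ('k, ('g word \<Rightarrow>\<^sub>0 'k) set) module" where
  "presented_algebra S rels =
    (let F = free_algebra S; I = genideal F rels; A = F Quot I
     in ring.extend A (module.fields (\<lambda>c a. (I +>\<^bsub>F\<^esub> scalar c) \<otimes>\<^bsub>A\<^esub> a)))"


section \<open>The division ring of fractions\<close>

text \<open>
  The Ore construction with right fractions: \<open>ore_frac A a s\<close> stands for \<open>a s\<^sup>-\<^sup>1\<close>.
  Two right fractions are identified if they agree over some common denominator.
  The definitions make sense for every \<open>A\<close>, but are meaningful only for an Ore domain \<open>A\<close>.
\<close>

definition ore_rel :: "('k, 'a) module \<Rightarrow> (('a \<times> 'a) \<times> ('a \<times> 'a)) set" where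
  "ore_rel A = {((a, s), (b, t)).
     a \<in> carrier A \<and> b \<in> carrier A \<and>
     s \<in> carrier A - {\<zero>\<^bsub>A\<^esub>} \<and> t \<in> carrier A - {\<zero>\<^bsub>A\<^esub>} \<and>
     (\<exists>u \<in> carrier A. \<exists>v \<in> carrier A.
        s \<otimes>\<^bsub>A\<^esub> u = t \<otimes>\<^bsub>A\<^esub> v \<and> s \<otimes>\<^bsub>A\<^esub> u \<noteq> \<zero>\<^bsub>A\<^esub> \<and> a \<otimes>\<^bsub>A\<^esub> u = b \<otimes>\<^bsub>A\<^esub> v)}"

definition ore_frac :: "('k, 'a) module \<Rightarrow> 'a \<Rightarrow> 'a \<Rightarrow> ('a \<times> 'a) set" where
  "ore_frac A a s = ore_rel A `` {(a, s)}"

text \<open>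
  Products: \<open>(a s\<^sup>-\<^sup>1) (b t\<^sup>-\<^sup>1) = (a c) (t u)\<^sup>-\<^sup>1\<close> whenever \<open>s c = b u\<close> with \<open>u \<noteq> 0\<close>.
  Sums: \<open>a s\<^sup>-\<^sup>1 + b t\<^sup>-\<^sup>1 = (a u + b v) (s u)\<^sup>-\<^sup>1\<close> whenever \<open>s u = t v \<noteq> 0\<close>.
  For an Ore domain such \<open>c\<close>, \<open>u\<close>, \<open>v\<close> exist and the resulting class does not depend on any
  choice, so each of the unions below is a union of copies of a single class.
\<close>

definition Frac :: "('k, 'a) module \<Rightarrow> ('k, ('a \<times> 'a) set) module" where
  "Frac A =
    \<lparr>carrier = (carrier A \<times> (carrier A - {\<zero>\<^bsub>A\<^esub>})) // ore_rel A,
     mult = (\<lambda>X Y. \<Union>{ore_frac A (a \<otimes>\<^bsub>A\<^esub> c) (t \<otimes>\<^bsub>A\<^esub> u) | a s b t c u.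
        (a, s) \<in> X \<and> (b, t) \<in> Y \<and> c \<in> carrier A \<and> u \<in> carrier A - {\<zero>\<^bsub>A\<^esub>} \<and>
        s \<otimes>\<^bsub>A\<^esub> c = b \<otimes>\<^bsub>A\<^esub> u}),
     one = ore_frac A \<one>\<^bsub>A\<^esub> \<one>\<^bsub>A\<^esub>,
     zero = ore_frac A \<zero>\<^bsub>A\<^esub> \<one>\<^bsub>A\<^esub>,
     add = (\<lambda>X Y. \<Union>{ore_frac A (a \<otimes>\<^bsub>A\<^esub> u \<oplus>\<^bsub>A\<^esub> b \<otimes>\<^bsub>A\<^esub> v) (s \<otimes>\<^bsub>A\<^esub> u) | a s b t u v.
        (a, s) \<in> X \<and> (b, t) \<in> Y \<and> u \<in> carrier A \<and> v \<in> carrier A \<and>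
        s \<otimes>\<^bsub>A\<^esub> u = t \<otimes>\<^bsub>A\<^esub> v \<and> s \<otimes>\<^bsub>A\<^esub> u \<noteq> \<zero>\<^bsub>A\<^esub>}),
     smult = (\<lambda>c X. \<Union>{ore_frac A (c \<odot>\<^bsub>A\<^esub> a) s | a s. (a, s) \<in> X})\<rparr>"

text \<open>
  \<open>D\<close> is a division ring of fractions of \<open>A\<close> via the embedding \<open>\<iota>\<close>, on both sides.
\<close>

definition is_division_ring_of_fractions ::
    "('k::field, 'a) module \<Rightarrow> ('k, 'b) module \<Rightarrow> ('a \<Rightarrow> 'b) \<Rightarrow> bool" where
  "is_division_ring_of_fractions A D \<iota> \<longleftrightarrow>
     k_algebra A \<and> k_algebra D \<and>
     \<one>\<^bsub>D\<^esub> \<noteq> \<zero>\<^bsub>D\<^esub> \<and> Units D = carrier D - {\<zero>\<^bsub>D\<^esub>} \<and>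
     \<iota> \<in> ring_hom A D \<and> k_linear A D \<iota> \<and> inj_on \<iota> (carrier A) \<and>
     (\<forall>d \<in> carrier D. \<exists>a \<in> carrier A. \<exists>s \<in> carrier A - {\<zero>\<^bsub>A\<^esub>}.
        d = \<iota> a \<otimes>\<^bsub>D\<^esub> inv\<^bsub>D\<^esub> (\<iota> s)) \<and>
     (\<forall>d \<in> carrier D. \<exists>a \<in> carrier A. \<exists>s \<in> carrier A - {\<zero>\<^bsub>A\<^esub>}.
        d = inv\<^bsub>D\<^esub> (\<iota> s) \<otimes>\<^bsub>D\<^esub> \<iota> a)"

text \<open>\<open>Frac A\<close> is the division ring of fractions of \<open>A\<close>; in particular \<open>A\<close> is an Ore domain.\<close>

definition has_division_ring_of_fractions :: "('k::field, 'a) module \<Rightarrow> bool" where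
  "has_division_ring_of_fractions A \<longleftrightarrow>
     is_division_ring_of_fractions A (Frac A) (\<lambda>a. ore_frac A a \<one>\<^bsub>A\<^esub>)"


section \<open>The algebras\<close>

text \<open>
  Families \<open>(p\<^sub>1, \<dots>, p\<^sub>n)\<close> and \<open>N \<times> N\<close> matrices are functions on \<^typ>\<open>nat\<close>; only
  the values at indices in \<open>{1..n}\<close> resp. \<open>{1..N}\<close> matter.
\<close>

definition mult_antisymmetric :: "nat \<Rightarrow> (nat \<Rightarrow> nat \<Rightarrow> 'k::field) \<Rightarrow> bool" where
  "mult_antisymmetric N L \<longleftrightarrow>
     (\<forall>i\<in>{1..N}. \<forall>j\<in>{1..N}. L i j \<noteq> 0 \<and> L j i = inverse (L i j)) \<and>
     (\<forall>i\<in>{1..N}. L i i = 1)"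

definition quantum_space ::
    "nat \<Rightarrow> (nat \<Rightarrow> nat \<Rightarrow> 'k::field) \<Rightarrow> ('k, (nat word \<Rightarrow>\<^sub>0 'k) set) module" where
  "quantum_space N L = presented_algebra {1..N}
     {gen i * gen j - scalar (L i j) * gen j * gen i | i j. i \<in> {1..N} \<and> j \<in> {1..N}}"

datatype xy_gen = GenX nat | GenY nat

abbreviation x_gen :: "nat \<Rightarrow> (xy_gen word \<Rightarrow>\<^sub>0 'k::field)" (\<open>\<x>\<close>) where
  "\<x> i \<equiv> gen (GenX i)"

abbreviation y_gen :: "nat \<Rightarrow> (xy_gen word \<Rightarrow>\<^sub>0 'k::field)" (\<open>\<y>\<close>) where
  "\<y> i \<equiv> gen (GenY i)"

definition K_relations ::
    "nat \<Rightarrow> (nat \<Rightarrow> 'k) \<Rightarrow> (nat \<Rightarrow> 'k) \<Rightarrow> (nat \<Rightarrow> nat \<Rightarrow> 'k) \<Rightarrow>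
     (xy_gen word \<Rightarrow>\<^sub>0 'k::field) set" where
  "K_relations n p q \<gamma> =
     {\<y> i * \<y> j - scalar (\<gamma> i j) * \<y> j * \<y> i | i j.
        i \<in> {1..n} \<and> j \<in> {1..n}} \<union>
     {\<x> i * \<x> j - scalar (q i * inverse (p j) * \<gamma> i j) * \<x> j * \<x> i | i j.
        i \<in> {1..n} \<and> j \<in> {1..n} \<and> i < j} \<union>
     {\<x> i * \<y> j - scalar (p j * \<gamma> j i) * \<y> j * \<x> i | i j.
        i \<in> {1..n} \<and> j \<in> {1..n} \<and> i < j} \<union>
     {\<x> i * \<y> j - scalar (q j * \<gamma> j i) * \<y> j * \<x> i | i j.
        i \<in> {1..n} \<and> j \<in> {1..n} \<and> i > j} \<union>
     {\<x> i * \<y> i - (scalar (q i) * \<y> i * \<x> i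
          + (\<Sum>l\<in>{1..<i}. scalar (q l - p l) * \<y> l * \<x> l)) | i.
        i \<in> {1..n}}"

definition K_algebra ::
    "nat \<Rightarrow> (nat \<Rightarrow> 'k) \<Rightarrow> (nat \<Rightarrow> 'k) \<Rightarrow> (nat \<Rightarrow> nat \<Rightarrow> 'k::field) \<Rightarrow>
     ('k, (xy_gen word \<Rightarrow>\<^sub>0 'k) set) module" where
  "K_algebra n p q \<gamma> =
     presented_algebra (GenX ` {1..n} \<union> GenY ` {1..n}) (K_relations n p q \<gamma>)"


section \<open>The block matrix\<close>

text \<open>The entry with indices \<open>a, b \<in> {1, 2}\<close> of a \<open>2 \<times> 2\<close> matrix given by its rows.\<close>

definition mat22 :: "'k \<Rightarrow> 'k \<Rightarrow> 'k \<Rightarrow> 'k \<Rightarrow> nat \<Rightarrow> nat \<Rightarrow> 'k" where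
  "mat22 m11 m12 m21 m22 a b =
     (if a = 1 then (if b = 1 then m11 else m12) else (if b = 1 then m21 else m22))"

definition B_block ::
    "(nat \<Rightarrow> 'k) \<Rightarrow> (nat \<Rightarrow> 'k) \<Rightarrow> (nat \<Rightarrow> nat \<Rightarrow> 'k::field) \<Rightarrow>
     nat \<Rightarrow> nat \<Rightarrow> nat \<Rightarrow> nat \<Rightarrow> 'k" where
  "B_block p q \<gamma> i j =
     (if i = j then
        mat22 1     (inverse (q i))
              (q i) 1
      else if i < j then
        mat22 (\<gamma> i j)       (inverse (q i) * \<gamma> j i)
              (p j * \<gamma> j i) (q i * inverse (p j) * \<gamma> i j)
      else
        mat22 (\<gamma> i j)       (inverse (p i) * \<gamma> j i)
              (q j * \<gamma> j i) (inverse (q j) * p i * \<gamma> i j))"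

text \<open>
  Row \<open>r \<in> {1..2n}\<close> of the whole matrix is row \<open>r - 2 (i - 1)\<close> of block row \<open>i = (r + 1) div 2\<close>,
  and likewise for columns.
\<close>

definition Lambda_matrix ::
    "(nat \<Rightarrow> 'k) \<Rightarrow> (nat \<Rightarrow> 'k) \<Rightarrow> (nat \<Rightarrow> nat \<Rightarrow> 'k::field) \<Rightarrow> nat \<Rightarrow> nat \<Rightarrow> 'k" where
  "Lambda_matrix p q \<gamma> r s =
     (let i = (r + 1) div 2; j = (s + 1) div 2
      in B_block p q \<gamma> i j (r - 2 * (i - 1)) (s - 2 * (j - 1)))"

end

(*
  Put omega_i = sum_{l <= i} (q_l - p_l) y_l x_l. The omega_i commute with each other and q-commute with
  all x_j and y_j, so z_{2i-1} = y_i and z_{2i} = y_i^{-1} omega_i satisfy the relations of the quantum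
  space for Lambda; conversely x_i = (q_i - p_i)^{-1} y_i^{-1} (omega_i - omega_{i-1}) with
  omega_i = z_{2i-1} z_{2i}. Hence both algebras map to the quantum torus T of Lambda. Both maps are
  injective: after straightening words, the ordered monomials span the algebra, and their images have
  pairwise distinct trailing exponents. Both images contain enough monomials for every pair of
  elements of T to have a common monomial denominator, so both algebras have the same division ring of
  fractions as T. That T is an Ore domain follows by comparing trailing terms and from its polynomial
  growth: the equation f u = g v, for u and v supported in a large box of exponents, has more
  unknowns than equations.
*)

theory Submission
  imports Complex_Main "HOL-Library.Multiset" Defs
begin

section \<open>Ore localization\<close>

text \<open>The relation for x_i y_i says that x_i y_i - q_i y_i x_i = omega_{i-1}, hence also x_i
  y_i - p_i y_i x_i = omega_i: the inhomogeneous part of the relations is made of elements that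
  commute with every generator up to a scalar. The hypothesis p_i \<noteq> q_i is what lets x_i be
  recovered from y_i, omega_i and omega_{i-1}. The obstacle is that both algebras are given as
  quotients of free algebras: neither is known beforehand to be a domain, to have the ordered
  monomials as a basis, or to be an Ore domain. T is explicit: finitely supported functions with a
  twisted convolution. It is therefore treated directly and the rest is pulled back from it.
  Injectivity of a map to T and independence of the ordered monomials come out together, with no
  confluence check of the relations; the domain property and the Ore conditions are inherited
  through common denominators. Both one-sided Ore conditions are carried along: \<open>Frac\<close>
  consists of right fractions, but a division ring of fractions must consist of left fractions as
  well. The counting argument for T is plain linear algebra, so it is blind to the characteristic
  and to roots of unity.\<close>

locale ore_domain = k_algebra A for A :: "('k::field, 'a) module" (structure) +
  assumes nontrivial: "\<one> \<noteq> \<zero>"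
    and no_zero_div: "\<lbrakk>a \<in> carrier A; b \<in> carrier A; a \<otimes> b = \<zero>\<rbrakk> \<Longrightarrow> a = \<zero> \<or> b = \<zero>"
    and right_ore: "\<lbrakk>a \<in> carrier A - {\<zero>}; b \<in> carrier A - {\<zero>}\<rbrakk> \<Longrightarrow>
      \<exists>u\<in>carrier A. \<exists>v\<in>carrier A. a \<otimes> u = b \<otimes> v \<and> a \<otimes> u \<noteq> \<zero>"
    and left_ore: "\<lbrakk>a \<in> carrier A - {\<zero>}; b \<in> carrier A - {\<zero>}\<rbrakk> \<Longrightarrow>
      \<exists>u\<in>carrier A. \<exists>v\<in>carrier A. u \<otimes> a = v \<otimes> b \<and> u \<otimes> a \<noteq> \<zero>"
begin

definition R0 where "R0 = carrier A - {\<zero>}"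

lemma R0I: "\<lbrakk>a \<in> carrier A; a \<noteq> \<zero>\<rbrakk> \<Longrightarrow> a \<in> R0"
  and R0_closed: "a \<in> R0 \<Longrightarrow> a \<in> carrier A"
  and R0_nonzero: "a \<in> R0 \<Longrightarrow> a \<noteq> \<zero>"
  and R0_one: "\<one> \<in> R0"
  by (auto simp: R0_def nontrivial)

lemma R0_mult: "\<lbrakk>a \<in> R0; b \<in> R0\<rbrakk> \<Longrightarrow> a \<otimes> b \<in> R0"
  using no_zero_div by (auto simp: R0_def)

lemma R0_factors:
  assumes "a \<otimes> b \<noteq> \<zero>" "a \<in> carrier A" "b \<in> carrier A"
  shows "a \<in> R0" "b \<in> R0"
  using assms by (auto simp: R0_def)

lemma mult_right_cancel_R0:
  assumes "a \<otimes> c = b \<otimes> c" "a \<in> carrier A" "b \<in> carrier A" "c \<in> R0"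
  shows "a = b"
proof -
  have c: "c \<in> carrier A" using assms R0_closed by auto
  have "(a \<ominus> b) \<otimes> c = \<zero>"
    using assms c by (simp add: minus_eq l_distr l_minus r_neg)
  then have "a \<ominus> b = \<zero>"
    using no_zero_div[of "a \<ominus> b" c] assms c R0_nonzero by auto
  then show ?thesis using minus_equality[of a "\<ominus> b"] assms by (simp add: minus_eq)
qed

lemma mult_left_cancel_R0:
  assumes "c \<otimes> a = c \<otimes> b" "a \<in> carrier A" "b \<in> carrier A" "c \<in> R0"
  shows "a = b"
proof -
  have c: "c \<in> carrier A" using assms R0_closed by auto
  have "c \<otimes> (a \<ominus> b) = \<zero>"
    using assms c by (simp add: minus_eq r_distr r_minus r_neg)
  then have "a \<ominus> b = \<zero>"
    using no_zero_div[of c "a \<ominus> b"] assms c R0_nonzero by auto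
  then show ?thesis using minus_equality[of a "\<ominus> b"] assms by (simp add: minus_eq)
qed

lemma right_ore':
  assumes "a \<in> R0" "b \<in> R0"
  shows "\<exists>u\<in>R0. \<exists>v\<in>R0. a \<otimes> u = b \<otimes> v"
proof -
  obtain u v where uv: "u \<in> carrier A" "v \<in> carrier A" "a \<otimes> u = b \<otimes> v" "a \<otimes> u \<noteq> \<zero>"
    using right_ore[OF assms[unfolded R0_def]] by (elim bexE conjE)
  have "b \<otimes> v \<noteq> \<zero>" using uv(3,4) by argo
  then have "u \<in> R0" "v \<in> R0"
    using R0_factors(2)[OF uv(4)] R0_factors(2)[of b v] uv(1,2) assms[THEN R0_closed] by simp_all
  with uv(3) show ?thesis by (intro bexI)
qed

lemma left_ore':
  assumes "a \<in> R0" "b \<in> R0"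
  shows "\<exists>u\<in>R0. \<exists>v\<in>R0. u \<otimes> a = v \<otimes> b"
proof -
  obtain u v where uv: "u \<in> carrier A" "v \<in> carrier A" "u \<otimes> a = v \<otimes> b" "u \<otimes> a \<noteq> \<zero>"
    using left_ore[OF assms[unfolded R0_def]] by (elim bexE conjE)
  have "v \<otimes> b \<noteq> \<zero>" using uv(3,4) by argo
  then have "u \<in> R0" "v \<in> R0"
    using R0_factors(1)[OF uv(4)] R0_factors(1)[of v b] uv(1,2) assms[THEN R0_closed] by simp_all
  with uv(3) show ?thesis by (intro bexI)
qed

text \<open>Multiplying fractions requires s c = b u with only u nonzero, because the numerator b
  may vanish; in that case c = 0 and u = 1 will do.\<close>

lemma right_ore_zero:
  assumes "s \<in> R0" "b \<in> carrier A"
  shows "\<exists>c\<in>carrier A. \<exists>u\<in>R0. s \<otimes> c = b \<otimes> u"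
proof (cases "b = \<zero>")
  case True
  then have "s \<otimes> \<zero> = b \<otimes> \<one>" using R0_closed[OF assms(1)] by simp
  then show ?thesis using zero_closed R0_one by metis
next
  case False
  then show ?thesis using right_ore'[OF assms(1) R0I[OF assms(2)]] R0_closed by metis
qed

lemma left_ore_zero:
  assumes "s \<in> R0" "b \<in> carrier A"
  shows "\<exists>c\<in>carrier A. \<exists>u\<in>R0. c \<otimes> s = u \<otimes> b"
proof (cases "b = \<zero>")
  case True
  then have "\<zero> \<otimes> s = \<one> \<otimes> b" using R0_closed[OF assms(1)] by simp
  then show ?thesis using zero_closed R0_one by metis
next
  case False
  then show ?thesis using left_ore'[OF assms(1) R0I[OF assms(2)]] R0_closed by metis
qed

subsection \<open>Right fractions\<close>

text \<open>In a domain a nonzero common multiple s u = t v has both cofactors nonzero. This form is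
  visibly symmetric in the two fractions.\<close>

lemma ore_rel_iff:
  "((a, s), (b, t)) \<in> ore_rel A \<longleftrightarrow> a \<in> carrier A \<and> b \<in> carrier A \<and> s \<in> R0 \<and> t \<in> R0 \<and>
     (\<exists>u\<in>R0. \<exists>v\<in>R0. s \<otimes> u = t \<otimes> v \<and> a \<otimes> u = b \<otimes> v)"
  (is "?l \<longleftrightarrow> ?r")
proof
  assume ?l
  then obtain u v where h: "a \<in> carrier A" "b \<in> carrier A" "s \<in> R0" "t \<in> R0"
    "u \<in> carrier A" "v \<in> carrier A" "s \<otimes> u = t \<otimes> v" "s \<otimes> u \<noteq> \<zero>" "a \<otimes> u = b \<otimes> v"
    unfolding ore_rel_def R0_def mem_Collect_eq prod.case Diff_iff singleton_iff by (elim conjE bexE) blast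
  have "t \<otimes> v \<noteq> \<zero>" using h(7,8) by argo
  then have "u \<in> R0" "v \<in> R0"
    using R0_factors(2)[OF h(8)] R0_factors(2)[of t v] h(3,4)[THEN R0_closed] h(5,6) by simp_all
  with h show ?r by blast
next
  assume ?r
  then obtain u v where h: "a \<in> carrier A" "b \<in> carrier A" "s \<in> R0" "t \<in> R0"
    "u \<in> R0" "v \<in> R0" "s \<otimes> u = t \<otimes> v" "a \<otimes> u = b \<otimes> v" by blast
  then have "s \<otimes> u \<noteq> \<zero>" using R0_mult R0_nonzero by blast
  moreover have "u \<in> carrier A" "v \<in> carrier A" using h R0_closed by auto
  ultimately have "\<exists>u\<in>carrier A. \<exists>v\<in>carrier A. s \<otimes> u = t \<otimes> v \<and> s \<otimes> u \<noteq> \<zero> \<and> a \<otimes> u = b \<otimes> v"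
    using h by blast
  then show ?l using h by (simp add: ore_rel_def R0_def)
qed

text \<open>
  Related fractions agree over \<^emph>\<open>every\<close> common multiple of their denominators, so that any
  convenient one may be chosen when computing with classes.
\<close>

lemma ore_rel_transfer:
  assumes r: "((a, s), (b, t)) \<in> ore_rel A"
    and uv: "u \<in> carrier A" "v \<in> carrier A" "s \<otimes> u = t \<otimes> v"
  shows "a \<otimes> u = b \<otimes> v"
proof -
  obtain x y where c: "a \<in> carrier A" "b \<in> carrier A" "s \<in> R0" "t \<in> R0"
    "x \<in> R0" "y \<in> R0" "s \<otimes> x = t \<otimes> y" "a \<otimes> x = b \<otimes> y"
    using r ore_rel_iff by auto
  \<comment> \<open>Compare the given multiple s u with the witnessing one s x. Here u may be zero,
    so only w is known to be nonzero, and w is the factor cancelled at the end; cancelling t carries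
    the equation over from x, u to y, v.\<close>
  obtain z w where zw: "z \<in> carrier A" "w \<in> R0" "x \<otimes> z = u \<otimes> w"
    using right_ore_zero c(5) uv(1) by metis
  note cl = c(1,2) R0_closed[OF c(3)] R0_closed[OF c(4)] R0_closed[OF c(5)] R0_closed[OF c(6)]
    uv(1,2) zw(1) R0_closed[OF zw(2)]
  have "t \<otimes> (y \<otimes> z) = s \<otimes> x \<otimes> z" using cl c(7) by (simp add: m_assoc[symmetric])
  also have "\<dots> = s \<otimes> (u \<otimes> w)" using cl zw(3) by (simp add: m_assoc)
  also have "\<dots> = t \<otimes> (v \<otimes> w)" using cl uv(3) by (simp add: m_assoc[symmetric])
  finally have yz: "y \<otimes> z = v \<otimes> w" using mult_left_cancel_R0[of t] c(4) cl by simp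
  have "(a \<otimes> u) \<otimes> w = a \<otimes> x \<otimes> z" using cl zw(3) by (simp add: m_assoc)
  also have "\<dots> = b \<otimes> (y \<otimes> z)" using cl c(8) by (simp add: m_assoc)
  also have "\<dots> = (b \<otimes> v) \<otimes> w" using cl yz by (simp add: m_assoc)
  finally show ?thesis using mult_right_cancel_R0 zw(2) cl by simp
qed

lemma ore_relI:
  assumes "a \<in> carrier A" "b \<in> carrier A" "s \<in> R0" "t \<in> R0" "u \<in> R0" "v \<in> R0"
    "s \<otimes> u = t \<otimes> v" "a \<otimes> u = b \<otimes> v"
  shows "((a, s), (b, t)) \<in> ore_rel A"
  using assms ore_rel_iff by blast

lemma ore_rel_equiv: "equiv (carrier A \<times> R0) (ore_rel A)"
proof (rule equivI)
  show "ore_rel A \<subseteq> (carrier A \<times> R0) \<times> (carrier A \<times> R0)" by (auto simp: ore_rel_iff)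
  show "refl_on (carrier A \<times> R0) (ore_rel A)"
    using R0_one by (auto simp: refl_on_def ore_rel_iff)
  show "sym (ore_rel A)"
    by (rule symI) (auto simp: ore_rel_iff, metis)
  show "trans (ore_rel A)"
  proof (rule transI, clarify)
    fix a s b t c w
    assume 1: "((a, s), (b, t)) \<in> ore_rel A" and 2: "((b, t), (c, w)) \<in> ore_rel A"
    then have m: "a \<in> carrier A" "c \<in> carrier A" "s \<in> R0" "t \<in> R0" "w \<in> R0"
      by (auto simp: ore_rel_iff)
    obtain u v where uv: "u \<in> R0" "v \<in> R0" "s \<otimes> u = t \<otimes> v" using right_ore' m by metis
    \<comment> \<open>The common multiple of s and t is extended to one of all three denominators,
      over which both given relations can be read off.\<close>
    obtain y z where yz: "y \<in> R0" "z \<in> R0" "(t \<otimes> v) \<otimes> y = w \<otimes> z"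
      using right_ore' m R0_mult uv by metis
    note cl = R0_closed[OF m(3)] R0_closed[OF m(4)] R0_closed[OF m(5)]
      R0_closed[OF uv(1)] R0_closed[OF uv(2)] R0_closed[OF yz(1)] R0_closed[OF yz(2)]
    have e1: "s \<otimes> (u \<otimes> y) = t \<otimes> (v \<otimes> y)" using uv(3) cl by (simp add: m_assoc[symmetric])
    have e2: "t \<otimes> (v \<otimes> y) = w \<otimes> z" using yz(3) cl by (simp add: m_assoc)
    have "a \<otimes> (u \<otimes> y) = b \<otimes> (v \<otimes> y)" by (rule ore_rel_transfer[OF 1]) (use cl e1 in auto)
    moreover have "b \<otimes> (v \<otimes> y) = c \<otimes> z" by (rule ore_rel_transfer[OF 2]) (use cl e2 in auto)
    ultimately show "((a, s), (c, w)) \<in> ore_rel A"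
      using m R0_mult[OF uv(1) yz(1)] yz(2) e1 e2 by (intro ore_relI[of a c s w "u \<otimes> y" z]) auto
  qed
qed

abbreviation fr where "fr \<equiv> ore_frac A"

lemma fr_eq_iff_rel:
  assumes "a \<in> carrier A" "b \<in> carrier A" "s \<in> R0" "t \<in> R0"
  shows "fr a s = fr b t \<longleftrightarrow> ((a, s), (b, t)) \<in> ore_rel A"
  unfolding ore_frac_def using assms by (intro eq_equiv_class_iff[OF ore_rel_equiv]) auto

lemma fr_eq_iff:
  assumes "a \<in> carrier A" "b \<in> carrier A" "s \<in> R0" "t \<in> R0" "u \<in> R0" "v \<in> R0" "s \<otimes> u = t \<otimes> v"
  shows "fr a s = fr b t \<longleftrightarrow> a \<otimes> u = b \<otimes> v"
  unfolding fr_eq_iff_rel[OF assms(1-4)]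
  using ore_rel_transfer[OF _ R0_closed[OF assms(5)] R0_closed[OF assms(6)] assms(7)] ore_relI[OF assms]
  by blast

lemma fr_eq_transfer:
  assumes "fr a s = fr b t" "a \<in> carrier A" "b \<in> carrier A" "s \<in> R0" "t \<in> R0"
    "u \<in> carrier A" "v \<in> carrier A" "s \<otimes> u = t \<otimes> v"
  shows "a \<otimes> u = b \<otimes> v"
  using assms(1) unfolding fr_eq_iff_rel[OF assms(2-5)] by (rule ore_rel_transfer[OF _ assms(6-8)])

lemma fr_same_denom_iff:
  assumes "a \<in> carrier A" "b \<in> carrier A" "s \<in> R0"
  shows "fr a s = fr b s \<longleftrightarrow> a = b"
  using fr_eq_iff[OF assms(1,2,3,3) R0_one R0_one refl] assms by simp

lemma fr_expand:
  assumes "a \<in> carrier A" "s \<in> R0" "u \<in> R0"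
  shows "fr (a \<otimes> u) (s \<otimes> u) = fr a s"
  by (subst fr_eq_iff[OF _ assms(1) R0_mult[OF assms(2,3)] assms(2) R0_one assms(3)])
    (use assms R0_closed in simp_all)

lemma fr_mem_iff:
  assumes "a \<in> carrier A" "s \<in> R0"
  shows "(b, t) \<in> fr a s \<longleftrightarrow> b \<in> carrier A \<and> t \<in> R0 \<and> fr b t = fr a s"
proof -
  have 1: "(b, t) \<in> fr a s \<longleftrightarrow> ((a, s), (b, t)) \<in> ore_rel A"
    by (simp add: ore_frac_def)
  have 2: "b \<in> carrier A \<and> t \<in> R0" if "((a, s), (b, t)) \<in> ore_rel A"
    using that unfolding ore_rel_iff by blast
  show ?thesis
    unfolding 1 using 2 fr_eq_iff_rel[OF assms(1) _ assms(2), of b t] by metis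
qed

lemma carrier_Frac: "carrier (Frac A) = {fr a s | a s. a \<in> carrier A \<and> s \<in> R0}"
  by (auto simp: Frac_def quotient_def ore_frac_def R0_def)

lemma fr_closed: "\<lbrakk>a \<in> carrier A; s \<in> R0\<rbrakk> \<Longrightarrow> fr a s \<in> carrier (Frac A)"
  by (auto simp: carrier_Frac)

lemma Frac_rep:
  assumes "x \<in> carrier (Frac A)"
  shows "\<exists>a\<in>carrier A. \<exists>s\<in>R0. x = fr a s"
  using assms by (auto simp: carrier_Frac)

lemma common_denom2:
  assumes "x \<in> carrier (Frac A)" "y \<in> carrier (Frac A)"
  shows "\<exists>a\<in>carrier A. \<exists>b\<in>carrier A. \<exists>s\<in>R0. x = fr a s \<and> y = fr b s"
proof -
  obtain a s where x: "a \<in> carrier A" "s \<in> R0" "x = fr a s" using Frac_rep[OF assms(1)] by blast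
  obtain b t where y: "b \<in> carrier A" "t \<in> R0" "y = fr b t" using Frac_rep[OF assms(2)] by blast
  obtain u v where uv: "u \<in> R0" "v \<in> R0" "s \<otimes> u = t \<otimes> v" using right_ore'[OF x(2) y(2)] by blast
  have "x = fr (a \<otimes> u) (s \<otimes> u)" using fr_expand[OF x(1,2) uv(1)] x(3) by simp
  moreover have "y = fr (b \<otimes> v) (s \<otimes> u)" using fr_expand[OF y(1,2) uv(2)] y(3) uv(3) by simp
  moreover have "a \<otimes> u \<in> carrier A" "b \<otimes> v \<in> carrier A" "s \<otimes> u \<in> R0"
    using x y uv R0_closed R0_mult by simp_all
  ultimately show ?thesis by blast
qed

lemma common_denom3:
  assumes "x \<in> carrier (Frac A)" "y \<in> carrier (Frac A)" "z \<in> carrier (Frac A)"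
  shows "\<exists>a\<in>carrier A. \<exists>b\<in>carrier A. \<exists>c\<in>carrier A. \<exists>s\<in>R0. x = fr a s \<and> y = fr b s \<and> z = fr c s"
proof -
  obtain a b s where xy: "a \<in> carrier A" "b \<in> carrier A" "s \<in> R0" "x = fr a s" "y = fr b s"
    using common_denom2[OF assms(1,2)] by blast
  obtain c t where z: "c \<in> carrier A" "t \<in> R0" "z = fr c t" using Frac_rep[OF assms(3)] by blast
  obtain u v where uv: "u \<in> R0" "v \<in> R0" "s \<otimes> u = t \<otimes> v" using right_ore'[OF xy(3) z(2)] by blast
  have "x = fr (a \<otimes> u) (s \<otimes> u)" "y = fr (b \<otimes> u) (s \<otimes> u)" 
    using fr_expand[OF xy(1,3) uv(1)] fr_expand[OF xy(2,3) uv(1)] xy(4,5) by simp_all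
  moreover have "z = fr (c \<otimes> v) (s \<otimes> u)" using fr_expand[OF z(1,2) uv(2)] z(3) uv(3) by simp
  moreover have "a \<otimes> u \<in> carrier A" "b \<otimes> u \<in> carrier A" "c \<otimes> v \<in> carrier A" "s \<otimes> u \<in> R0"
    using xy z uv R0_closed R0_mult by simp_all
  ultimately show ?thesis by blast
qed

text \<open>
  A second factor written as \<open>(s c) t\<^sup>-\<^sup>1\<close> cancels against the denominator of \<open>a s\<^sup>-\<^sup>1\<close>; this
  makes associativity and distributivity immediate.
\<close>

lemma chain_rep:
  assumes "s \<in> R0" "y \<in> carrier (Frac A)"
  shows "\<exists>c\<in>carrier A. \<exists>t\<in>R0. y = fr (s \<otimes> c) t"
proof -
  obtain b t where y: "b \<in> carrier A" "t \<in> R0" "y = fr b t" using Frac_rep[OF assms(2)] by blast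
  obtain c u where cu: "c \<in> carrier A" "u \<in> R0" "s \<otimes> c = b \<otimes> u"
    using right_ore_zero[OF assms(1) y(1)] by blast
  have "y = fr (s \<otimes> c) (t \<otimes> u)" using fr_expand[OF y(1,2) cu(2)] y(3) cu(3) by simp
  then show ?thesis using cu(1) R0_mult[OF y(2) cu(2)] by blast
qed

text \<open>Made for left distributivity: the two summands need a common denominator and, at the
  same time, numerators that cancel against the denominator of the left factor.\<close>

lemma chain_rep2:
  assumes "s \<in> R0" "y \<in> carrier (Frac A)" "z \<in> carrier (Frac A)"
  shows "\<exists>c\<in>carrier A. \<exists>d\<in>carrier A. \<exists>t\<in>R0. y = fr (s \<otimes> c) t \<and> z = fr (s \<otimes> d) t"
proof -
  obtain c t where y: "c \<in> carrier A" "t \<in> R0" "y = fr (s \<otimes> c) t" using chain_rep[OF assms(1,2)] by blast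
  obtain d w where z: "d \<in> carrier A" "w \<in> R0" "z = fr (s \<otimes> d) w" using chain_rep[OF assms(1,3)] by blast
  obtain u v where uv: "u \<in> R0" "v \<in> R0" "t \<otimes> u = w \<otimes> v" using right_ore'[OF y(2) z(2)] by blast
  note cl = R0_closed[OF assms(1)] R0_closed[OF uv(1)] R0_closed[OF uv(2)]
  have "y = fr (s \<otimes> c \<otimes> u) (t \<otimes> u)" "z = fr (s \<otimes> d \<otimes> v) (t \<otimes> u)"
    using fr_expand[OF _ y(2) uv(1), of "s \<otimes> c"] fr_expand[OF _ z(2) uv(2), of "s \<otimes> d"] y z uv(3) cl
    by simp_all
  then have "y = fr (s \<otimes> (c \<otimes> u)) (t \<otimes> u)" "z = fr (s \<otimes> (d \<otimes> v)) (t \<otimes> u)"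
    using y z cl by (simp_all add: m_assoc)
  moreover have "c \<otimes> u \<in> carrier A" "d \<otimes> v \<in> carrier A" "t \<otimes> u \<in> R0"
    using y z uv cl R0_mult by simp_all
  ultimately show ?thesis by blast
qed

text \<open>The operations of \<open>Frac\<close> are unions over all representatives and all
  choices of multipliers. Once each choice is shown to give the same class, the union is that class,
  so independence of choices and the computation rule are proved together.\<close>

lemma Union_const:
  assumes "\<And>X. X \<in> S \<Longrightarrow> X = C" "S \<noteq> {}"
  shows "\<Union> S = C"
  using assms by blast

section \<open>The division ring structure on right fractions\<close>

lemma add_Frac:
  assumes "a \<in> carrier A" "b \<in> carrier A" "s \<in> R0"
  shows "fr a s \<oplus>\<^bsub>Frac A\<^esub> fr b s = fr (a \<oplus> b) s"
proof -
  have "fr (a' \<otimes> u \<oplus> b' \<otimes> v) (s' \<otimes> u) = fr (a \<oplus> b) s"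
    if m: "(a', s') \<in> fr a s" "(b', t') \<in> fr b s"
      and uv: "u \<in> carrier A" "v \<in> carrier A" "s' \<otimes> u = t' \<otimes> v" "s' \<otimes> u \<noteq> \<zero>"
    for a' s' b' t' u v
  proof -
    have m': "a' \<in> carrier A" "s' \<in> R0" "fr a' s' = fr a s" "b' \<in> carrier A" "t' \<in> R0" "fr b' t' = fr b s"
      using m unfolding fr_mem_iff[OF assms(1,3)] fr_mem_iff[OF assms(2,3)] by blast+
    have R: "s' \<otimes> u \<in> R0" using R0I[OF m_closed[OF R0_closed[OF m'(2)] uv(1)] uv(4)] .
    obtain x y where xy: "x \<in> R0" "y \<in> R0" "(s' \<otimes> u) \<otimes> x = s \<otimes> y"
      using right_ore'[OF R assms(3)] by blast
    note cl = m'(1,4) R0_closed[OF m'(2)] R0_closed[OF m'(5)] uv(1,2) R0_closed[OF xy(1)]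
      R0_closed[OF xy(2)] assms(1,2) R0_closed[OF assms(3)]
    have e: "s' \<otimes> (u \<otimes> x) = s \<otimes> y" using xy(3) cl by (simp add: m_assoc)
    have "t' \<otimes> (v \<otimes> x) = s' \<otimes> u \<otimes> x" unfolding uv(3) using cl by (simp add: m_assoc)
    then have e': "t' \<otimes> (v \<otimes> x) = s \<otimes> y" using xy(3) by simp
    have "a' \<otimes> (u \<otimes> x) = a \<otimes> y"
      by (rule fr_eq_transfer[OF m'(3,1) assms(1) m'(2) assms(3) _ _ e]) (use cl in simp_all)
    moreover have "b' \<otimes> (v \<otimes> x) = b \<otimes> y"
      by (rule fr_eq_transfer[OF m'(6,4) assms(2) m'(5) assms(3) _ _ e']) (use cl in simp_all)
    ultimately have "(a' \<otimes> u \<oplus> b' \<otimes> v) \<otimes> x = (a \<oplus> b) \<otimes> y"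
      using cl by (simp add: l_distr m_assoc)
    then show ?thesis using cl by (subst fr_eq_iff[OF _ _ R assms(3) xy]) simp_all
  qed
  moreover have "(a, s) \<in> fr a s" "(b, s) \<in> fr b s" using assms fr_mem_iff by simp_all
  moreover have "s \<otimes> \<one> \<noteq> \<zero>" using R0_closed[OF assms(3)] R0_nonzero[OF assms(3)] by simp
  ultimately show ?thesis
    unfolding Frac_def ring_record_simps by (intro Union_const) (blast, fast)
qed

text \<open>Over a common multiple of the two result denominators the numerators of the second
  factor agree. Since these numerators are multiples of the denominators of the first factor, this
  is also a common multiple of s' and s, over which the numerators of the first factor
  agree.\<close>

lemma mult_Frac:
  assumes "a \<in> carrier A" "s \<in> R0" "c \<in> carrier A" "t \<in> R0"
  shows "fr a s \<otimes>\<^bsub>Frac A\<^esub> fr (s \<otimes> c) t = fr (a \<otimes> c) t"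
proof -
  have sc: "s \<otimes> c \<in> carrier A" using assms R0_closed by auto
  have "fr (a' \<otimes> c') (t' \<otimes> u) = fr (a \<otimes> c) t"
    if m: "(a', s') \<in> fr a s" "(b', t') \<in> fr (s \<otimes> c) t"
      and cu: "c' \<in> carrier A" "u \<in> R0" "s' \<otimes> c' = b' \<otimes> u"
    for a' s' b' t' c' u
  proof -
    have m': "a' \<in> carrier A" "s' \<in> R0" "fr a' s' = fr a s"
      "b' \<in> carrier A" "t' \<in> R0" "fr b' t' = fr (s \<otimes> c) t"
      using m unfolding fr_mem_iff[OF assms(1,2)] fr_mem_iff[OF sc assms(4)] by blast+
    have R: "t' \<otimes> u \<in> R0" by (rule R0_mult[OF m'(5) cu(2)])
    obtain x y where xy: "x \<in> R0" "y \<in> R0" "(t' \<otimes> u) \<otimes> x = t \<otimes> y"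
      using right_ore'[OF R assms(4)] by blast
    note cl = m'(1,4) R0_closed[OF m'(2)] R0_closed[OF m'(5)] cu(1) R0_closed[OF cu(2)] R0_closed[OF xy(1)]
      R0_closed[OF xy(2)] assms(1,3) R0_closed[OF assms(2)] R0_closed[OF assms(4)]
    have e: "t' \<otimes> (u \<otimes> x) = t \<otimes> y" using xy(3) cl by (simp add: m_assoc)
    have b: "b' \<otimes> (u \<otimes> x) = s \<otimes> c \<otimes> y"
      by (rule fr_eq_transfer[OF m'(6,4) sc m'(5) assms(4) _ _ e]) (use cl in simp_all)
    have "s' \<otimes> (c' \<otimes> x) = s' \<otimes> c' \<otimes> x" using cl by (simp add: m_assoc)
    also have "\<dots> = s \<otimes> (c \<otimes> y)" unfolding cu(3) using b cl by (simp add: m_assoc)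
    finally have e': "s' \<otimes> (c' \<otimes> x) = s \<otimes> (c \<otimes> y)" .
    have "a' \<otimes> (c' \<otimes> x) = a \<otimes> (c \<otimes> y)"
      by (rule fr_eq_transfer[OF m'(3,1) assms(1) m'(2) assms(2) _ _ e']) (use cl in simp_all)
    then have "(a' \<otimes> c') \<otimes> x = (a \<otimes> c) \<otimes> y" using cl by (simp add: m_assoc)
    then show ?thesis using cl by (subst fr_eq_iff[OF _ _ R assms(4) xy]) simp_all
  qed
  moreover have "(a, s) \<in> fr a s" "(s \<otimes> c, t) \<in> fr (s \<otimes> c) t" using assms sc fr_mem_iff by simp_all
  \<comment> \<open>The choice \<open>u = \<one>\<close> shows that the union is taken over a
    nonempty set.\<close>
  moreover have "s \<otimes> c = (s \<otimes> c) \<otimes> \<one>" using sc by simp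
  moreover have "fr (a \<otimes> c) (t \<otimes> \<one>) = fr (a \<otimes> c) t" using R0_closed[OF assms(4)] by simp
  ultimately show ?thesis
    using assms(3) R0_one unfolding Frac_def ring_record_simps R0_def[symmetric]
    by (intro Union_const) (blast, fast)
qed

lemma smult_Frac:
  assumes "a \<in> carrier A" "s \<in> R0"
  shows "c \<odot>\<^bsub>Frac A\<^esub> fr a s = fr (c \<odot> a) s"
proof -
  have "fr (c \<odot> a') s' = fr (c \<odot> a) s" if m: "(a', s') \<in> fr a s" for a' s'
  proof -
    have m': "a' \<in> carrier A" "s' \<in> R0" "fr a' s' = fr a s" 
      using m unfolding fr_mem_iff[OF assms] by blast+
    obtain x y where xy: "x \<in> R0" "y \<in> R0" "s' \<otimes> x = s \<otimes> y"
      using right_ore'[OF m'(2) assms(2)] by blast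
    have "a' \<otimes> x = a \<otimes> y"
      by (rule fr_eq_transfer[OF m'(3,1) assms(1) m'(2) assms(2) R0_closed[OF xy(1)] R0_closed[OF xy(2)] xy(3)])
    then have "(c \<odot> a') \<otimes> x = (c \<odot> a) \<otimes> y"
      using m'(1) assms(1) xy(1,2)[THEN R0_closed] by (simp add: smult_mult_l)
    then show ?thesis using m'(1) assms(1) smult_closed by (subst fr_eq_iff[OF _ _ m'(2) assms(2) xy]) simp_all
  qed
  moreover have "(a, s) \<in> fr a s" using assms fr_mem_iff by simp
  ultimately show ?thesis unfolding Frac_def module.simps by (intro Union_const) (blast, fast)
qed

lemma zero_Frac: "s \<in> R0 \<Longrightarrow> fr \<zero> s = \<zero>\<^bsub>Frac A\<^esub>"
  unfolding Frac_def ring_record_simps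
  by (subst fr_eq_iff[OF _ _ _ R0_one R0_one, where v = s]) (use R0_closed in simp_all)

lemma one_Frac: "s \<in> R0 \<Longrightarrow> fr s s = \<one>\<^bsub>Frac A\<^esub>"
  unfolding Frac_def ring_record_simps monoid.simps
  by (subst fr_eq_iff[OF _ _ _ R0_one R0_one, where v = s]) (use R0_closed in simp_all)

lemma mult_Frac_inverse: "\<lbrakk>a \<in> carrier A; s \<in> R0; t \<in> R0\<rbrakk> \<Longrightarrow> fr a s \<otimes>\<^bsub>Frac A\<^esub> fr s t = fr a t"
  using mult_Frac[of a s \<one> t] R0_closed by simp

lemma mult_Frac_denom_one:
  "\<lbrakk>a \<in> carrier A; c \<in> carrier A; t \<in> R0\<rbrakk> \<Longrightarrow> fr a \<one> \<otimes>\<^bsub>Frac A\<^esub> fr c t = fr (a \<otimes> c) t"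
  using mult_Frac[of a \<one> c t] R0_one by simp

lemma Frac_abelian_group: "abelian_group (Frac A)"
proof (rule abelian_groupI)
  fix x y assume h: "x \<in> carrier (Frac A)" "y \<in> carrier (Frac A)"
  obtain a b s where "a \<in> carrier A" "b \<in> carrier A" "s \<in> R0" "x = fr a s" "y = fr b s"
    using common_denom2[OF h] by blast
  then show "x \<oplus>\<^bsub>Frac A\<^esub> y \<in> carrier (Frac A)" by (simp add: add_Frac fr_closed)
next
  show "\<zero>\<^bsub>Frac A\<^esub> \<in> carrier (Frac A)"
    using zero_Frac[OF R0_one] fr_closed[of \<zero> \<one>] R0_one by simp
next
  fix x y z assume "x \<in> carrier (Frac A)" "y \<in> carrier (Frac A)" "z \<in> carrier (Frac A)"
  then obtain a b c s where "a \<in> carrier A" "b \<in> carrier A" "c \<in> carrier A" "s \<in> R0"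
    "x = fr a s" "y = fr b s" "z = fr c s" using common_denom3[of x y z] by blast
  then show "x \<oplus>\<^bsub>Frac A\<^esub> y \<oplus>\<^bsub>Frac A\<^esub> z = x \<oplus>\<^bsub>Frac A\<^esub> (y \<oplus>\<^bsub>Frac A\<^esub> z)"
    by (simp add: add_Frac a_assoc)
next
  fix x y assume "x \<in> carrier (Frac A)" "y \<in> carrier (Frac A)"
  then obtain a b s where "a \<in> carrier A" "b \<in> carrier A" "s \<in> R0"
    "x = fr a s" "y = fr b s" using common_denom2[of x y] by blast
  then show "x \<oplus>\<^bsub>Frac A\<^esub> y = y \<oplus>\<^bsub>Frac A\<^esub> x" by (simp add: add_Frac a_comm)
next
  fix x assume "x \<in> carrier (Frac A)"
  then obtain a s where x: "a \<in> carrier A" "s \<in> R0" "x = fr a s" using Frac_rep by blast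
  then show "\<zero>\<^bsub>Frac A\<^esub> \<oplus>\<^bsub>Frac A\<^esub> x = x" using zero_Frac[of s] add_Frac[of \<zero> a s] by simp
  have "fr (\<ominus> a) s \<oplus>\<^bsub>Frac A\<^esub> x = \<zero>\<^bsub>Frac A\<^esub>" using x by (simp add: add_Frac l_neg zero_Frac)
  then show "\<exists>y\<in>carrier (Frac A). y \<oplus>\<^bsub>Frac A\<^esub> x = \<zero>\<^bsub>Frac A\<^esub>"
    using x fr_closed by blast
qed

lemma Frac_ring: "ring (Frac A)"
proof (rule ringI[OF Frac_abelian_group])
  show "Group.monoid (Frac A)"
  proof (rule monoidI)
    fix x y assume h: "x \<in> carrier (Frac A)" "y \<in> carrier (Frac A)"
    obtain a s where x: "a \<in> carrier A" "s \<in> R0" "x = fr a s" using Frac_rep[OF h(1)] by blast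
    obtain c t where y: "c \<in> carrier A" "t \<in> R0" "y = fr (s \<otimes> c) t" using chain_rep[OF x(2) h(2)] by blast
    show "x \<otimes>\<^bsub>Frac A\<^esub> y \<in> carrier (Frac A)" using x y by (simp add: mult_Frac fr_closed)
  next
    show "\<one>\<^bsub>Frac A\<^esub> \<in> carrier (Frac A)"
      using one_Frac[OF R0_one] fr_closed[of \<one> \<one>] R0_one by simp
  next
    fix x y z assume h: "x \<in> carrier (Frac A)" "y \<in> carrier (Frac A)" "z \<in> carrier (Frac A)"
    then obtain a s where x: "a \<in> carrier A" "s \<in> R0" "x = fr a s" using Frac_rep by blast
    obtain c t where y: "c \<in> carrier A" "t \<in> R0" "y = fr (s \<otimes> c) t" using chain_rep[OF x(2) h(2)] by blast
    obtain d w where z: "d \<in> carrier A" "w \<in> R0" "z = fr (t \<otimes> d) w" using chain_rep[OF y(2) h(3)] by blast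
    have "y \<otimes>\<^bsub>Frac A\<^esub> z = fr (s \<otimes> (c \<otimes> d)) w"
      using x y z R0_closed by (simp add: mult_Frac m_assoc)
    then show "x \<otimes>\<^bsub>Frac A\<^esub> y \<otimes>\<^bsub>Frac A\<^esub> z = x \<otimes>\<^bsub>Frac A\<^esub> (y \<otimes>\<^bsub>Frac A\<^esub> z)"
      using x y z by (simp add: mult_Frac m_assoc)
  next
    fix x assume "x \<in> carrier (Frac A)"
    then obtain a s where x: "a \<in> carrier A" "s \<in> R0" "x = fr a s" using Frac_rep by blast
    then show "\<one>\<^bsub>Frac A\<^esub> \<otimes>\<^bsub>Frac A\<^esub> x = x"
      using one_Frac[OF R0_one] mult_Frac_denom_one[of \<one> a s] by simp
    show "x \<otimes>\<^bsub>Frac A\<^esub> \<one>\<^bsub>Frac A\<^esub> = x"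
      using one_Frac[of s] mult_Frac_inverse[of a s s] x by simp
  qed
next
  fix x y z assume h: "x \<in> carrier (Frac A)" "y \<in> carrier (Frac A)" "z \<in> carrier (Frac A)"
  {
    obtain a b s where xy: "a \<in> carrier A" "b \<in> carrier A" "s \<in> R0" "x = fr a s" "y = fr b s"
      using common_denom2[OF h(1,2)] by blast
    obtain c t where z: "c \<in> carrier A" "t \<in> R0" "z = fr (s \<otimes> c) t" using chain_rep[OF xy(3) h(3)] by blast
    show "(x \<oplus>\<^bsub>Frac A\<^esub> y) \<otimes>\<^bsub>Frac A\<^esub> z = x \<otimes>\<^bsub>Frac A\<^esub> z \<oplus>\<^bsub>Frac A\<^esub> y \<otimes>\<^bsub>Frac A\<^esub> z"
      using xy z by (simp add: mult_Frac add_Frac l_distr)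
  }
  {
    obtain c w where z: "c \<in> carrier A" "w \<in> R0" "z = fr c w" using Frac_rep[OF h(3)] by blast
    obtain a b s where xy: "a \<in> carrier A" "b \<in> carrier A" "s \<in> R0" "x = fr (w \<otimes> a) s" "y = fr (w \<otimes> b) s"
      using chain_rep2[OF z(2) h(1,2)] by blast
    have "x \<oplus>\<^bsub>Frac A\<^esub> y = fr (w \<otimes> (a \<oplus> b)) s"
      using xy z R0_closed by (simp add: add_Frac r_distr)
    then show "z \<otimes>\<^bsub>Frac A\<^esub> (x \<oplus>\<^bsub>Frac A\<^esub> y) = z \<otimes>\<^bsub>Frac A\<^esub> x \<oplus>\<^bsub>Frac A\<^esub> z \<otimes>\<^bsub>Frac A\<^esub> y"
      using xy z by (simp add: mult_Frac add_Frac r_distr)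
  }
qed

lemma Frac_k_algebra: "k_algebra (Frac A)"
proof (rule k_algebra.intro[OF Frac_ring], unfold_locales)
  fix x c d assume "x \<in> carrier (Frac A)"
  then obtain a s where x: "a \<in> carrier A" "s \<in> R0" "x = fr a s" using Frac_rep by blast
  show "c \<odot>\<^bsub>Frac A\<^esub> x \<in> carrier (Frac A)"
    using x by (simp add: smult_Frac fr_closed smult_closed)
  show "(c + d) \<odot>\<^bsub>Frac A\<^esub> x = c \<odot>\<^bsub>Frac A\<^esub> x \<oplus>\<^bsub>Frac A\<^esub> d \<odot>\<^bsub>Frac A\<^esub> x"
    using x by (simp add: smult_Frac add_Frac smult_closed smult_l_distr)
  show "(c * d) \<odot>\<^bsub>Frac A\<^esub> x = c \<odot>\<^bsub>Frac A\<^esub> (d \<odot>\<^bsub>Frac A\<^esub> x)"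
    using x by (simp add: smult_Frac smult_closed smult_assoc)
  show "1 \<odot>\<^bsub>Frac A\<^esub> x = x" using x by (simp add: smult_Frac smult_one)
next
  fix x y c assume h: "x \<in> carrier (Frac A)" "y \<in> carrier (Frac A)"
  {
    obtain a b s where xy: "a \<in> carrier A" "b \<in> carrier A" "s \<in> R0" "x = fr a s" "y = fr b s"
      using common_denom2[OF h(1,2)] by blast
    then show "c \<odot>\<^bsub>Frac A\<^esub> (x \<oplus>\<^bsub>Frac A\<^esub> y) = c \<odot>\<^bsub>Frac A\<^esub> x \<oplus>\<^bsub>Frac A\<^esub> c \<odot>\<^bsub>Frac A\<^esub> y"
      by (simp add: smult_Frac add_Frac smult_closed smult_r_distr)
  }
  obtain a s where x: "a \<in> carrier A" "s \<in> R0" "x = fr a s" using Frac_rep[OF h(1)] by blast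
  obtain b t where y: "b \<in> carrier A" "t \<in> R0" "y = fr (s \<otimes> b) t" using chain_rep[OF x(2) h(2)] by blast
  note sm = smult_Frac mult_Frac smult_closed smult_mult_l smult_mult_r R0_closed m_closed
  show "(c \<odot>\<^bsub>Frac A\<^esub> x) \<otimes>\<^bsub>Frac A\<^esub> y = c \<odot>\<^bsub>Frac A\<^esub> (x \<otimes>\<^bsub>Frac A\<^esub> y)"
    using x y by (simp add: sm)
  have cy: "c \<odot>\<^bsub>Frac A\<^esub> y = fr (s \<otimes> (c \<odot> b)) t" using x y by (simp add: sm)
  have "x \<otimes>\<^bsub>Frac A\<^esub> (c \<odot>\<^bsub>Frac A\<^esub> y) = fr (a \<otimes> (c \<odot> b)) t"
    unfolding cy x(3) by (rule mult_Frac[OF x(1,2) smult_closed[OF y(1)] y(2)])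
  then show "x \<otimes>\<^bsub>Frac A\<^esub> (c \<odot>\<^bsub>Frac A\<^esub> y) = c \<odot>\<^bsub>Frac A\<^esub> (x \<otimes>\<^bsub>Frac A\<^esub> y)"
    using x y by (simp add: sm)
qed

lemma fr_inverse:
  assumes "a \<in> R0" "s \<in> R0"
  shows "fr a s \<in> Units (Frac A)" "inv\<^bsub>Frac A\<^esub> (fr a s) = fr s a"
proof -
  interpret F: ring "Frac A" by (rule Frac_ring)
  have c: "fr a s \<in> carrier (Frac A)" "fr s a \<in> carrier (Frac A)"
    using assms fr_closed R0_closed by auto
  have e: "fr a s \<otimes>\<^bsub>Frac A\<^esub> fr s a = \<one>\<^bsub>Frac A\<^esub>" "fr s a \<otimes>\<^bsub>Frac A\<^esub> fr a s = \<one>\<^bsub>Frac A\<^esub>"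
    using assms mult_Frac_inverse R0_closed one_Frac by auto
  then show "fr a s \<in> Units (Frac A)" using c unfolding Units_def by blast
  show "inv\<^bsub>Frac A\<^esub> (fr a s) = fr s a" using F.inv_char[OF c e] .
qed

lemma fr_eq_zero_iff:
  assumes "a \<in> carrier A" "s \<in> R0"
  shows "fr a s = \<zero>\<^bsub>Frac A\<^esub> \<longleftrightarrow> a = \<zero>"
  using assms fr_same_denom_iff[of a \<zero> s] zero_Frac[of s] by simp

theorem has_division_ring_of_fractions: "has_division_ring_of_fractions A"
  unfolding has_division_ring_of_fractions_def is_division_ring_of_fractions_def
proof (intro conjI)
  interpret F: ring "Frac A" by (rule Frac_ring)
  show "k_algebra A" by unfold_locales
  show "k_algebra (Frac A)" by (rule Frac_k_algebra)
  show ne: "\<one>\<^bsub>Frac A\<^esub> \<noteq> \<zero>\<^bsub>Frac A\<^esub>"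
    using fr_eq_zero_iff[OF one_closed R0_one] one_Frac[OF R0_one] nontrivial by simp
  show "Units (Frac A) = carrier (Frac A) - {\<zero>\<^bsub>Frac A\<^esub>}"
  proof
    show "Units (Frac A) \<subseteq> carrier (Frac A) - {\<zero>\<^bsub>Frac A\<^esub>}"
    proof
      fix x assume x: "x \<in> Units (Frac A)"
      have "x \<noteq> \<zero>\<^bsub>Frac A\<^esub>"
        using F.Units_r_inv_ex[OF x] ne F.l_null by metis
      then show "x \<in> carrier (Frac A) - {\<zero>\<^bsub>Frac A\<^esub>}" using x F.Units_closed by auto
    qed
    show "carrier (Frac A) - {\<zero>\<^bsub>Frac A\<^esub>} \<subseteq> Units (Frac A)"
    proof
      fix x assume x: "x \<in> carrier (Frac A) - {\<zero>\<^bsub>Frac A\<^esub>}"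
      then obtain a s where as: "a \<in> carrier A" "s \<in> R0" "x = fr a s" using Frac_rep by blast
      then have "a \<in> R0" using x fr_eq_zero_iff by (simp add: R0_def)
      then show "x \<in> Units (Frac A)" using as fr_inverse(1) by simp
    qed
  qed
  show "(\<lambda>a. fr a \<one>) \<in> ring_hom A (Frac A)"
    by (rule ring_hom_memI)
      (use R0_one in \<open>simp_all add: fr_closed mult_Frac_denom_one add_Frac one_Frac\<close>)
  show "k_linear A (Frac A) (\<lambda>a. fr a \<one>)"
    unfolding k_linear_def using R0_one by (simp add: smult_Frac)
  show "inj_on (\<lambda>a. fr a \<one>) (carrier A)"
    using fr_same_denom_iff[OF _ _ R0_one] by (simp add: inj_on_def)
  have inv1: "inv\<^bsub>Frac A\<^esub> (fr s \<one>) = fr \<one> s" if "s \<in> R0" for s by (rule fr_inverse(2)[OF that R0_one])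
  show "\<forall>d\<in>carrier (Frac A). \<exists>a\<in>carrier A. \<exists>s\<in>carrier A - {\<zero>}.
      d = fr a \<one> \<otimes>\<^bsub>Frac A\<^esub> inv\<^bsub>Frac A\<^esub> (fr s \<one>)"
  proof
    fix d assume "d \<in> carrier (Frac A)"
    then obtain a s where d: "a \<in> carrier A" "s \<in> R0" "d = fr a s" using Frac_rep by blast
    have "fr a \<one> \<otimes>\<^bsub>Frac A\<^esub> fr \<one> s = d" using d mult_Frac_denom_one[of a \<one> s] by simp
    then show "\<exists>a\<in>carrier A. \<exists>s\<in>carrier A - {\<zero>}. d = fr a \<one> \<otimes>\<^bsub>Frac A\<^esub> inv\<^bsub>Frac A\<^esub> (fr s \<one>)"
      unfolding R0_def[symmetric] using d inv1[OF d(2)] by metis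
  qed
  show "\<forall>d\<in>carrier (Frac A). \<exists>a\<in>carrier A. \<exists>s\<in>carrier A - {\<zero>}.
      d = inv\<^bsub>Frac A\<^esub> (fr s \<one>) \<otimes>\<^bsub>Frac A\<^esub> fr a \<one>"
  proof
    fix d assume "d \<in> carrier (Frac A)"
    then obtain a s where d: "a \<in> carrier A" "s \<in> R0" "d = fr a s" using Frac_rep by blast
    \<comment> \<open>The left Ore condition turns a right fraction into a left one: from b s = t a
      it follows that a s^-1 = t^-1 b.\<close>
    obtain b t where bt: "b \<in> carrier A" "t \<in> R0" "b \<otimes> s = t \<otimes> a" using left_ore_zero[OF d(2,1)] by blast
    have b1: "fr b \<one> = fr (t \<otimes> a) s"
      using bt d R0_closed R0_one by (subst fr_eq_iff[OF _ _ R0_one d(2) d(2) R0_one]) simp_all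
    have "fr \<one> t \<otimes>\<^bsub>Frac A\<^esub> fr b \<one> = d"
      unfolding b1 using d bt mult_Frac[of \<one> t a s] by simp
    then show "\<exists>a\<in>carrier A. \<exists>s\<in>carrier A - {\<zero>}. d = inv\<^bsub>Frac A\<^esub> (fr s \<one>) \<otimes>\<^bsub>Frac A\<^esub> fr a \<one>"
      unfolding R0_def[symmetric] using bt inv1[OF bt(2)] by metis
  qed
qed

end

subsection \<open>Dense subalgebras of an Ore domain\<close>

text \<open>Two elements are cleared by the same s, so that numerator and denominator of a fraction
  over \<open>T\<close> can be moved into the image together. The same clearing, applied to the two
  cofactors of a common multiple, transports the Ore conditions.\<close>

locale dense_embedding = A: k_algebra A + T: ore_domain T
  for A :: "('k::field, 'a) module" and T :: "('k, 'b) module" +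
  fixes \<iota> :: "'a \<Rightarrow> 'b"
  assumes emb_hom: "\<iota> \<in> ring_hom A T"
    and emb_linear: "k_linear A T \<iota>"
    and emb_inj: "inj_on \<iota> (carrier A)"
    and dense_right: "\<lbrakk>t1 \<in> carrier T; t2 \<in> carrier T\<rbrakk> \<Longrightarrow> \<exists>s\<in>carrier A - {\<zero>\<^bsub>A\<^esub>}.
      t1 \<otimes>\<^bsub>T\<^esub> \<iota> s \<in> \<iota> ` carrier A \<and> t2 \<otimes>\<^bsub>T\<^esub> \<iota> s \<in> \<iota> ` carrier A"
    and dense_left: "\<lbrakk>t1 \<in> carrier T; t2 \<in> carrier T\<rbrakk> \<Longrightarrow> \<exists>s\<in>carrier A - {\<zero>\<^bsub>A\<^esub>}.
      \<iota> s \<otimes>\<^bsub>T\<^esub> t1 \<in> \<iota> ` carrier A \<and> \<iota> s \<otimes>\<^bsub>T\<^esub> t2 \<in> \<iota> ` carrier A"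
begin

lemma emb_closed: "a \<in> carrier A \<Longrightarrow> \<iota> a \<in> carrier T"
  and emb_mult: "\<lbrakk>a \<in> carrier A; b \<in> carrier A\<rbrakk> \<Longrightarrow> \<iota> (a \<otimes>\<^bsub>A\<^esub> b) = \<iota> a \<otimes>\<^bsub>T\<^esub> \<iota> b"
  and emb_add: "\<lbrakk>a \<in> carrier A; b \<in> carrier A\<rbrakk> \<Longrightarrow> \<iota> (a \<oplus>\<^bsub>A\<^esub> b) = \<iota> a \<oplus>\<^bsub>T\<^esub> \<iota> b"
  and emb_one: "\<iota> \<one>\<^bsub>A\<^esub> = \<one>\<^bsub>T\<^esub>"
  using emb_hom by (auto simp: ring_hom_def)

lemma emb_eq_iff: "\<lbrakk>a \<in> carrier A; b \<in> carrier A\<rbrakk> \<Longrightarrow> \<iota> a = \<iota> b \<longleftrightarrow> a = b"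
  using emb_inj by (auto simp: inj_on_def)

lemma emb_zero: "\<iota> \<zero>\<^bsub>A\<^esub> = \<zero>\<^bsub>T\<^esub>"
  using emb_add[OF A.zero_closed A.zero_closed] emb_closed[OF A.zero_closed] by simp

lemma emb_eq_zero_iff: "a \<in> carrier A \<Longrightarrow> \<iota> a = \<zero>\<^bsub>T\<^esub> \<longleftrightarrow> a = \<zero>\<^bsub>A\<^esub>"
  using emb_eq_iff[of a "\<zero>\<^bsub>A\<^esub>"] emb_zero by simp

lemma emb_R0: "a \<in> carrier A - {\<zero>\<^bsub>A\<^esub>} \<Longrightarrow> \<iota> a \<in> T.R0"
  using emb_eq_zero_iff emb_closed by (auto simp: T.R0_def)

text \<open>A common multiple of the images of a and b exists in \<open>T\<close>. Clearing its two
  cofactors with one s brings it into the image of \<open>A\<close>, and it stays nonzero because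
  \<open>T\<close> has no zero divisors.\<close>

sublocale A: ore_domain A
proof
  show "\<one>\<^bsub>A\<^esub> \<noteq> \<zero>\<^bsub>A\<^esub>" using emb_one emb_zero T.nontrivial by metis
next
  fix a b assume ab: "a \<in> carrier A" "b \<in> carrier A" "a \<otimes>\<^bsub>A\<^esub> b = \<zero>\<^bsub>A\<^esub>"
  have "\<iota> a \<otimes>\<^bsub>T\<^esub> \<iota> b = \<zero>\<^bsub>T\<^esub>" using emb_mult[OF ab(1,2)] ab(3) emb_zero by simp
  then show "a = \<zero>\<^bsub>A\<^esub> \<or> b = \<zero>\<^bsub>A\<^esub>"
    using T.no_zero_div[OF emb_closed[OF ab(1)] emb_closed[OF ab(2)]] ab emb_eq_zero_iff by simp
next
  fix a b assume ab: "a \<in> carrier A - {\<zero>\<^bsub>A\<^esub>}" "b \<in> carrier A - {\<zero>\<^bsub>A\<^esub>}"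
  obtain t1 t2 where t: "t1 \<in> T.R0" "t2 \<in> T.R0" "\<iota> a \<otimes>\<^bsub>T\<^esub> t1 = \<iota> b \<otimes>\<^bsub>T\<^esub> t2"
    using T.right_ore'[OF emb_R0[OF ab(1)] emb_R0[OF ab(2)]] by blast
  obtain s u v where s: "s \<in> carrier A - {\<zero>\<^bsub>A\<^esub>}" "u \<in> carrier A" "v \<in> carrier A"
    "t1 \<otimes>\<^bsub>T\<^esub> \<iota> s = \<iota> u" "t2 \<otimes>\<^bsub>T\<^esub> \<iota> s = \<iota> v"
    using dense_right[OF t(1,2)[THEN T.R0_closed]] by (elim bexE conjE imageE)
  note cl = T.R0_closed[OF t(1)] T.R0_closed[OF t(2)] T.R0_closed[OF emb_R0[OF s(1)]] 
    T.R0_closed[OF emb_R0[OF ab(1)]]  T.R0_closed[OF emb_R0[OF ab(2)]]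
  have 1: "\<iota> (a \<otimes>\<^bsub>A\<^esub> u) = \<iota> a \<otimes>\<^bsub>T\<^esub> t1 \<otimes>\<^bsub>T\<^esub> \<iota> s"
    using cl ab s by (simp add: emb_mult T.m_assoc flip: s(4))
  have 2: "\<iota> (b \<otimes>\<^bsub>A\<^esub> v) = \<iota> b \<otimes>\<^bsub>T\<^esub> t2 \<otimes>\<^bsub>T\<^esub> \<iota> s"
    using cl ab s by (simp add: emb_mult T.m_assoc flip: s(5))
  have "\<iota> (a \<otimes>\<^bsub>A\<^esub> u) \<in> T.R0" unfolding 1
    by (intro T.R0_mult emb_R0 ab s t)
  then have "a \<otimes>\<^bsub>A\<^esub> u \<noteq> \<zero>\<^bsub>A\<^esub>" using emb_zero T.R0_nonzero by force
  moreover have "a \<otimes>\<^bsub>A\<^esub> u = b \<otimes>\<^bsub>A\<^esub> v" using 1 2 t(3) ab s emb_eq_iff[of "a \<otimes>\<^bsub>A\<^esub> u" "b \<otimes>\<^bsub>A\<^esub> v"] by simp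
  ultimately show "\<exists>u\<in>carrier A. \<exists>v\<in>carrier A. a \<otimes>\<^bsub>A\<^esub> u = b \<otimes>\<^bsub>A\<^esub> v \<and> a \<otimes>\<^bsub>A\<^esub> u \<noteq> \<zero>\<^bsub>A\<^esub>"
    using s by blast
next
  fix a b assume ab: "a \<in> carrier A - {\<zero>\<^bsub>A\<^esub>}" "b \<in> carrier A - {\<zero>\<^bsub>A\<^esub>}"
  obtain t1 t2 where t: "t1 \<in> T.R0" "t2 \<in> T.R0" "t1 \<otimes>\<^bsub>T\<^esub> \<iota> a = t2 \<otimes>\<^bsub>T\<^esub> \<iota> b"
    using T.left_ore'[OF emb_R0[OF ab(1)] emb_R0[OF ab(2)]] by blast
  obtain s u v where s: "s \<in> carrier A - {\<zero>\<^bsub>A\<^esub>}" "u \<in> carrier A" "v \<in> carrier A"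
    "\<iota> s \<otimes>\<^bsub>T\<^esub> t1 = \<iota> u" "\<iota> s \<otimes>\<^bsub>T\<^esub> t2 = \<iota> v"
    using dense_left[OF t(1,2)[THEN T.R0_closed]] by (elim bexE conjE imageE)
  note cl = T.R0_closed[OF t(1)] T.R0_closed[OF t(2)] T.R0_closed[OF emb_R0[OF s(1)]] 
    T.R0_closed[OF emb_R0[OF ab(1)]]  T.R0_closed[OF emb_R0[OF ab(2)]]
  have 1: "\<iota> (u \<otimes>\<^bsub>A\<^esub> a) = \<iota> s \<otimes>\<^bsub>T\<^esub> (t1 \<otimes>\<^bsub>T\<^esub> \<iota> a)"
    using cl ab s by (simp add: emb_mult T.m_assoc flip: s(4))
  have 2: "\<iota> (v \<otimes>\<^bsub>A\<^esub> b) = \<iota> s \<otimes>\<^bsub>T\<^esub> (t2 \<otimes>\<^bsub>T\<^esub> \<iota> b)"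
    using cl ab s by (simp add: emb_mult T.m_assoc flip: s(5))
  have "\<iota> (u \<otimes>\<^bsub>A\<^esub> a) \<in> T.R0" unfolding 1
    by (intro T.R0_mult emb_R0 ab s t)
  then have "u \<otimes>\<^bsub>A\<^esub> a \<noteq> \<zero>\<^bsub>A\<^esub>" using emb_zero T.R0_nonzero by force
  moreover have "u \<otimes>\<^bsub>A\<^esub> a = v \<otimes>\<^bsub>A\<^esub> b" using 1 2 t(3) ab s emb_eq_iff[of "u \<otimes>\<^bsub>A\<^esub> a" "v \<otimes>\<^bsub>A\<^esub> b"] by simp
  ultimately show "\<exists>u\<in>carrier A. \<exists>v\<in>carrier A. u \<otimes>\<^bsub>A\<^esub> a = v \<otimes>\<^bsub>A\<^esub> b \<and> u \<otimes>\<^bsub>A\<^esub> a \<noteq> \<zero>\<^bsub>A\<^esub>"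
    using s by blast
qed

lemma emb_R0': "s \<in> A.R0 \<Longrightarrow> \<iota> s \<in> T.R0"
  using emb_R0 by (simp add: A.R0_def)

text \<open>A union over representatives, like the operations of \<open>Frac\<close>, which avoids
  choosing one.\<close>

definition Frac_map where
  "Frac_map X = \<Union>{ore_frac T (\<iota> a) (\<iota> s) | a s. (a, s) \<in> X}"

text \<open>The equivalence serves twice: one direction makes \<open>Frac_map\<close> well defined,
  the other makes it injective.\<close>

lemma fr_emb_eq_iff:
  assumes "a \<in> carrier A" "b \<in> carrier A" "s \<in> A.R0" "t \<in> A.R0"
  shows "ore_frac T (\<iota> a) (\<iota> s) = ore_frac T (\<iota> b) (\<iota> t) \<longleftrightarrow> ore_frac A a s = ore_frac A b t"
proof -
  obtain u v where uv: "u \<in> A.R0" "v \<in> A.R0" "s \<otimes>\<^bsub>A\<^esub> u = t \<otimes>\<^bsub>A\<^esub> v"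
    using A.right_ore'[OF assms(3,4)] by blast
  note cl = A.R0_closed[OF uv(1)] A.R0_closed[OF uv(2)] A.R0_closed[OF assms(3)] A.R0_closed[OF assms(4)]
  have "\<iota> s \<otimes>\<^bsub>T\<^esub> \<iota> u = \<iota> t \<otimes>\<^bsub>T\<^esub> \<iota> v"
    using uv(3) cl by (simp flip: emb_mult)
  then have "ore_frac T (\<iota> a) (\<iota> s) = ore_frac T (\<iota> b) (\<iota> t) \<longleftrightarrow> \<iota> a \<otimes>\<^bsub>T\<^esub> \<iota> u = \<iota> b \<otimes>\<^bsub>T\<^esub> \<iota> v"
    using assms uv emb_R0' emb_closed by (intro T.fr_eq_iff) simp_all
  also have "\<dots> \<longleftrightarrow> a \<otimes>\<^bsub>A\<^esub> u = b \<otimes>\<^bsub>A\<^esub> v"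
    using assms cl by (simp add: emb_eq_iff flip: emb_mult)
  also have "\<dots> \<longleftrightarrow> ore_frac A a s = ore_frac A b t"
    by (rule A.fr_eq_iff[OF assms uv, symmetric])
  finally show ?thesis .
qed

lemma Frac_map_fr:
  assumes "a \<in> carrier A" "s \<in> A.R0"
  shows "Frac_map (ore_frac A a s) = ore_frac T (\<iota> a) (\<iota> s)"
  unfolding Frac_map_def
proof (rule A.Union_const)
  show "{ore_frac T (\<iota> b) (\<iota> t) | b t. (b, t) \<in> ore_frac A a s} \<noteq> {}"
    using A.fr_mem_iff[of a s a s] assms by blast
  fix X assume "X \<in> {ore_frac T (\<iota> b) (\<iota> t) | b t. (b, t) \<in> ore_frac A a s}"
  then obtain b t where "X = ore_frac T (\<iota> b) (\<iota> t)"
    "b \<in> carrier A" "t \<in> A.R0" "ore_frac A b t = ore_frac A a s"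
    using A.fr_mem_iff[OF assms] by blast
  then show "X = ore_frac T (\<iota> a) (\<iota> s)" using assms by (simp add: fr_emb_eq_iff)
qed

theorem Frac_isomorphic: "Frac A \<simeq>\<^sub>k Frac T"
  unfolding k_algebra_isomorphic_def
proof (rule bexI)
  show "k_linear (Frac A) (Frac T) Frac_map"
    unfolding k_linear_def
  proof (intro allI ballI)
    fix c x assume "x \<in> carrier (Frac A)"
    then obtain a s where x: "a \<in> carrier A" "s \<in> A.R0" "x = ore_frac A a s" using A.Frac_rep by blast
    have "\<iota> (c \<odot>\<^bsub>A\<^esub> a) = c \<odot>\<^bsub>T\<^esub> \<iota> a" using emb_linear x by (auto simp: k_linear_def)
    then show "Frac_map (c \<odot>\<^bsub>Frac A\<^esub> x) = c \<odot>\<^bsub>Frac T\<^esub> Frac_map x"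
      using x by (simp add: A.smult_Frac A.smult_closed T.smult_Frac Frac_map_fr emb_closed emb_R0')
  qed
  show "Frac_map \<in> ring_iso (Frac A) (Frac T)"
  proof (rule ring_iso_memI)
    fix x assume "x \<in> carrier (Frac A)"
    then obtain a s where "a \<in> carrier A" "s \<in> A.R0" "x = ore_frac A a s" using A.Frac_rep by blast
    then show "Frac_map x \<in> carrier (Frac T)"
      by (simp add: Frac_map_fr T.fr_closed emb_closed emb_R0')
  next
    fix x y assume h: "x \<in> carrier (Frac A)" "y \<in> carrier (Frac A)"
    {
      obtain a s where x: "a \<in> carrier A" "s \<in> A.R0" "x = ore_frac A a s" using A.Frac_rep[OF h(1)] by blast
      obtain c t where y: "c \<in> carrier A" "t \<in> A.R0" "y = ore_frac A (s \<otimes>\<^bsub>A\<^esub> c) t"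
        using A.chain_rep[OF x(2) h(2)] by blast
      show "Frac_map (x \<otimes>\<^bsub>Frac A\<^esub> y) = Frac_map x \<otimes>\<^bsub>Frac T\<^esub> Frac_map y"
        using x y A.R0_closed
        by (simp add: A.mult_Frac T.mult_Frac Frac_map_fr emb_closed emb_R0' emb_mult)
    }
    {
      obtain a b s where "a \<in> carrier A" "b \<in> carrier A" "s \<in> A.R0"
        "x = ore_frac A a s" "y = ore_frac A b s" using A.common_denom2[OF h] by blast
      then show "Frac_map (x \<oplus>\<^bsub>Frac A\<^esub> y) = Frac_map x \<oplus>\<^bsub>Frac T\<^esub> Frac_map y"
        by (simp add: A.add_Frac T.add_Frac Frac_map_fr emb_closed emb_R0' emb_add)
    }
  next
    show "Frac_map \<one>\<^bsub>Frac A\<^esub> = \<one>\<^bsub>Frac T\<^esub>"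
      using A.one_Frac[OF A.R0_one] T.one_Frac[OF T.R0_one] Frac_map_fr[of "\<one>\<^bsub>A\<^esub>" "\<one>\<^bsub>A\<^esub>"] A.R0_one emb_one
      by simp
  next
    show "bij_betw Frac_map (carrier (Frac A)) (carrier (Frac T))"
      unfolding bij_betw_def
    proof
      show "inj_on Frac_map (carrier (Frac A))"
      proof (rule inj_onI)
        fix x y assume h: "x \<in> carrier (Frac A)" "y \<in> carrier (Frac A)" "Frac_map x = Frac_map y"
        obtain a s where x: "a \<in> carrier A" "s \<in> A.R0" "x = ore_frac A a s"
          using A.Frac_rep[OF h(1)] by blast
        obtain b t where y: "b \<in> carrier A" "t \<in> A.R0" "y = ore_frac A b t"
          using A.Frac_rep[OF h(2)] by blast
        show "x = y" using h(3) x y by (simp add: Frac_map_fr fr_emb_eq_iff)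
      qed
      show "Frac_map ` carrier (Frac A) = carrier (Frac T)"
      proof
        show "Frac_map ` carrier (Frac A) \<subseteq> carrier (Frac T)"
          using A.Frac_rep by (force simp: Frac_map_fr T.fr_closed emb_closed emb_R0')
        show "carrier (Frac T) \<subseteq> Frac_map ` carrier (Frac A)"
        proof
          fix x assume "x \<in> carrier (Frac T)"
          then obtain t1 t2 where x: "t1 \<in> carrier T" "t2 \<in> T.R0" "x = ore_frac T t1 t2"
            using T.Frac_rep by blast
          \<comment> \<open>Surjectivity: expanding the fraction by the image of s puts both t1 and
            t2 into the image of \<open>A\<close>.\<close>
          obtain s u v where s: "s \<in> carrier A - {\<zero>\<^bsub>A\<^esub>}" "u \<in> carrier A" "v \<in> carrier A"
            "t1 \<otimes>\<^bsub>T\<^esub> \<iota> s = \<iota> u" "t2 \<otimes>\<^bsub>T\<^esub> \<iota> s = \<iota> v"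
            using dense_right[OF x(1) T.R0_closed[OF x(2)]] by (elim bexE conjE imageE)
          have "\<iota> v \<in> T.R0" unfolding s(5)[symmetric] by (intro T.R0_mult x emb_R0 s)
          then have v: "v \<in> A.R0" using A.R0I[OF s(3)] emb_zero T.R0_nonzero by blast
          have "x = ore_frac T (\<iota> u) (\<iota> v)"
            unfolding s(4)[symmetric] s(5)[symmetric] x(3)
            by (rule T.fr_expand[OF x(1,2) emb_R0[OF s(1)], symmetric])
          then have "x = Frac_map (ore_frac A u v)" using Frac_map_fr s v by simp
          then show "x \<in> Frac_map ` carrier (Frac A)" using A.fr_closed s v by blast
        qed
      qed
    qed
  qed
qed

end

section \<open>Symmetry and transitivity of algebra isomorphism\<close>

lemma k_algebra_isomorphic_sym:
  assumes "A \<simeq>\<^sub>k B" "k_algebra A"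
  shows "B \<simeq>\<^sub>k A"
proof -
  interpret A: k_algebra A by fact
  obtain f where f: "f \<in> ring_iso A B" "k_linear A B f"
    using assms by (auto simp: k_algebra_isomorphic_def)
  let ?g = "inv_into (carrier A) f"
  have bij: "bij_betw f (carrier A) (carrier B)" using f by (simp add: ring_iso_def)
  have "?g \<in> ring_iso B A" using f A.ring_axioms by (intro ring_iso_set_sym)
  moreover have "k_linear B A ?g"
    unfolding k_linear_def
  proof (intro allI ballI)
    fix c b assume b: "b \<in> carrier B"
    then obtain a where a: "a \<in> carrier A" "b = f a" using bij by (auto simp: bij_betw_def)
    then have "c \<odot>\<^bsub>B\<^esub> b = f (c \<odot>\<^bsub>A\<^esub> a)" using f by (simp add: k_linear_def)
    then show "?g (c \<odot>\<^bsub>B\<^esub> b) = c \<odot>\<^bsub>A\<^esub> ?g b"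
      using a bij A.smult_closed by (simp add: bij_betw_inv_into_left)
  qed
  ultimately show ?thesis by (auto simp: k_algebra_isomorphic_def)
qed

lemma k_algebra_isomorphic_trans:
  assumes "A \<simeq>\<^sub>k B" "B \<simeq>\<^sub>k C"
  shows "A \<simeq>\<^sub>k C"
proof -
  obtain f g where "f \<in> ring_iso A B" "k_linear A B f" "g \<in> ring_iso B C" "k_linear B C g"
    using assms by (auto simp: k_algebra_isomorphic_def)
  moreover from this have "g \<circ> f \<in> ring_iso A C" by (intro ring_iso_set_trans)
  moreover have "f a \<in> carrier B" if "a \<in> carrier A" for a
    using that \<open>f \<in> ring_iso A B\<close> by (auto simp: ring_iso_def ring_hom_def)
  ultimately show ?thesis
    by (auto simp: k_algebra_isomorphic_def k_linear_def intro!: bexI[of _ "g \<circ> f"])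
qed

section \<open>Linear algebra\<close>

text \<open>Gaussian elimination, one equation at a time. An equation without coefficients is
  dropped; otherwise an unknown j that occurs in it is eliminated from the other equations and its
  value is chosen at the end so as to solve this one. Each step uses up one equation and at most one
  unknown.\<close>

lemma homogeneous_system_nontrivial:
  fixes M :: "'i \<Rightarrow> 'c \<Rightarrow> 'k::field"
  assumes "finite C" "finite I" "card C < card I"
  shows "\<exists>x. (\<exists>i\<in>I. x i \<noteq> 0) \<and> (\<forall>c\<in>C. (\<Sum>i\<in>I. x i * M i c) = 0)"
  using assms
proof (induction C arbitrary: I M rule: finite_induct)
  case empty
  then have "I \<noteq> {}" by auto
  then show ?case by (intro exI[of _ "\<lambda>_. 1"]) auto
next
  case (insert c C)
  show ?case
  proof (cases "\<forall>i\<in>I. M i c = 0")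
    case True
    have "card C < card I" using insert by simp
    then show ?thesis using insert.IH[OF insert.prems(1), of M] True by auto
  next
    case False
    then obtain j where j: "j \<in> I" "M j c \<noteq> 0" by blast
    define I' where "I' = I - {j}"
    have I': "finite I'" "card C < card I'" "I = insert j I'" "j \<notin> I'"
      using insert j by (auto simp: I'_def card_Diff_singleton)
    obtain x where x: "\<exists>i\<in>I'. x i \<noteq> 0"
      "\<And>d. d \<in> C \<Longrightarrow> (\<Sum>i\<in>I'. x i * (M i d - M i c / M j c * M j d)) = 0"
      using insert.IH[OF I'(1,2), of "\<lambda>i d. M i d - M i c / M j c * M j d"] by blast
    define y where "y = x(j := - (\<Sum>i\<in>I'. x i * M i c) / M j c)"
    have split: "(\<Sum>i\<in>I. y i * M i d) = y j * M j d + (\<Sum>i\<in>I'. x i * M i d)" for d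
    proof -
      have "(\<Sum>i\<in>I'. y i * M i d) = (\<Sum>i\<in>I'. x i * M i d)"
        using I'(4) by (intro sum.cong) (auto simp: y_def)
      then show ?thesis using I'(1,3,4) by simp
    qed
    have "(\<Sum>i\<in>I. y i * M i d) = 0" if "d \<in> C" for d
    proof -
      have "(\<Sum>i\<in>I'. x i * (M i d - M i c / M j c * M j d)) =
          (\<Sum>i\<in>I'. x i * M i d) - (\<Sum>i\<in>I'. x i * M i c) / M j c * M j d"
        by (simp add: right_diff_distrib sum_subtractf sum_distrib_right sum_divide_distrib mult.assoc)
      then show ?thesis using x(2)[OF that] unfolding split by (simp add: y_def)
    qed
    moreover have "(\<Sum>i\<in>I. y i * M i c) = 0"
      unfolding split using j by (simp add: y_def)
    moreover have "\<exists>i\<in>I. y i \<noteq> 0" using x(1) I' by (auto simp: y_def)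
    ultimately show ?thesis by (intro exI[of _ y]) auto
  qed
qed

section \<open>Twisted monoid algebras\<close>

lemma sum_single_keys: "(\<Sum>a\<in>Poly_Mapping.keys f. Poly_Mapping.single a (Poly_Mapping.lookup f a)) = f"
  by (rule poly_mapping_eqI)
    (simp add: lookup_sum lookup_single when_def sum.delta in_keys_iff)

lemma poly_mapping_additive_induct [consumes 1, case_names zero single add]:
  fixes f :: "'a \<Rightarrow>\<^sub>0 'b::comm_monoid_add"
  assumes "Poly_Mapping.keys f \<subseteq> X"
    and "P 0" "\<And>a c. a \<in> X \<Longrightarrow> P (Poly_Mapping.single a c)"
    and "\<And>f g. P f \<Longrightarrow> P g \<Longrightarrow> P (f + g)"
  shows "P f"
proof -
  have "P (\<Sum>a\<in>S. Poly_Mapping.single a (Poly_Mapping.lookup f a))"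
    if "finite S" "S \<subseteq> Poly_Mapping.keys f" for S
    using that by (induction S rule: finite_induct) (use assms in auto)
  from this[of "Poly_Mapping.keys f"] show ?thesis by (simp add: sum_single_keys)
qed

text \<open>\<open>\<sigma>\<close> is a bicharacter on \<open>X\<close>, which makes the twisted
  convolution associative. The order lives on the whole exponent group and provides smallest
  exponents; the submonoid \<open>X\<close> restricts to the exponents that occur, for which alone
  the growth bound can hold. \<open>folner\<close> asks for little: \<open>K + B\<close> must have
  fewer than twice as many elements as \<open>B\<close>, twice because the Ore equation f u = g v
  has two unknown elements supported in \<open>B\<close>.\<close>

locale twisted_monoid_algebra =
  fixes \<sigma> :: "'e::linordered_ab_group_add \<Rightarrow> 'e \<Rightarrow> 'k::field"
    and X :: "'e set"
  assumes \<sigma>_add_left: "\<lbrakk>a \<in> X; b \<in> X; c \<in> X\<rbrakk> \<Longrightarrow> \<sigma> (a + b) c = \<sigma> a c * \<sigma> b c"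
    and \<sigma>_add_right: "\<lbrakk>a \<in> X; b \<in> X; c \<in> X\<rbrakk> \<Longrightarrow> \<sigma> a (b + c) = \<sigma> a b * \<sigma> a c"
    and \<sigma>_nonzero: "\<lbrakk>a \<in> X; b \<in> X\<rbrakk> \<Longrightarrow> \<sigma> a b \<noteq> 0"
    and X_zero: "0 \<in> X"
    and X_add: "\<lbrakk>a \<in> X; b \<in> X\<rbrakk> \<Longrightarrow> a + b \<in> X"
    and folner: "\<lbrakk>finite K; K \<subseteq> X\<rbrakk> \<Longrightarrow>
      \<exists>B. finite B \<and> B \<subseteq> X \<and> card {k + b | k b. k \<in> K \<and> b \<in> B} < 2 * card B"
begin

definition tmult :: "('e \<Rightarrow>\<^sub>0 'k) \<Rightarrow> ('e \<Rightarrow>\<^sub>0 'k) \<Rightarrow> ('e \<Rightarrow>\<^sub>0 'k)" (infixl \<open>\<star>\<close> 70) where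
  "f \<star> g = (\<Sum>a\<in>Poly_Mapping.keys f. \<Sum>b\<in>Poly_Mapping.keys g. Poly_Mapping.single (a + b)
     (Poly_Mapping.lookup f a * Poly_Mapping.lookup g b * \<sigma> a b))"

abbreviation mono :: "'e \<Rightarrow> 'k \<Rightarrow> ('e \<Rightarrow>\<^sub>0 'k)" where "mono \<equiv> Poly_Mapping.single"
abbreviation carr :: "('e \<Rightarrow>\<^sub>0 'k) set" where "carr \<equiv> {f. Poly_Mapping.keys f \<subseteq> X}"

lemma tmult_superset:
  assumes "finite A" "finite B" "Poly_Mapping.keys f \<subseteq> A" "Poly_Mapping.keys g \<subseteq> B"
  shows "f \<star> g = (\<Sum>a\<in>A. \<Sum>b\<in>B. mono (a + b)
     (Poly_Mapping.lookup f a * Poly_Mapping.lookup g b * \<sigma> a b))"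
proof -
  have "(\<Sum>b\<in>Poly_Mapping.keys g. mono (a + b) (Poly_Mapping.lookup f a * Poly_Mapping.lookup g b * \<sigma> a b))
      = (\<Sum>b\<in>B. mono (a + b) (Poly_Mapping.lookup f a * Poly_Mapping.lookup g b * \<sigma> a b))" for a
    by (intro sum.mono_neutral_left) (use assms in \<open>auto simp: in_keys_iff\<close>)
  then have "f \<star> g = (\<Sum>a\<in>Poly_Mapping.keys f. \<Sum>b\<in>B. mono (a + b)
     (Poly_Mapping.lookup f a * Poly_Mapping.lookup g b * \<sigma> a b))" by (simp add: tmult_def)
  also have "\<dots> = (\<Sum>a\<in>A. \<Sum>b\<in>B. mono (a + b)
     (Poly_Mapping.lookup f a * Poly_Mapping.lookup g b * \<sigma> a b))"
    by (intro sum.mono_neutral_left) (use assms in \<open>auto simp: in_keys_iff\<close>)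
  finally show ?thesis .
qed

lemma tmult_add_left: "(f + g) \<star> h = f \<star> h + g \<star> h"
proof -
  let ?A = "Poly_Mapping.keys f \<union> Poly_Mapping.keys g" and ?B = "Poly_Mapping.keys h"
  have k: "Poly_Mapping.keys (f + g) \<subseteq> ?A" by (rule keys_add)
  show ?thesis
    using k by (simp add: tmult_superset[of ?A ?B] lookup_add ring_distribs single_add sum.distrib)
qed

lemma tmult_add_right: "f \<star> (g + h) = f \<star> g + f \<star> h"
proof -
  let ?B = "Poly_Mapping.keys g \<union> Poly_Mapping.keys h" and ?A = "Poly_Mapping.keys f"
  have k: "Poly_Mapping.keys (g + h) \<subseteq> ?B" by (rule keys_add)
  show ?thesis
    using k by (simp add: tmult_superset[of ?A ?B] lookup_add ring_distribs single_add sum.distrib)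
qed

lemma tmult_zero [simp]: "0 \<star> f = 0" "f \<star> 0 = 0"
  by (simp_all add: tmult_def)

lemma tmult_mono: "mono a c \<star> mono b d = mono (a + b) (c * d * \<sigma> a b)"
  by (cases "c = 0"; cases "d = 0") (simp_all add: tmult_def)

lemma tmult_diff_left: "(f - g) \<star> h = f \<star> h - g \<star> h"
  using tmult_add_left[of "f - g" g h] by simp

lemma tmult_diff_right: "f \<star> (g - h) = f \<star> g - f \<star> h"
  using tmult_add_right[of f "g - h" h] by simp

lemma tmult_sum_left: "(\<Sum>i\<in>I. f i) \<star> g = (\<Sum>i\<in>I. f i \<star> g)"
  by (induction I rule: infinite_finite_induct) (simp_all add: tmult_add_left)

lemma tmult_sum_right: "g \<star> (\<Sum>i\<in>I. f i) = (\<Sum>i\<in>I. g \<star> f i)"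
  by (induction I rule: infinite_finite_induct) (simp_all add: tmult_add_right)

lemma carr_induct [consumes 1, case_names zero single add]:
  assumes "f \<in> carr" "P 0" "\<And>a c. a \<in> X \<Longrightarrow> P (mono a c)" "\<And>f g. P f \<Longrightarrow> P g \<Longrightarrow> P (f + g)"
  shows "P f"
  using assms poly_mapping_additive_induct[of f X P] by blast

lemma \<sigma>_zero: "a \<in> X \<Longrightarrow> \<sigma> 0 a = 1" "a \<in> X \<Longrightarrow> \<sigma> a 0 = 1"
  using \<sigma>_add_left[of 0 0 a] \<sigma>_add_right[of a 0 0] \<sigma>_nonzero[of 0 a] \<sigma>_nonzero[of a 0] X_zero
  by auto

text \<open>By additivity it is enough to treat monomials with exponents a, b, c, where both
  bracketings collect the same scalar
  \<open>\<sigma> a b * \<sigma> a c * \<sigma> b c\<close>.\<close>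

lemma tmult_assoc:
  assumes f: "f \<in> carr" and g: "g \<in> carr" and h: "h \<in> carr"
  shows "(f \<star> g) \<star> h = f \<star> (g \<star> h)"
  using f
proof (induction f rule: carr_induct)
  case (single a c)
  show ?case using g
  proof (induction g rule: carr_induct)
    case (single b d)
    show ?case using h
      by (induction h rule: carr_induct)
        (use single \<open>a \<in> X\<close> in \<open>simp_all add: tmult_add_right tmult_mono \<sigma>_add_left \<sigma>_add_right add.assoc mult_ac\<close>)
  qed (simp_all add: tmult_add_right tmult_add_left)
qed (simp_all add: tmult_add_left)

lemma tmult_keys: "Poly_Mapping.keys (f \<star> g) \<subseteq>
    {a + b | a b. a \<in> Poly_Mapping.keys f \<and> b \<in> Poly_Mapping.keys g}"
proof -
  have "Poly_Mapping.keys (f \<star> g) \<subseteq> (\<Union>a\<in>Poly_Mapping.keys f. Poly_Mapping.keys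
      (\<Sum>b\<in>Poly_Mapping.keys g. mono (a + b) (Poly_Mapping.lookup f a * Poly_Mapping.lookup g b * \<sigma> a b)))"
    unfolding tmult_def by (rule keys_sum)
  also have "\<dots> \<subseteq> (\<Union>a\<in>Poly_Mapping.keys f. \<Union>b\<in>Poly_Mapping.keys g. Poly_Mapping.keys
      (mono (a + b) (Poly_Mapping.lookup f a * Poly_Mapping.lookup g b * \<sigma> a b)))"
    by (intro UN_mono keys_sum subset_refl)
  also have "\<dots> \<subseteq> (\<Union>a\<in>Poly_Mapping.keys f. \<Union>b\<in>Poly_Mapping.keys g. {a + b})"
    by (intro UN_mono subset_refl) simp
  finally show ?thesis by blast
qed

lemma tmult_closed: "\<lbrakk>f \<in> carr; g \<in> carr\<rbrakk> \<Longrightarrow> f \<star> g \<in> carr"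
  using tmult_keys[of f g] X_add by blast

lemma tmult_one_left: "f \<in> carr \<Longrightarrow> 1 \<star> f = f"
proof (induction f rule: carr_induct)
  case (single a c)
  then show ?case using tmult_mono[of 0 1 a c] by (simp add: \<sigma>_zero)
qed (simp_all add: tmult_add_right)

lemma tmult_one_right: "f \<in> carr \<Longrightarrow> f \<star> 1 = f"
proof (induction f rule: carr_induct)
  case (single a c)
  then show ?case using tmult_mono[of a c 0 1] by (simp add: \<sigma>_zero)
qed (simp_all add: tmult_add_left)

lemma tmult_scalar_comm: "f \<in> carr \<Longrightarrow> mono 0 c \<star> f = f \<star> mono 0 c"
  by (induction f rule: carr_induct) (simp_all add: tmult_mono \<sigma>_zero tmult_add_left tmult_add_right mult.commute)

lemma scalar_mono: "a \<in> X \<Longrightarrow> mono 0 c \<star> mono a d = mono a (c * d)"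
  by (simp add: tmult_mono \<sigma>_zero)

lemma lookup_scalar:
  "f \<in> carr \<Longrightarrow> Poly_Mapping.lookup (mono 0 c \<star> f) a = c * Poly_Mapping.lookup f a"
  by (induction f rule: carr_induct)
    (simp_all add: scalar_mono tmult_add_right lookup_add lookup_single when_def distrib_left)

lemma scalar_in_carr: "mono 0 c \<in> carr"
  using X_zero by simp

lemma mono_in_carr: "a \<in> X \<Longrightarrow> mono a c \<in> carr"
  by simp

lemma add_in_carr: "\<lbrakk>f \<in> carr; g \<in> carr\<rbrakk> \<Longrightarrow> f + g \<in> carr"
  using keys_add[of f g] by blast

lemma neg_in_carr: "f \<in> carr \<Longrightarrow> - f \<in> carr"
  by (auto simp: in_keys_iff)

lemma diff_in_carr: "\<lbrakk>f \<in> carr; g \<in> carr\<rbrakk> \<Longrightarrow> f - g \<in> carr"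
  using add_in_carr[of f "- g"] neg_in_carr[of g] by simp

lemma sum_in_carr: "(\<And>i. i \<in> I \<Longrightarrow> f i \<in> carr) \<Longrightarrow> (\<Sum>i\<in>I. f i) \<in> carr"
  by (induction I rule: infinite_finite_induct) (use add_in_carr in auto)

lemma q_commute:
  assumes "f \<in> carr" "g \<in> carr"
    and "\<And>a b. \<lbrakk>a \<in> Poly_Mapping.keys f; b \<in> Poly_Mapping.keys g\<rbrakk> \<Longrightarrow> \<sigma> a b = c * \<sigma> b a"
  shows "f \<star> g = mono 0 c \<star> (g \<star> f)"
proof -
  have "mono (a + b) (Poly_Mapping.lookup f a * Poly_Mapping.lookup g b * \<sigma> a b) =
      mono 0 c \<star> mono (b + a) (Poly_Mapping.lookup g b * Poly_Mapping.lookup f a * \<sigma> b a)"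
    if "a \<in> Poly_Mapping.keys f" "b \<in> Poly_Mapping.keys g" for a b
  proof -
    have "b + a \<in> X" using that assms X_add by blast
    then show ?thesis using assms(3)[OF that] by (simp add: scalar_mono add.commute mult_ac)
  qed
  then have "f \<star> g = (\<Sum>a\<in>Poly_Mapping.keys f. \<Sum>b\<in>Poly_Mapping.keys g.
      mono 0 c \<star> mono (b + a) (Poly_Mapping.lookup g b * Poly_Mapping.lookup f a * \<sigma> b a))"
    unfolding tmult_def by (intro sum.cong) auto
  also have "\<dots> = mono 0 c \<star> (\<Sum>a\<in>Poly_Mapping.keys f. \<Sum>b\<in>Poly_Mapping.keys g.
      mono (b + a) (Poly_Mapping.lookup g b * Poly_Mapping.lookup f a * \<sigma> b a))"
    by (simp add: tmult_sum_right)
  also have "\<dots> = mono 0 c \<star> (g \<star> f)"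
    unfolding tmult_def[of g f] by (subst sum.swap) simp
  finally show ?thesis .
qed

subsection \<open>Trailing exponents\<close>

definition trailing :: "('e \<Rightarrow>\<^sub>0 'k) \<Rightarrow> 'e \<Rightarrow> bool" where
  "trailing f e \<longleftrightarrow> e \<in> Poly_Mapping.keys f \<and> (\<forall>a\<in>Poly_Mapping.keys f. e \<le> a)"

lemma trailing_exists: "f \<noteq> 0 \<Longrightarrow> \<exists>e. trailing f e"
  by (rule exI[of _ "Min (Poly_Mapping.keys f)"]) (simp add: trailing_def)

lemma trailing_nonzero: "trailing f e \<Longrightarrow> f \<noteq> 0"
  by (auto simp: trailing_def)

lemma trailing_mono: "c \<noteq> 0 \<Longrightarrow> trailing (mono e c) e"
  by (simp add: trailing_def)

text \<open>The order is compatible with addition, so a' + b' = a + b with a \<le> a' and b \<le> b'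
  forces a' = a and b' = b. The smallest term of the product thus comes from a single pair and
  cannot cancel.\<close>

lemma trailing_mult:
  assumes f: "trailing f a" "f \<in> carr" and g: "trailing g b" "g \<in> carr"
  shows "trailing (f \<star> g) (a + b)"
proof -
  let ?c = "Poly_Mapping.lookup f a * Poly_Mapping.lookup g b * \<sigma> a b"
  have ab: "a \<in> X" "b \<in> X" using f g by (auto simp: trailing_def)
  have "Poly_Mapping.lookup (f \<star> g) (a + b) = (\<Sum>a'\<in>Poly_Mapping.keys f. \<Sum>b'\<in>Poly_Mapping.keys g.
      if a' = a then if b' = b then ?c else 0 else 0)"
    unfolding tmult_def lookup_sum
  proof (intro sum.cong refl)
    fix a' b' assume "a' \<in> Poly_Mapping.keys f" "b' \<in> Poly_Mapping.keys g"
    then have "a \<le> a'" "b \<le> b'" using f g by (auto simp: trailing_def)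
    then have "a' + b' = a + b \<longleftrightarrow> a' = a \<and> b' = b"
      by (metis add_le_less_mono add_less_le_mono order_le_less less_irrefl)
    then show "Poly_Mapping.lookup (mono (a' + b')
        (Poly_Mapping.lookup f a' * Poly_Mapping.lookup g b' * \<sigma> a' b')) (a + b) =
        (if a' = a then if b' = b then ?c else 0 else 0)"
      by (auto simp: lookup_single when_def)
  qed
  also have "\<dots> = (\<Sum>a'\<in>Poly_Mapping.keys f. if a' = a then ?c else 0)"
    using g by (intro sum.cong refl) (auto simp: trailing_def sum.delta)
  also have "\<dots> = ?c" using f by (simp add: trailing_def sum.delta)
  also have "\<dots> \<noteq> 0" using f g ab \<sigma>_nonzero by (simp add: trailing_def in_keys_iff)
  finally have "a + b \<in> Poly_Mapping.keys (f \<star> g)" by (simp add: in_keys_iff)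
  moreover have "a + b \<le> e" if e: "e \<in> Poly_Mapping.keys (f \<star> g)" for e
  proof -
    obtain x y where "e = x + y" "x \<in> Poly_Mapping.keys f" "y \<in> Poly_Mapping.keys g"
      using subsetD[OF tmult_keys e] by blast
    then show ?thesis using f g by (simp add: trailing_def add_mono)
  qed
  ultimately show ?thesis by (simp add: trailing_def)
qed

lemma tmult_eq_zero:
  assumes "f \<in> carr" "g \<in> carr" "f \<star> g = 0"
  shows "f = 0 \<or> g = 0"
  using trailing_exists[of f] trailing_exists[of g] trailing_mult assms trailing_nonzero by blast

subsection \<open>The Ore condition\<close>

text \<open>
  The coefficients of \<open>u\<close> and \<open>v\<close> are \<open>2 card B\<close> unknowns subject to only \<open>card C\<close> linear equations.
\<close>

lemma syzygy:
  assumes "finite B" "finite C" "card C < 2 * card B"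
    and F: "\<And>e. e \<in> B \<Longrightarrow> Poly_Mapping.keys (F e) \<subseteq> C"
    and G: "\<And>e. e \<in> B \<Longrightarrow> Poly_Mapping.keys (G e) \<subseteq> C"
    and BX: "B \<subseteq> X"
    and bilF: "\<And>u. (\<Sum>e\<in>B. mono 0 (u e) \<star> F e) = mF (\<Sum>e\<in>B. mono e (u e))"
    and bilG: "\<And>u. (\<Sum>e\<in>B. mono 0 (u e) \<star> G e) = mG (\<Sum>e\<in>B. mono e (u e))"
    and CX: "C \<subseteq> X"
  shows "\<exists>u\<in>carr. \<exists>v\<in>carr. (u \<noteq> 0 \<or> v \<noteq> 0) \<and> mF u = mG v"
proof -
  have FX: "F e \<in> carr" "G e \<in> carr" if "e \<in> B" for e using F G that CX by blast+
  \<comment> \<open>\<open>True\<close> marks the unknown coefficients of u, \<open>False\<close>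
    those of v; the latter change sign in the definition of \<open>v\<close>, so that a vanishing
    sum becomes an equation. \<open>mF\<close> and \<open>mG\<close> are left abstract so that the
    argument covers multiplication from either side.\<close>
  define I where "I = B \<times> (UNIV :: bool set)"
  have "card I = card B * 2" by (simp add: I_def card_cartesian_product)
  then have I: "finite I" "card C < card I" using assms by (simp_all add: I_def)
  obtain x where x: "\<exists>i\<in>I. x i \<noteq> 0" "\<forall>c\<in>C. (\<Sum>i\<in>I. x i *
      (if snd i then Poly_Mapping.lookup (F (fst i)) c else Poly_Mapping.lookup (G (fst i)) c)) = 0"
    using homogeneous_system_nontrivial[OF assms(2) I, of "\<lambda>i c. if snd i then Poly_Mapping.lookup (F (fst i)) c
      else Poly_Mapping.lookup (G (fst i)) c"] by blast
  define u where "u = (\<Sum>e\<in>B. mono e (x (e, True)))"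
  define v where "v = (\<Sum>e\<in>B. mono e (- x (e, False)))"
  have lk: "Poly_Mapping.lookup (\<Sum>e\<in>B. mono e (h e)) a = (if a \<in> B then h a else 0)" for h :: "'e \<Rightarrow> 'k" and a
    using assms(1) by (simp add: lookup_sum lookup_single when_def sum.delta)
  have "mF u = mG v"
  proof (rule poly_mapping_eqI)
    fix c
    have 1: "Poly_Mapping.lookup (mF u) c = (\<Sum>e\<in>B. x (e, True) * Poly_Mapping.lookup (F e) c)"
      unfolding u_def bilF[symmetric] lookup_sum by (intro sum.cong refl lookup_scalar FX)
    have 2: "Poly_Mapping.lookup (mG v) c = (\<Sum>e\<in>B. (- x (e, False)) * Poly_Mapping.lookup (G e) c)"
      unfolding v_def bilG[symmetric] lookup_sum by (intro sum.cong refl lookup_scalar FX)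
    show "Poly_Mapping.lookup (mF u) c = Poly_Mapping.lookup (mG v) c"
    proof (cases "c \<in> C")
      case True
      have "(\<Sum>i\<in>I. x i * (if snd i then Poly_Mapping.lookup (F (fst i)) c else Poly_Mapping.lookup (G (fst i)) c))
          = (\<Sum>e\<in>B. \<Sum>b\<in>UNIV. x (e, b) * (if b then Poly_Mapping.lookup (F e) c else Poly_Mapping.lookup (G e) c))"
        unfolding I_def by (simp add: sum.cartesian_product case_prod_unfold)
      also have "\<dots> = (\<Sum>e\<in>B. x (e, True) * Poly_Mapping.lookup (F e) c + x (e, False) * Poly_Mapping.lookup (G e) c)"
        by (intro sum.cong refl) (simp add: UNIV_bool add.commute)
      finally have "(\<Sum>e\<in>B. x (e, True) * Poly_Mapping.lookup (F e) c + x (e, False) * Poly_Mapping.lookup (G e) c) = 0"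
        using x(2) True by simp
      then show ?thesis unfolding 1 2 by (simp add: sum.distrib sum_negf eq_neg_iff_add_eq_0)
    next
      case False
      then have "Poly_Mapping.lookup (F e) c = 0" "Poly_Mapping.lookup (G e) c = 0" if "e \<in> B" for e
        using F[OF that] G[OF that] by (auto simp: in_keys_iff)
      then show ?thesis unfolding 1 2 by simp
    qed
  qed
  moreover have "u \<noteq> 0 \<or> v \<noteq> 0"
  proof -
    obtain e b where eb: "e \<in> B" "x (e, b) \<noteq> 0" using x(1) by (auto simp: I_def)
    have "Poly_Mapping.lookup u e = x (e, True)" "Poly_Mapping.lookup v e = - x (e, False)"
      using eb by (simp_all add: u_def v_def lk)
    then show ?thesis using eb(2) by (cases b) auto
  qed
  moreover have "u \<in> carr" "v \<in> carr"
    unfolding u_def v_def using BX by (intro sum_in_carr; auto)+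
  ultimately show ?thesis by blast
qed

lemma folner_pair:
  assumes "f \<in> carr" "g \<in> carr"
  obtains B C where "finite B" "finite C" "card C < 2 * card B" "B \<subseteq> X" "C \<subseteq> X"
    "\<And>a b. a \<in> Poly_Mapping.keys f \<union> Poly_Mapping.keys g \<Longrightarrow> b \<in> B \<Longrightarrow> a + b \<in> C"
proof -
  let ?K = "Poly_Mapping.keys f \<union> Poly_Mapping.keys g"
  have K: "finite ?K" "?K \<subseteq> X" using assms by auto
  obtain B where B: "finite B" "B \<subseteq> X" "card {k + b | k b. k \<in> ?K \<and> b \<in> B} < 2 * card B"
    using folner[OF K] by blast
  have "{k + b | k b. k \<in> ?K \<and> b \<in> B} = (\<lambda>(k, b). k + b) ` (?K \<times> B)" by auto
  then have "finite {k + b | k b. k \<in> ?K \<and> b \<in> B}" using K(1) B(1) by simp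
  moreover have "{k + b | k b. k \<in> ?K \<and> b \<in> B} \<subseteq> X" using K(2) B(2) X_add by blast
  ultimately show ?thesis using that[of B "{k + b | k b. k \<in> ?K \<and> b \<in> B}"] B by blast
qed

lemma right_ore_condition:
  assumes "f \<in> carr" "g \<in> carr" "f \<noteq> 0" "g \<noteq> 0"
  shows "\<exists>u\<in>carr. \<exists>v\<in>carr. f \<star> u = g \<star> v \<and> f \<star> u \<noteq> 0"
proof -
  obtain B C where BC: "finite B" "finite C" "card C < 2 * card B" "B \<subseteq> X" "C \<subseteq> X"
    "\<And>a b. a \<in> Poly_Mapping.keys f \<union> Poly_Mapping.keys g \<Longrightarrow> b \<in> B \<Longrightarrow> a + b \<in> C"
    using folner_pair[OF assms(1,2)] by blast
  have bil: "(\<Sum>e\<in>B. mono 0 (u e) \<star> (h \<star> mono e 1)) = h \<star> (\<Sum>e\<in>B. mono e (u e))"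
    if h: "h \<in> carr" for h u
    unfolding tmult_sum_right
  proof (intro sum.cong refl)
    fix e assume "e \<in> B"
    then have e: "e \<in> X" using BC by auto
    have "mono 0 (u e) \<star> (h \<star> mono e 1) = mono 0 (u e) \<star> h \<star> mono e 1"
      by (rule tmult_assoc[symmetric]) (use h e X_zero in auto)
    also have "\<dots> = h \<star> mono 0 (u e) \<star> mono e 1" using tmult_scalar_comm[OF h] by simp
    also have "\<dots> = h \<star> (mono 0 (u e) \<star> mono e 1)"
      by (rule tmult_assoc) (use h e X_zero in auto)
    also have "\<dots> = h \<star> mono e (u e)" using e by (simp add: scalar_mono)
    finally show "mono 0 (u e) \<star> (h \<star> mono e 1) = h \<star> mono e (u e)" .
  qed
  have k: "Poly_Mapping.keys (h \<star> mono e 1) \<subseteq> C"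
    if "Poly_Mapping.keys h \<subseteq> Poly_Mapping.keys f \<union> Poly_Mapping.keys g" "e \<in> B" for h e
    using tmult_keys[of h "mono e 1"] that BC(6) by fastforce
  obtain u v where uv: "u \<in> carr" "v \<in> carr" "u \<noteq> 0 \<or> v \<noteq> 0" "f \<star> u = g \<star> v"
    using syzygy[OF BC(1-3), of "\<lambda>e. f \<star> mono e 1" "\<lambda>e. g \<star> mono e 1" "\<lambda>u. f \<star> u" "\<lambda>u. g \<star> u"]
      k bil[OF assms(1)] bil[OF assms(2)] BC(4,5) by blast
  \<comment> \<open>Only one of u and v is known to be nonzero. In a domain f u = g v = 0 would make
    both vanish.\<close>
  have "f \<star> u \<noteq> 0"
  proof
    assume 0: "f \<star> u = 0"
    then have "u = 0" using tmult_eq_zero[OF assms(1) uv(1)] assms(3) by simp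
    moreover have "v = 0" using tmult_eq_zero[OF assms(2) uv(2)] assms(4) 0 uv(4) by simp
    ultimately show False using uv(3) by simp
  qed
  then show ?thesis using uv by blast
qed

lemma left_ore_condition:
  assumes "f \<in> carr" "g \<in> carr" "f \<noteq> 0" "g \<noteq> 0"
  shows "\<exists>u\<in>carr. \<exists>v\<in>carr. u \<star> f = v \<star> g \<and> u \<star> f \<noteq> 0"
proof -
  obtain B C where BC: "finite B" "finite C" "card C < 2 * card B" "B \<subseteq> X" "C \<subseteq> X"
    "\<And>a b. a \<in> Poly_Mapping.keys f \<union> Poly_Mapping.keys g \<Longrightarrow> b \<in> B \<Longrightarrow> a + b \<in> C"
    using folner_pair[OF assms(1,2)] by blast
  have bil: "(\<Sum>e\<in>B. mono 0 (u e) \<star> (mono e 1 \<star> h)) = (\<Sum>e\<in>B. mono e (u e)) \<star> h"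
    if h: "h \<in> carr" for h u
    unfolding tmult_sum_left
  proof (intro sum.cong refl)
    fix e assume "e \<in> B"
    then have e: "e \<in> X" using BC by auto
    have "mono 0 (u e) \<star> (mono e 1 \<star> h) = mono 0 (u e) \<star> mono e 1 \<star> h"
      by (rule tmult_assoc[symmetric]) (use h e X_zero in auto)
    then show "mono 0 (u e) \<star> (mono e 1 \<star> h) = mono e (u e) \<star> h" using e by (simp add: scalar_mono)
  qed
  have k: "Poly_Mapping.keys (mono e 1 \<star> h) \<subseteq> C"
    if "Poly_Mapping.keys h \<subseteq> Poly_Mapping.keys f \<union> Poly_Mapping.keys g" "e \<in> B" for h e
    using tmult_keys[of "mono e 1" h] that BC(6) by (fastforce simp: add.commute)
  obtain u v where uv: "u \<in> carr" "v \<in> carr" "u \<noteq> 0 \<or> v \<noteq> 0" "u \<star> f = v \<star> g"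
    using syzygy[OF BC(1-3), of "\<lambda>e. mono e 1 \<star> f" "\<lambda>e. mono e 1 \<star> g" "\<lambda>u. u \<star> f" "\<lambda>u. u \<star> g"]
      k bil[OF assms(1)] bil[OF assms(2)] BC(4,5) by blast
  have "u \<star> f \<noteq> 0"
  proof
    assume 0: "u \<star> f = 0"
    then have "u = 0" using tmult_eq_zero[OF uv(1) assms(1)] assms(3) by simp
    moreover have "v = 0" using tmult_eq_zero[OF uv(2) assms(2)] assms(4) 0 uv(4) by simp
    ultimately show False using uv(3) by simp
  qed
  then show ?thesis using uv by blast
qed

definition tw_alg :: "('k, 'e \<Rightarrow>\<^sub>0 'k) module" where
  "tw_alg = \<lparr>carrier = carr, mult = (\<star>), one = 1, zero = 0, add = (+), smult = (\<lambda>c f. mono 0 c \<star> f)\<rparr>"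

lemma tw_alg_simps:
  "carrier tw_alg = carr" "mult tw_alg = (\<star>)" "one tw_alg = 1" "zero tw_alg = 0" "add tw_alg = (+)"
  "smult tw_alg = (\<lambda>c f. mono 0 c \<star> f)"
  by (simp_all add: tw_alg_def)

sublocale T: ore_domain tw_alg
proof -
  have "abelian_group tw_alg"
  proof (rule abelian_groupI, unfold tw_alg_simps)
    fix f g h :: "'e \<Rightarrow>\<^sub>0 'k"
    show "f \<in> carr \<Longrightarrow> \<exists>y\<in>carr. y + f = 0" using neg_in_carr by (intro bexI[of _ "- f"]) auto
  qed (use add_in_carr in \<open>auto simp: ac_simps\<close>)
  moreover have "Group.monoid tw_alg"
    by (rule monoidI, unfold tw_alg_simps)
      (use tmult_closed tmult_assoc tmult_one_left tmult_one_right X_zero in simp_all)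
  ultimately have "ring tw_alg"
    by (rule ringI, unfold tw_alg_simps) (rule tmult_add_left tmult_add_right)+
  then interpret ring tw_alg .
  show "ore_domain tw_alg"
  proof (unfold_locales, unfold tw_alg_simps)
    fix f g :: "'e \<Rightarrow>\<^sub>0 'k" and c d
    assume f: "f \<in> carr"
    show "mono 0 c \<star> f \<in> carr" using tmult_closed[OF scalar_in_carr f] .
    show "mono 0 (c + d) \<star> f = mono 0 c \<star> f + mono 0 d \<star> f" by (simp add: single_add tmult_add_left)
    show "mono 0 (c * d) \<star> f = mono 0 c \<star> (mono 0 d \<star> f)"
      by (simp add: tmult_assoc[OF scalar_in_carr scalar_in_carr f, symmetric] scalar_mono X_zero)
    show "mono 0 1 \<star> f = f" using tmult_one_left[OF f] by simp
    assume g: "g \<in> carr"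
    show "mono 0 c \<star> (f + g) = mono 0 c \<star> f + mono 0 c \<star> g" by (rule tmult_add_right)
    show "mono 0 c \<star> f \<star> g = mono 0 c \<star> (f \<star> g)" by (rule tmult_assoc[OF scalar_in_carr f g])
    show "f \<star> (mono 0 c \<star> g) = mono 0 c \<star> (f \<star> g)"
      unfolding tmult_assoc[OF scalar_in_carr f g, symmetric] tmult_scalar_comm[OF f]
      by (rule tmult_assoc[OF f scalar_in_carr g, symmetric])
    show "f \<star> g = 0 \<Longrightarrow> f = 0 \<or> g = 0" by (rule tmult_eq_zero[OF f g])
  next
    fix f g :: "'e \<Rightarrow>\<^sub>0 'k"
    assume "f \<in> carr - {0}" "g \<in> carr - {0}"
    then have fg: "f \<in> carr" "g \<in> carr" "f \<noteq> 0" "g \<noteq> 0" by simp_all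
    show "\<exists>u\<in>carr. \<exists>v\<in>carr. f \<star> u = g \<star> v \<and> f \<star> u \<noteq> 0" by (rule right_ore_condition[OF fg])
    show "\<exists>u\<in>carr. \<exists>v\<in>carr. u \<star> f = v \<star> g \<and> u \<star> f \<noteq> 0" by (rule left_ore_condition[OF fg])
  qed simp
qed

end

text \<open>If the monomials with exponents in \<open>C\<close> lie in the image, so does everything
  supported in \<open>C\<close>. Since \<open>C\<close> contains a translate of every finite set of
  exponents, a single monomial moves the supports of t1 and t2 into \<open>C\<close>; as addition of
  exponents is commutative, it does so from the left and from the right.\<close>

lemma dense_embedding_twistedI:
  fixes A :: "('k::field, 'a) module" and X :: "'e::linordered_ab_group_add set"
  assumes "twisted_monoid_algebra \<sigma> X" and "k_algebra A"
    and hom: "\<iota> \<in> ring_hom A (twisted_monoid_algebra.tw_alg \<sigma> X)"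
    and lin: "k_linear A (twisted_monoid_algebra.tw_alg \<sigma> X) \<iota>"
    and inj: "inj_on \<iota> (carrier A)"
    and cone: "\<And>e. e \<in> C \<Longrightarrow> Poly_Mapping.single e 1 \<in> \<iota> ` carrier A"
    and shift: "\<And>K. \<lbrakk>finite K; K \<subseteq> X\<rbrakk> \<Longrightarrow> \<exists>e\<in>C. \<forall>k\<in>K. k + e \<in> C"
    and CX: "C \<subseteq> X"
  shows "dense_embedding A (twisted_monoid_algebra.tw_alg \<sigma> X) \<iota>"
proof -
  interpret twisted_monoid_algebra \<sigma> X by fact
  interpret A: k_algebra A by fact
  have im_add: "f + g \<in> \<iota> ` carrier A" if "f \<in> \<iota> ` carrier A" "g \<in> \<iota> ` carrier A" for f g
  proof -
    obtain a b where ab: "a \<in> carrier A" "b \<in> carrier A" "f = \<iota> a" "g = \<iota> b" using \<open>f \<in> _\<close> \<open>g \<in> _\<close> by blast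
    then have "f + g = \<iota> (a \<oplus>\<^bsub>A\<^esub> b)" using ring_hom_add[OF hom ab(1,2)] by (simp add: tw_alg_simps)
    then show ?thesis using ab by simp
  qed
  have im_mono: "mono e c \<in> \<iota> ` carrier A" if e: "e \<in> C" for e c
  proof -
    obtain a where a: "a \<in> carrier A" "mono e 1 = \<iota> a" using cone[OF e] by blast
    have "\<iota> (c \<odot>\<^bsub>A\<^esub> a) = mono 0 c \<star> \<iota> a" using lin a(1) by (simp add: k_linear_def tw_alg_simps)
    also have "\<dots> = mono e c" unfolding a(2)[symmetric] using e CX by (subst scalar_mono) auto
    finally show ?thesis using A.smult_closed[OF a(1)] by (metis imageI)
  qed
  have im: "f \<in> \<iota> ` carrier A" if "Poly_Mapping.keys f \<subseteq> C" for f
    using that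
  proof (induction f rule: poly_mapping_additive_induct)
    case zero
    \<comment> \<open>\<open>shift\<close> for the empty set shows that \<open>C\<close> is
      nonempty; a zero coefficient then gives the zero element.\<close>
    obtain e where "e \<in> C" using shift[of "{}"] by auto
    then show ?case using im_mono[of e 0] by simp
  qed (use im_add im_mono in auto)
  have z: "a \<noteq> \<zero>\<^bsub>A\<^esub>" if "mono e 1 = \<iota> a" "a \<in> carrier A" for e a
  proof
    assume "a = \<zero>\<^bsub>A\<^esub>"
    then have "\<iota> a = \<iota> a + \<iota> a"
      using ring_hom_add[OF hom that(2) that(2)] by (simp only: tw_alg_simps A.l_zero A.zero_closed)
    then have "mono e 1 = (0 :: 'e \<Rightarrow>\<^sub>0 'k)" unfolding that(1) by (metis add_cancel_right_right)
    then show False by (metis keys_single keys_zero insert_not_empty zero_neq_one)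
  qed
  have dense: "\<exists>s\<in>carrier A - {\<zero>\<^bsub>A\<^esub>}. (t1 \<star> \<iota> s \<in> \<iota> ` carrier A \<and> t2 \<star> \<iota> s \<in> \<iota> ` carrier A) \<and>
      (\<iota> s \<star> t1 \<in> \<iota> ` carrier A \<and> \<iota> s \<star> t2 \<in> \<iota> ` carrier A)"
    if t: "t1 \<in> carr" "t2 \<in> carr" for t1 t2
  proof -
    have K: "finite (Poly_Mapping.keys t1 \<union> Poly_Mapping.keys t2)" "Poly_Mapping.keys t1 \<union> Poly_Mapping.keys t2 \<subseteq> X"
      using t by auto
    obtain e where e: "e \<in> C" "\<And>k. k \<in> Poly_Mapping.keys t1 \<union> Poly_Mapping.keys t2 \<Longrightarrow> k + e \<in> C"
      using shift[OF K] by blast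
    obtain s where s: "s \<in> carrier A" "mono e 1 = \<iota> s" using cone[OF e(1)] by blast
    have r: "t \<star> mono e 1 \<in> \<iota> ` carrier A" "mono e 1 \<star> t \<in> \<iota> ` carrier A"
      if "Poly_Mapping.keys t \<subseteq> Poly_Mapping.keys t1 \<union> Poly_Mapping.keys t2" for t
    proof -
      have "Poly_Mapping.keys (t \<star> mono e 1) \<subseteq> C"
        using tmult_keys[of t "mono e 1"] e(2) that by fastforce
      then show "t \<star> mono e 1 \<in> \<iota> ` carrier A" by (rule im)
      have "Poly_Mapping.keys (mono e 1 \<star> t) \<subseteq> C"
        using tmult_keys[of "mono e 1" t] e(2) that by (fastforce simp: add.commute)
      then show "mono e 1 \<star> t \<in> \<iota> ` carrier A" by (rule im)
    qed
    show ?thesis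
      by (rule bexI[of _ s]) (use r[of t1] r[of t2] s z[OF s(2,1)] in auto)
  qed
  show ?thesis
    by (unfold_locales; (unfold tw_alg_simps)?)
      (use hom lin inj in \<open>simp_all add: tw_alg_simps\<close>, (use dense in blast)+)
qed

section \<open>Quantum tori\<close>

lemma mult_antisymmetricD:
  assumes "mult_antisymmetric N L" "i \<in> {1..N}" "j \<in> {1..N}"
  shows "L i j \<noteq> 0" "L j i = inverse (L i j)" "L i i = 1"
  using assms unfolding mult_antisymmetric_def by blast+

definition torus_exponents :: "nat \<Rightarrow> (nat \<Rightarrow>\<^sub>0 int) set" where
  "torus_exponents N = {e. Poly_Mapping.keys e \<subseteq> {1..N}}"

definition exponent_box :: "nat \<Rightarrow> int \<Rightarrow> int \<Rightarrow> (nat \<Rightarrow>\<^sub>0 int) set" where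
  "exponent_box N l u =
    {e \<in> torus_exponents N. \<forall>i\<in>{1..N}. l \<le> Poly_Mapping.lookup e i \<and> Poly_Mapping.lookup e i < u}"

lemma lookup_outside: "e \<in> torus_exponents N \<Longrightarrow> i \<notin> {1..N} \<Longrightarrow> Poly_Mapping.lookup e i = 0"
  unfolding torus_exponents_def mem_Collect_eq using in_keys_iff[of i e] by blast

lemma bij_exponent_box:
  "bij_betw (\<lambda>e. restrict (Poly_Mapping.lookup e) {1..N}) (exponent_box N l u) (PiE {1..N} (\<lambda>_. {l..<u}))"
proof (rule bij_betwI')
  fix e e' assume e: "e \<in> exponent_box N l u" "e' \<in> exponent_box N l u"
  show "(restrict (Poly_Mapping.lookup e) {1..N} = restrict (Poly_Mapping.lookup e') {1..N}) = (e = e')"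
  proof
    assume h: "restrict (Poly_Mapping.lookup e) {1..N} = restrict (Poly_Mapping.lookup e') {1..N}"
    show "e = e'"
    proof (rule poly_mapping_eqI)
      fix i show "Poly_Mapping.lookup e i = Poly_Mapping.lookup e' i"
        using fun_cong[OF h, of i] e lookup_outside[of e N i] lookup_outside[of e' N i]
        by (cases "i \<in> {1..N}") (simp_all add: exponent_box_def)
    qed
  qed simp
next
  fix e assume "e \<in> exponent_box N l u"
  then show "restrict (Poly_Mapping.lookup e) {1..N} \<in> PiE {1..N} (\<lambda>_. {l..<u})"
    by (auto simp: exponent_box_def)
next
  fix f assume f: "f \<in> PiE {1..N} (\<lambda>_. {l..<u})"
  define e where "e = Abs_poly_mapping (\<lambda>i. if i \<in> {1..N} then f i else 0)"
  have "finite {i. (if i \<in> {1..N} then f i else 0) \<noteq> 0}"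
    by (rule finite_subset[of _ "{1..N}"]) auto
  then have lk: "Poly_Mapping.lookup e i = (if i \<in> {1..N} then f i else 0)" for i
    by (simp add: e_def)
  have "e \<in> exponent_box N l u"
    using PiE_mem[OF f] by (auto simp: exponent_box_def torus_exponents_def lk in_keys_iff split: if_splits)
  moreover have "f = restrict (Poly_Mapping.lookup e) {1..N}"
  proof
    fix i show "f i = restrict (Poly_Mapping.lookup e) {1..N} i"
      using PiE_arb[OF f, of i] by (cases "i \<in> {1..N}") (simp_all add: lk)
  qed
  ultimately show "\<exists>e\<in>exponent_box N l u. f = restrict (Poly_Mapping.lookup e) {1..N}" by blast
qed

lemma finite_exponent_box: "finite (exponent_box N l u)"
proof -
  have "finite (PiE {1..N} (\<lambda>_. {l..<u}))" by (intro finite_PiE) simp_all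
  then show ?thesis using bij_betw_finite[OF bij_exponent_box] by blast
qed

lemma card_exponent_box: "card (exponent_box N l u) = nat (u - l) ^ N"
  using bij_betw_same_card[OF bij_exponent_box[of N l u]] by (simp add: card_PiE)

text \<open>A cube of side m grows by d at both ends of each of its N edges. By Bernoulli the ratio
  of the volumes, old to new, is at least 1 - 2dN / (m + 2d), and this exceeds 1/2 as soon as m >
  4dN. The summand 1 in \<open>m\<close> makes this strict and keeps m positive when d N =
  0.\<close>

lemma exponent_box_growth:
  fixes d N :: nat
  defines "m \<equiv> 4 * d * N + 1"
  shows "(m + 2 * d) ^ N < 2 * m ^ N"
proof -
  define M where "M = real (m + 2 * d)"
  define x where "x = - (2 * real d / M)"
  have M: "M > 0" "2 * real d \<le> M" "4 * real d * real N < M"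
  proof -
    have "real m > 0" unfolding of_nat_0_less_iff by (simp add: m_def)
    moreover have "real m = 4 * real d * real N + 1" by (simp add: m_def)
    ultimately show "M > 0" "2 * real d \<le> M" "4 * real d * real N < M" by (simp_all add: M_def)
  qed
  then have "x \<ge> - 1" by (simp add: x_def divide_le_eq)
  then have "1 + real N * x \<le> (1 + x) ^ N" by (rule Bernoulli_inequality)
  moreover have "1 + real N * x > 1 / 2"
    using M by (simp add: x_def field_simps)
  moreover have "1 + x = real m / M" using M by (simp add: x_def M_def field_simps)
  ultimately have "1 / 2 < (real m / M) ^ N" by simp
  then have "M ^ N < 2 * real m ^ N" using M by (simp add: power_divide field_simps)
  then have "real ((m + 2 * d) ^ N) < real (2 * m ^ N)" by (simp add: M_def)
  then show ?thesis by (simp only: of_nat_less_iff)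
qed

lemma torus_exponents_folner:
  assumes "finite K" "K \<subseteq> torus_exponents N"
  shows "\<exists>B. finite B \<and> B \<subseteq> torus_exponents N \<and> card {k + b | k b. k \<in> K \<and> b \<in> B} < 2 * card B"
proof -
  have "finite (\<Union>k\<in>K. (\<lambda>i. nat \<bar>Poly_Mapping.lookup k i\<bar>) ` {1..N})" using assms(1) by simp
  then obtain d :: nat where "\<forall>x\<in>(\<Union>k\<in>K. (\<lambda>i. nat \<bar>Poly_Mapping.lookup k i\<bar>) ` {1..N}). x \<le> d"
    unfolding finite_nat_set_iff_bounded_le by (elim exE)
  then have d: "nat \<bar>Poly_Mapping.lookup k i\<bar> \<le> d" if "k \<in> K" "i \<in> {1..N}" for k i
    using that by simp
  define m where "m = 4 * d * N + 1"
  \<comment> \<open>All coordinates of elements of \<open>K\<close> are at most \<open>d\<close> in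
    absolute value, so adding them to a cube of side \<open>m\<close> stays inside the cube of side
    \<open>m + 2 * d\<close>.\<close>
  let ?B = "exponent_box N 0 (int m)" and ?C = "exponent_box N (- int d) (int (m + d))"
  have "{k + b | k b. k \<in> K \<and> b \<in> ?B} \<subseteq> ?C"
  proof clarify
    fix k b assume kb: "k \<in> K" "b \<in> ?B"
    have "k + b \<in> torus_exponents N"
      using kb assms(2) keys_add[of k b] by (auto simp: exponent_box_def torus_exponents_def)
    moreover have "- int d \<le> Poly_Mapping.lookup (k + b) i \<and> Poly_Mapping.lookup (k + b) i < int (m + d)"
      if i: "i \<in> {1..N}" for i
    proof -
      have "0 \<le> Poly_Mapping.lookup b i" "Poly_Mapping.lookup b i < int m"
        using kb(2) i by (auto simp: exponent_box_def)
      moreover have "\<bar>Poly_Mapping.lookup k i\<bar> \<le> int d" using d[OF kb(1) i] by linarith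
      ultimately show ?thesis unfolding lookup_add of_nat_add by linarith
    qed
    ultimately show "k + b \<in> ?C" by (simp add: exponent_box_def)
  qed
  then have "card {k + b | k b. k \<in> K \<and> b \<in> ?B} \<le> card ?C"
    by (intro card_mono finite_exponent_box)
  also have "\<dots> = (m + 2 * d) ^ N"
    unfolding card_exponent_box by (intro arg_cong[of _ _ "\<lambda>x. x ^ N"]) simp
  also have "\<dots> < 2 * m ^ N" unfolding m_def by (rule exponent_box_growth)
  also have "m ^ N = card ?B" by (simp add: card_exponent_box)
  finally have lt: "card {k + b | k b. k \<in> K \<and> b \<in> ?B} < 2 * card ?B" .
  have "?B \<subseteq> torus_exponents N" unfolding exponent_box_def by (rule Collect_subset)
  then show ?thesis by (intro exI[of _ ?B] conjI finite_exponent_box lt)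
qed

locale quantum_torus =
  fixes N :: nat and L :: "nat \<Rightarrow> nat \<Rightarrow> 'k::field"
  assumes antisym: "mult_antisymmetric N L"
begin

text \<open>The monomial with exponent a stands for the ordered product z_1^(a_1) ... z_N^(a_N).
  Bringing z^a z^b into this order moves z_j to the left past z_i exactly for j < i, which explains
  why only these pairs contribute.\<close>

definition cocycle :: "(nat \<Rightarrow>\<^sub>0 int) \<Rightarrow> (nat \<Rightarrow>\<^sub>0 int) \<Rightarrow> 'k" where
  "cocycle a b = (\<Prod>i\<in>{1..N}. \<Prod>j\<in>{1..<i}. L i j powi (Poly_Mapping.lookup a i * Poly_Mapping.lookup b j))"

lemma L_nonzero: "i \<in> {1..N} \<Longrightarrow> j \<in> {1..<i} \<Longrightarrow> L i j \<noteq> 0"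
  using mult_antisymmetricD(1)[OF antisym, of i j] by auto

lemma cocycle_add:
  "cocycle (a + b) c = cocycle a c * cocycle b c"
  "cocycle a (b + c) = cocycle a b * cocycle a c"
  unfolding cocycle_def prod.distrib[symmetric]
  by (intro prod.cong refl; simp add: lookup_add distrib_left distrib_right power_int_add L_nonzero)+

lemma cocycle_nonzero: "cocycle a b \<noteq> 0"
  by (simp add: cocycle_def L_nonzero power_int_eq_0_iff)

sublocale twisted_monoid_algebra cocycle "torus_exponents N"
proof
  fix a b :: "nat \<Rightarrow>\<^sub>0 int"
  show "\<lbrakk>a \<in> torus_exponents N; b \<in> torus_exponents N\<rbrakk> \<Longrightarrow> a + b \<in> torus_exponents N"
    using keys_add[of a b] by (auto simp: torus_exponents_def)
qed (rule cocycle_add cocycle_nonzero torus_exponents_folner | simp add: torus_exponents_def)+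

notation tmult (infixl \<open>\<star>\<close> 70)

definition unit_exp :: "nat \<Rightarrow> (nat \<Rightarrow>\<^sub>0 int)" where
  "unit_exp i = Poly_Mapping.single i 1"

lemma unit_exp_in: "i \<in> {1..N} \<Longrightarrow> unit_exp i \<in> torus_exponents N"
  by (simp add: unit_exp_def torus_exponents_def)

lemma cocycle_unit:
  assumes "i \<in> {1..N}" "j \<in> {1..N}"
  shows "cocycle (unit_exp i) (unit_exp j) = (if j < i then L i j else 1)"
proof -
  have "cocycle (unit_exp i) (unit_exp j) =
      (\<Prod>i'\<in>{1..N}. if i' = i then (\<Prod>j'\<in>{1..<i}. if j' = j then L i j else 1) else 1)"
    unfolding cocycle_def
  proof (intro prod.cong refl)
    fix i'
    have "(\<Prod>j'\<in>{1..<i}. L i j' powi (Poly_Mapping.lookup (unit_exp i) i * Poly_Mapping.lookup (unit_exp j) j'))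
        = (\<Prod>j'\<in>{1..<i}. if j' = j then L i j else 1)"
      by (intro prod.cong refl) (simp add: unit_exp_def lookup_single when_def)
    then show "(\<Prod>j'\<in>{1..<i'}. L i' j' powi (Poly_Mapping.lookup (unit_exp i) i' * Poly_Mapping.lookup (unit_exp j) j'))
        = (if i' = i then (\<Prod>j'\<in>{1..<i}. if j' = j then L i j else 1) else 1)"
      by (cases "i' = i") (simp_all add: unit_exp_def lookup_single)
  qed
  then show ?thesis using assms by (auto simp: prod.delta)
qed

text \<open>The cocycle depends on the chosen order of the generators. Its quotient by the transpose
  is again a bicharacter, takes the values \<open>L i j\<close> on unit exponents whatever the
  order, and is all that a commutation relation sees.\<close>

definition comm_factor :: "(nat \<Rightarrow>\<^sub>0 int) \<Rightarrow> (nat \<Rightarrow>\<^sub>0 int) \<Rightarrow> 'k" where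
  "comm_factor a b = cocycle a b / cocycle b a"

lemma comm_factor_unit:
  assumes "i \<in> {1..N}" "j \<in> {1..N}"
  shows "comm_factor (unit_exp i) (unit_exp j) = L i j"
proof (cases "j < i")
  case True
  then show ?thesis using assms by (simp add: comm_factor_def cocycle_unit)
next
  case False
  then show ?thesis using assms mult_antisymmetricD(2)[OF antisym assms(2,1)] mult_antisymmetricD(3)[OF antisym assms]
    by (cases "i = j") (simp_all add: comm_factor_def cocycle_unit inverse_eq_divide)
qed

lemma comm_factor_add:
  "comm_factor (a + b) c = comm_factor a c * comm_factor b c"
  "comm_factor a (b + c) = comm_factor a b * comm_factor a c"
  by (simp_all add: comm_factor_def cocycle_add)

lemma comm_factor_zero: "comm_factor 0 a = 1" "comm_factor a 0 = 1"
  by (simp_all add: comm_factor_def cocycle_def)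

lemma comm_factor_minus:
  "comm_factor (- a) b = inverse (comm_factor a b)" "comm_factor a (- b) = inverse (comm_factor a b)"
proof -
  have "comm_factor a b * comm_factor (- a) b = 1" "comm_factor a b * comm_factor a (- b) = 1"
    using comm_factor_add(1)[of a "- a" b] comm_factor_add(2)[of a b "- b"] by (simp_all add: comm_factor_zero)
  then show "comm_factor (- a) b = inverse (comm_factor a b)" "comm_factor a (- b) = inverse (comm_factor a b)"
    by (blast intro: inverse_unique[symmetric])+
qed

text \<open>Intended for the images of the \<open>GenX i\<close>, which have up to two terms: a
  commutation relation survives when both exponents have the same factor.\<close>

lemma comm_factor_commute:
  assumes "f \<in> carr" "g \<in> carr"
    and "\<And>a b. \<lbrakk>a \<in> Poly_Mapping.keys f; b \<in> Poly_Mapping.keys g\<rbrakk> \<Longrightarrow> comm_factor a b = c"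
  shows "f \<star> g = mono 0 c \<star> (g \<star> f)"
proof (rule q_commute[OF assms(1,2)])
  fix a b assume "a \<in> Poly_Mapping.keys f" "b \<in> Poly_Mapping.keys g"
  from assms(3)[OF this] show "cocycle a b = c * cocycle b a"
    using cocycle_nonzero[of b a] by (simp add: comm_factor_def field_simps)
qed

end

section \<open>Presented algebras\<close>

definition monom_word :: "'g list \<Rightarrow> ('g word \<Rightarrow>\<^sub>0 'k::field)" where
  "monom_word l = Poly_Mapping.single (Word l) 1"

lemma monom_word_append: "monom_word (l @ l') = monom_word l * monom_word l'"
  by (simp add: monom_word_def mult_single plus_word_def)

lemma gen_eq_monom_word: "gen g = monom_word [g]"
  by (simp add: gen_def monom_word_def)

lemma monom_word_Cons: "monom_word (g # l) = gen g * monom_word l"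
  using monom_word_append[of "[g]" l] by (simp add: gen_eq_monom_word)

lemma scalar_mult_single: "scalar c * Poly_Mapping.single w d = Poly_Mapping.single w (c * d)"
  by (simp add: scalar_def mult_single)

lemma single_eq_scalar_monom_word: "Poly_Mapping.single w c = scalar c * monom_word (letters w)"
  by (simp add: monom_word_def scalar_mult_single)

lemma scalar_comm: "scalar c * f = f * scalar c"
proof -
  have "Poly_Mapping.keys f \<subseteq> UNIV" by simp
  then show ?thesis
    by (induction f rule: poly_mapping_additive_induct)
      (simp_all add: scalar_def mult_single distrib_left distrib_right mult.commute)
qed

lemma scalar_left_commute: "f * (scalar c * g) = scalar c * (f * g)"
  by (metis mult.assoc scalar_comm)

lemma scalar_mult: "scalar (c * d) = scalar c * scalar d"
  by (simp add: scalar_def mult_single)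

lemma scalar_add: "scalar (c + d) = scalar c + scalar d"
  by (simp add: scalar_def single_add)

lemma scalar_one: "scalar 1 = 1"
  by (simp add: scalar_def)

definition words_in :: "'g set \<Rightarrow> 'g word set" where
  "words_in S = {w. set (letters w) \<subseteq> S}"

lemma free_algebra_simps:
  "carrier (free_algebra S) = {f. Poly_Mapping.keys f \<subseteq> words_in S}"
  "monoid.mult (free_algebra S) = (*)" "one (free_algebra S) = 1" "zero (free_algebra S) = 0"
  "add (free_algebra S) = (+)"
  by (auto simp: free_algebra_def words_in_def)

lemma free_algebra_carrier_closed:
  "\<lbrakk>f \<in> carrier (free_algebra S); g \<in> carrier (free_algebra S)\<rbrakk> \<Longrightarrow> f + g \<in> carrier (free_algebra S)"
  "\<lbrakk>f \<in> carrier (free_algebra S); g \<in> carrier (free_algebra S)\<rbrakk> \<Longrightarrow> f * g \<in> carrier (free_algebra S)"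
  "f \<in> carrier (free_algebra S) \<Longrightarrow> - f \<in> carrier (free_algebra S)"
  "\<lbrakk>f \<in> carrier (free_algebra S); g \<in> carrier (free_algebra S)\<rbrakk> \<Longrightarrow> f - g \<in> carrier (free_algebra S)"
  "scalar c \<in> carrier (free_algebra S)"
  "set l \<subseteq> S \<Longrightarrow> monom_word l \<in> carrier (free_algebra S)"
  "x \<in> S \<Longrightarrow> gen x \<in> carrier (free_algebra S)"
proof -
  have neg: "- f \<in> carrier (free_algebra S)" if "f \<in> carrier (free_algebra S)" for f
    using that by (auto simp: free_algebra_simps in_keys_iff)
  have add: "f + g \<in> carrier (free_algebra S)"
    if "f \<in> carrier (free_algebra S)" "g \<in> carrier (free_algebra S)" for f g
    using that keys_add[of f g] by (auto simp: free_algebra_simps)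
  show "f \<in> carrier (free_algebra S) \<Longrightarrow> - f \<in> carrier (free_algebra S)" by (rule neg)
  show "\<lbrakk>f \<in> carrier (free_algebra S); g \<in> carrier (free_algebra S)\<rbrakk> \<Longrightarrow> f + g \<in> carrier (free_algebra S)"
    by (rule add)
  show "\<lbrakk>f \<in> carrier (free_algebra S); g \<in> carrier (free_algebra S)\<rbrakk> \<Longrightarrow> f - g \<in> carrier (free_algebra S)"
    using add[of f "- g"] neg[of g] by simp
  have "a + b \<in> words_in S" if "a \<in> words_in S" "b \<in> words_in S" for a b
    using that by (simp add: words_in_def plus_word_def)
  then show "\<lbrakk>f \<in> carrier (free_algebra S); g \<in> carrier (free_algebra S)\<rbrakk> \<Longrightarrow> f * g \<in> carrier (free_algebra S)"
    using keys_mult[of f g] unfolding free_algebra_simps by blast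
  show "scalar c \<in> carrier (free_algebra S)"
    by (simp add: free_algebra_simps scalar_def words_in_def zero_word_def)
  show "set l \<subseteq> S \<Longrightarrow> monom_word l \<in> carrier (free_algebra S)"
    by (simp add: free_algebra_simps monom_word_def words_in_def)
  show "x \<in> S \<Longrightarrow> gen x \<in> carrier (free_algebra S)"
    by (simp add: free_algebra_simps gen_def words_in_def)
qed

lemma free_algebra_sum_closed:
  "(\<And>i. i \<in> J \<Longrightarrow> f i \<in> carrier (free_algebra S)) \<Longrightarrow> (\<Sum>i\<in>J. f i) \<in> carrier (free_algebra S)"
  by (induction J rule: infinite_finite_induct)
    (simp_all add: free_algebra_carrier_closed(1), simp_all add: free_algebra_simps)

lemma free_algebra_ring: "ring (free_algebra S)"
proof (rule ringI)
  show "abelian_group (free_algebra S)"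
  proof (rule abelian_groupI)
    fix f assume f: "f \<in> carrier (free_algebra S)"
    show "\<exists>g\<in>carrier (free_algebra S). g \<oplus>\<^bsub>free_algebra S\<^esub> f = \<zero>\<^bsub>free_algebra S\<^esub>"
      by (rule bexI[of _ "- f"]) (simp_all add: free_algebra_carrier_closed(3)[OF f] free_algebra_simps(4,5))
  qed (simp_all add: free_algebra_carrier_closed(1) free_algebra_simps(2-5) ac_simps,
      simp add: free_algebra_simps)
  have "1 \<in> carrier (free_algebra S)" using free_algebra_carrier_closed(5)[of 1] by (simp add: scalar_one)
  then show "Group.monoid (free_algebra S)"
    by (intro monoidI) (simp_all add: free_algebra_carrier_closed(2) free_algebra_simps(2-5) mult.assoc)
qed (simp_all add: free_algebra_simps(2-5) distrib_left distrib_right)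

text \<open>A presented algebra is a quotient ring extended by a scalar multiplication. The two
  records have different types, so the ring laws are carried over field by field.\<close>

lemma ring_extend_cong:
  assumes "carrier A = carrier B" "monoid.mult A = monoid.mult B" "one A = one B" "zero A = zero B" "add A = add B"
    and "ring A"
  shows "ring B"
proof (rule ringI)
  interpret A: ring A by fact
  note eqs = assms(1-5)[symmetric]
  show "abelian_group B"
  proof (rule abelian_groupI, unfold eqs)
    fix x assume "x \<in> carrier A"
    then show "\<exists>y\<in>carrier A. y \<oplus>\<^bsub>A\<^esub> x = \<zero>\<^bsub>A\<^esub>" using A.l_neg A.a_inv_closed by blast
  qed (simp_all add: A.a_ac)
  show "Group.monoid B"
    by (rule monoidI, unfold eqs) (simp_all add: A.m_assoc)
qed (unfold assms(1-5)[symmetric], use ring.ring_simprules(13,23)[OF assms(6)] in simp_all)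

locale presentation =
  fixes S :: "'g set" and rels :: "('g word \<Rightarrow>\<^sub>0 'k::field) set"
  assumes rels_carrier: "rels \<subseteq> carrier (free_algebra S)"
begin

abbreviation F where "F \<equiv> free_algebra S :: ('g word \<Rightarrow>\<^sub>0 'k) ring"
definition I where "I = genideal F rels"
abbreviation P where "P \<equiv> presented_algebra S rels"

sublocale F: ring F by (rule free_algebra_ring)

sublocale idl: ideal I F
  unfolding I_def by (rule F.genideal_ideal[OF rels_carrier])

lemma rels_I: "r \<in> rels \<Longrightarrow> r \<in> I"
  using F.genideal_self[OF rels_carrier] by (auto simp: I_def)

lemma I_closed:
  "\<lbrakk>a \<in> I; b \<in> I\<rbrakk> \<Longrightarrow> a + b \<in> I"
  "\<lbrakk>a \<in> I; f \<in> carrier F\<rbrakk> \<Longrightarrow> f * a \<in> I"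
  "\<lbrakk>a \<in> I; f \<in> carrier F\<rbrakk> \<Longrightarrow> a * f \<in> I"
  "0 \<in> I"
  using idl.I_l_closed idl.I_r_closed idl.a_closed idl.zero_closed
  by (simp_all add: free_algebra_simps(2-5))

lemma I_neg: "a \<in> I \<Longrightarrow> - a \<in> I"
  using I_closed(2)[OF _ free_algebra_carrier_closed(5)[of "- 1"], of a]
  by (simp add: scalar_def single_uminus)

definition proj where "proj f = I +>\<^bsub>F\<^esub> f"

lemma proj_hom: "proj \<in> ring_hom F (F Quot I)"
  using idl.rcos_ring_hom by (simp add: proj_def[abs_def])

lemma P_simps:
  "carrier P = carrier (F Quot I)" "monoid.mult P = monoid.mult (F Quot I)" "one P = one (F Quot I)"
  "zero P = zero (F Quot I)" "add P = add (F Quot I)"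
  "smult P = (\<lambda>c a. proj (scalar c) \<otimes>\<^bsub>F Quot I\<^esub> a)"
  by (simp_all add: presented_algebra_def Let_def ring.defs module.defs I_def proj_def)

lemma P_rep: "x \<in> carrier P \<Longrightarrow> \<exists>f\<in>carrier F. x = proj f"
  unfolding P_simps by (auto simp: FactRing_def A_RCOSETS_def' proj_def)

lemma proj_simps:
  assumes "f \<in> carrier F" "g \<in> carrier F"
  shows "proj f \<in> carrier P" "proj f \<otimes>\<^bsub>P\<^esub> proj g = proj (f * g)" "proj f \<oplus>\<^bsub>P\<^esub> proj g = proj (f + g)"
    "c \<odot>\<^bsub>P\<^esub> proj f = proj (scalar c * f)"
  using assms ring_hom_closed[OF proj_hom] ring_hom_mult[OF proj_hom] ring_hom_add[OF proj_hom]
    free_algebra_carrier_closed(5)[of c S]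
  by (simp_all add: P_simps free_algebra_simps(2-5))

lemma P_k_algebra: "k_algebra P"
proof -
  have "ring (F Quot I)" by (rule idl.quotient_is_ring)
  then have "ring P" by (rule ring_extend_cong[rotated 5]) (simp_all add: P_simps)
  then interpret ring P .
  note cl = free_algebra_carrier_closed[where S = S]
  show ?thesis
  proof
    fix x c d assume "x \<in> carrier P"
    then obtain f where f: "f \<in> carrier F" "x = proj f" using P_rep by blast
    show "c \<odot>\<^bsub>P\<^esub> x \<in> carrier P" using f by (simp add: proj_simps cl)
    show "(c + d) \<odot>\<^bsub>P\<^esub> x = c \<odot>\<^bsub>P\<^esub> x \<oplus>\<^bsub>P\<^esub> d \<odot>\<^bsub>P\<^esub> x"
      using f by (simp add: proj_simps cl scalar_add distrib_right)
    show "(c * d) \<odot>\<^bsub>P\<^esub> x = c \<odot>\<^bsub>P\<^esub> (d \<odot>\<^bsub>P\<^esub> x)"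
      using f by (simp add: proj_simps cl scalar_mult mult.assoc)
    show "1 \<odot>\<^bsub>P\<^esub> x = x" using f by (simp add: proj_simps scalar_one)
  next
    fix x y c assume h: "x \<in> carrier P" "y \<in> carrier P"
    obtain f where f: "f \<in> carrier F" "x = proj f" using P_rep[OF h(1)] by blast
    obtain g where g: "g \<in> carrier F" "y = proj g" using P_rep[OF h(2)] by blast
    show "c \<odot>\<^bsub>P\<^esub> (x \<oplus>\<^bsub>P\<^esub> y) = c \<odot>\<^bsub>P\<^esub> x \<oplus>\<^bsub>P\<^esub> c \<odot>\<^bsub>P\<^esub> y"
      using f g by (simp add: proj_simps cl distrib_left)
    show "(c \<odot>\<^bsub>P\<^esub> x) \<otimes>\<^bsub>P\<^esub> y = c \<odot>\<^bsub>P\<^esub> (x \<otimes>\<^bsub>P\<^esub> y)"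
      using f g by (simp add: proj_simps cl mult.assoc)
    show "x \<otimes>\<^bsub>P\<^esub> (c \<odot>\<^bsub>P\<^esub> y) = c \<odot>\<^bsub>P\<^esub> (x \<otimes>\<^bsub>P\<^esub> y)"
      using f g by (simp add: proj_simps cl scalar_left_commute[of f])
  qed
qed

subsection \<open>Straightening words\<close>

definition cong (infix \<open>\<approx>\<close> 50) where "f \<approx> g \<longleftrightarrow> f - g \<in> I"

lemma cong_refl: "f \<approx> f"
  by (simp add: cong_def I_closed)

lemma cong_trans [trans]: "f \<approx> g \<Longrightarrow> g \<approx> h \<Longrightarrow> f \<approx> h"
  using I_closed(1)[of "f - g" "g - h"] by (simp add: cong_def)

lemma cong_sym: "f \<approx> g \<Longrightarrow> g \<approx> f"
  using I_neg[of "f - g"] by (simp add: cong_def)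

lemma cong_lmult: "\<lbrakk>f \<approx> g; h \<in> carrier F\<rbrakk> \<Longrightarrow> h * f \<approx> h * g"
  using I_closed(2)[of "f - g" h] by (simp add: cong_def right_diff_distrib)

lemma cong_rmult: "\<lbrakk>f \<approx> g; h \<in> carrier F\<rbrakk> \<Longrightarrow> f * h \<approx> g * h"
  using I_closed(3)[of "f - g" h] by (simp add: cong_def left_diff_distrib)

lemma cong_mult: "\<lbrakk>f \<approx> f'; g \<approx> g'; f' \<in> carrier F; g \<in> carrier F\<rbrakk> \<Longrightarrow> f * g \<approx> f' * g'"
  using cong_trans[OF cong_rmult cong_lmult] by blast

lemma cong_add: "\<lbrakk>f \<approx> f'; g \<approx> g'\<rbrakk> \<Longrightarrow> f + g \<approx> f' + g'"
  using I_closed(1)[of "f - f'" "g - g'"] by (simp add: cong_def algebra_simps)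

definition span_mod where
  "span_mod Q = {f. \<exists>g. Poly_Mapping.keys g \<subseteq> Word ` Q \<and> f \<approx> g}"

lemma span_mod_word: "l \<in> Q \<Longrightarrow> monom_word l \<in> span_mod Q"
  unfolding span_mod_def by (intro CollectI exI[of _ "monom_word l"]) (simp add: monom_word_def cong_refl)

lemma span_mod_cong: "f \<approx> g \<Longrightarrow> g \<in> span_mod Q \<Longrightarrow> f \<in> span_mod Q"
  unfolding span_mod_def using cong_trans by blast

lemma span_mod_zero: "0 \<in> span_mod Q"
  unfolding span_mod_def by (intro CollectI exI[of _ 0]) (simp add: cong_refl)

lemma span_mod_add: "f \<in> span_mod Q \<Longrightarrow> g \<in> span_mod Q \<Longrightarrow> f + g \<in> span_mod Q"
proof -
  assume "f \<in> span_mod Q" "g \<in> span_mod Q"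
  then obtain f' g' where h: "Poly_Mapping.keys f' \<subseteq> Word ` Q" "f \<approx> f'" "Poly_Mapping.keys g' \<subseteq> Word ` Q" "g \<approx> g'"
    unfolding span_mod_def by blast
  then have "f + g \<approx> f' + g'" "Poly_Mapping.keys (f' + g') \<subseteq> Word ` Q"
    using cong_add keys_add[of f' g'] by blast+
  then show ?thesis unfolding span_mod_def by blast
qed

lemma span_mod_sum: "(\<And>i. i \<in> J \<Longrightarrow> f i \<in> span_mod Q) \<Longrightarrow> (\<Sum>i\<in>J. f i) \<in> span_mod Q"
  by (induction J rule: infinite_finite_induct) (simp_all add: span_mod_zero span_mod_add)

lemma span_mod_scalar: "f \<in> span_mod Q \<Longrightarrow> scalar c * f \<in> span_mod Q"
proof -
  assume "f \<in> span_mod Q"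
  then obtain g where g: "Poly_Mapping.keys g \<subseteq> Word ` Q" "f \<approx> g" unfolding span_mod_def by blast
  have "Poly_Mapping.keys (scalar c * g) \<subseteq> Word ` Q"
    using g(1) keys_mult[of "scalar c" g] by (auto simp: scalar_def split: if_splits)
  moreover have "scalar c * f \<approx> scalar c * g" by (intro cong_lmult g free_algebra_carrier_closed)
  ultimately show ?thesis unfolding span_mod_def by blast
qed

text \<open>The induction step of straightening: a letter is put in front of a word that is already
  straightened modulo the ideal, and only the normal words in \<open>Q\<close> have to be
  examined.\<close>

lemma span_mod_mult_trans:
  assumes f: "f \<in> span_mod Q" and Q: "\<And>l. l \<in> Q \<Longrightarrow> h * monom_word l \<in> span_mod Q'"
    and h: "h \<in> carrier F"
  shows "h * f \<in> span_mod Q'"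
proof -
  obtain g where g: "Poly_Mapping.keys g \<subseteq> Word ` Q" "f \<approx> g" using f unfolding span_mod_def by blast
  have "h * g \<in> span_mod Q'" using g(1)
  proof (induction g rule: poly_mapping_additive_induct)
    case (single w c)
    then obtain l where l: "l \<in> Q" "w = Word l" by blast
    have "h * Poly_Mapping.single w c = scalar c * (h * monom_word l)"
      by (simp add: l(2) single_eq_scalar_monom_word scalar_left_commute[of h])
    then show ?case using span_mod_scalar[OF Q[OF l(1)]] by simp
  qed (simp_all add: span_mod_zero distrib_left span_mod_add)
  then show ?thesis using span_mod_cong[OF cong_lmult[OF g(2) h]] by blast
qed

lemma span_mod_trans:
  assumes "f \<in> span_mod Q" and "\<And>l. l \<in> Q \<Longrightarrow> monom_word l \<in> span_mod Q'"
  shows "f \<in> span_mod Q'"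
  using span_mod_mult_trans[of f Q 1 Q'] assms free_algebra_carrier_closed(5)[of 1 S]
  by (simp add: scalar_one)

lemma carrier_in_span_mod:
  assumes "f \<in> carrier F" and "\<And>l. set l \<subseteq> S \<Longrightarrow> monom_word l \<in> span_mod Q"
  shows "f \<in> span_mod Q"
proof -
  have "Poly_Mapping.keys f \<subseteq> words_in S" using assms(1) by (simp add: free_algebra_simps)
  then show ?thesis
    by (induction f rule: poly_mapping_additive_induct)
      (simp_all add: span_mod_zero span_mod_add single_eq_scalar_monom_word span_mod_scalar assms(2) words_in_def)
qed

text \<open>Insertion sort by swaps of adjacent letters. Each swap of letters from \<open>G\<close>
  costs a scalar and produces no further terms, so the outcome is a multiple of one word.\<close>

lemma insort_word:
  assumes q: "\<And>a b. \<lbrakk>a \<in> G; b \<in> G\<rbrakk> \<Longrightarrow> \<exists>c. gen a * gen b \<approx> scalar c * (gen b * gen a)"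
    and G: "G \<subseteq> S" and "a \<in> G" "set l \<subseteq> G"
  shows "\<exists>c. monom_word (a # l) \<approx> scalar c * monom_word (insort_key key a l)"
  using assms(4)
proof (induction l)
  case Nil
  show ?case by (rule exI[of _ 1]) (simp add: scalar_one cong_refl)
next
  case (Cons b l)
  show ?case
  proof (cases "key a \<le> key b")
    case True
    then show ?thesis by (intro exI[of _ 1]) (simp add: scalar_one cong_refl)
  next
    case False
    note cl = free_algebra_carrier_closed[where S = S]
    have m: "a \<in> S" "b \<in> S" "set l \<subseteq> S" using G \<open>a \<in> G\<close> Cons.prems by auto
    obtain c where c: "gen a * gen b \<approx> scalar c * (gen b * gen a)" using q[of a b] \<open>a \<in> G\<close> Cons.prems by auto
    obtain d where d: "monom_word (a # l) \<approx> scalar d * monom_word (insort_key key a l)"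
      using Cons by auto
    have "gen a * gen b * monom_word l \<approx> scalar c * (gen b * gen a) * monom_word l"
      by (intro cong_rmult c cl m)
    also have "scalar c * (gen b * gen a) * monom_word l = scalar c * gen b * monom_word (a # l)"
      by (simp add: monom_word_Cons mult.assoc)
    also have "\<dots> \<approx> scalar c * gen b * (scalar d * monom_word (insort_key key a l))"
      by (intro cong_lmult d cl m)
    also have "\<dots> = scalar (c * d) * monom_word (b # insort_key key a l)"
      by (simp add: monom_word_Cons scalar_mult mult.assoc scalar_left_commute[of "gen b"])
    finally show ?thesis using False by (intro exI[of _ "c * d"]) (simp add: monom_word_Cons mult.assoc)
  qed
qed

lemma sort_word:
  assumes q: "\<And>a b. \<lbrakk>a \<in> G; b \<in> G\<rbrakk> \<Longrightarrow> \<exists>c. gen a * gen b \<approx> scalar c * (gen b * gen a)"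
    and G: "G \<subseteq> S" and "set l \<subseteq> G"
  shows "\<exists>c. monom_word l \<approx> scalar c * monom_word (sort_key key l)"
  using assms(3)
proof (induction l)
  case Nil
  show ?case by (rule exI[of _ 1]) (simp add: scalar_one cong_refl)
next
  case (Cons a l)
  note cl = free_algebra_carrier_closed[where S = S]
  have a: "a \<in> G" "set l \<subseteq> G" using Cons.prems by auto
  obtain c where c: "monom_word l \<approx> scalar c * monom_word (sort_key key l)" using Cons by auto
  obtain d where d: "monom_word (a # sort_key key l) \<approx> scalar d * monom_word (insort_key key a (sort_key key l))"
    using insort_word[OF q G a(1), of "sort_key key l"] a by auto
  have "gen a * monom_word l \<approx> gen a * (scalar c * monom_word (sort_key key l))"
    using a G by (intro cong_lmult c cl) auto
  also have "\<dots> = scalar c * monom_word (a # sort_key key l)"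
    by (simp add: monom_word_Cons scalar_left_commute[of "gen a"])
  also have "\<dots> \<approx> scalar c * (scalar d * monom_word (insort_key key a (sort_key key l)))"
    by (intro cong_lmult d cl)
  finally show ?case
    by (intro exI[of _ "c * d"]) (simp add: monom_word_Cons scalar_mult mult.assoc)
qed

end

subsection \<open>Evaluation in a twisted monoid algebra\<close>

text \<open>The map lives on the free algebra and the relations need not vanish yet. That they do is
  an assumption of \<open>faithful_evaluation\<close> only, so that it can be verified with the
  computation rules established here.\<close>

locale evaluation = twisted_monoid_algebra \<sigma> X + presentation S rels
  for \<sigma> :: "'e::linordered_ab_group_add \<Rightarrow> 'e \<Rightarrow> 'k::field" and X
    and S :: "'g set" and rels :: "('g word \<Rightarrow>\<^sub>0 'k) set" +
  fixes h :: "'g \<Rightarrow> ('e \<Rightarrow>\<^sub>0 'k)"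
  assumes h_closed: "g \<in> S \<Longrightarrow> h g \<in> carr"
begin

notation tmult (infixl \<open>\<star>\<close> 70)

definition eval_word :: "'g list \<Rightarrow> ('e \<Rightarrow>\<^sub>0 'k)" where
  "eval_word l = foldr (\<lambda>g f. h g \<star> f) l 1"

definition evalp :: "('g word \<Rightarrow>\<^sub>0 'k) \<Rightarrow> ('e \<Rightarrow>\<^sub>0 'k)" where
  "evalp f = (\<Sum>w\<in>Poly_Mapping.keys f. mono 0 (Poly_Mapping.lookup f w) \<star> eval_word (letters w))"

lemma one_carr: "1 \<in> carr"
  using X_zero by simp

lemma eval_word_Nil: "eval_word [] = 1"
  and eval_word_Cons: "eval_word (g # l) = h g \<star> eval_word l"
  by (simp_all add: eval_word_def)

lemma eval_word_closed: "set l \<subseteq> S \<Longrightarrow> eval_word l \<in> carr"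
proof (induction l)
  case Nil
  show ?case unfolding eval_word_Nil by (rule one_carr)
next
  case (Cons g l)
  then show ?case unfolding eval_word_Cons by (intro tmult_closed h_closed) auto
qed

lemma eval_word_append: "\<lbrakk>set l \<subseteq> S; set l' \<subseteq> S\<rbrakk> \<Longrightarrow> eval_word (l @ l') = eval_word l \<star> eval_word l'"
proof (induction l)
  case Nil
  then show ?case by (simp only: append_Nil eval_word_Nil tmult_one_left[OF eval_word_closed])
next
  case (Cons g l)
  have "h g \<star> (eval_word l \<star> eval_word l') = h g \<star> eval_word l \<star> eval_word l'"
    by (rule tmult_assoc[symmetric]) (use Cons.prems h_closed eval_word_closed in auto)
  then show ?case using Cons by (simp add: eval_word_Cons)
qed

lemma evalp_single: "evalp (Poly_Mapping.single w c) = mono 0 c \<star> eval_word (letters w)"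
  by (simp add: evalp_def)

lemma evalp_add: "evalp (f + g) = evalp f + evalp g"
proof -
  let ?A = "Poly_Mapping.keys f \<union> Poly_Mapping.keys g"
  have e: "evalp f' = (\<Sum>w\<in>?A. mono 0 (Poly_Mapping.lookup f' w) \<star> eval_word (letters w))"
    if "Poly_Mapping.keys f' \<subseteq> ?A" for f'
    unfolding evalp_def using that by (intro sum.mono_neutral_left) (auto simp: in_keys_iff)
  show ?thesis
    using e[of "f + g"] e[of f] e[of g] keys_add[of f g]
    by (simp add: lookup_add single_add tmult_add_left sum.distrib)
qed

lemma evalp_zero: "evalp 0 = 0"
  by (simp add: evalp_def)

lemma evalp_diff: "evalp (f - g) = evalp f - evalp g"
  using evalp_add[of "f - g" g] by simp

lemma evalp_sum: "evalp (\<Sum>i\<in>J. f i) = (\<Sum>i\<in>J. evalp (f i))"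
  by (induction J rule: infinite_finite_induct) (simp_all add: evalp_zero evalp_add)

lemma carrier_induct [consumes 1, case_names zero single add]:
  assumes "f \<in> carrier F" "Q 0" "\<And>w c. set (letters w) \<subseteq> S \<Longrightarrow> Q (Poly_Mapping.single w c)"
    "\<And>f g. Q f \<Longrightarrow> Q g \<Longrightarrow> Q (f + g)"
  shows "Q f"
  using poly_mapping_additive_induct[of f "words_in S" Q] assms
  by (simp add: free_algebra_simps words_in_def)

lemma evalp_closed: "f \<in> carrier F \<Longrightarrow> evalp f \<in> carr"
proof (induction f rule: carrier_induct)
  case zero
  show ?case by (simp add: evalp_zero)
next
  case (single w c)
  then show ?case unfolding evalp_single by (intro tmult_closed scalar_in_carr eval_word_closed)
next
  case (add f g)
  then show ?case unfolding evalp_add by (intro add_in_carr)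
qed

lemma evalp_mult: "\<lbrakk>f \<in> carrier F; g \<in> carrier F\<rbrakk> \<Longrightarrow> evalp (f * g) = evalp f \<star> evalp g"
proof (induction f rule: carrier_induct)
  case (single v c)
  note v = single(1)
  show ?case using \<open>g \<in> carrier F\<close>
  proof (induction g rule: carrier_induct)
    case (single w d)
    note w = single
    note ev = eval_word_closed[OF v] eval_word_closed[OF w]
    have "mono 0 c \<star> eval_word (letters v) \<star> (mono 0 d \<star> eval_word (letters w))
        = mono 0 c \<star> (eval_word (letters v) \<star> mono 0 d \<star> eval_word (letters w))"
      by (simp only: tmult_assoc ev scalar_in_carr tmult_closed)
    also have "\<dots> = mono 0 c \<star> (mono 0 d \<star> eval_word (letters v) \<star> eval_word (letters w))"
      by (simp only: tmult_scalar_comm[OF ev(1)])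
    also have "\<dots> = mono 0 c \<star> mono 0 d \<star> (eval_word (letters v) \<star> eval_word (letters w))"
      by (simp only: tmult_assoc ev scalar_in_carr tmult_closed)
    also have "\<dots> = mono 0 (c * d) \<star> eval_word (letters v @ letters w)"
      by (simp only: eval_word_append[OF v w] scalar_mono[OF X_zero])
    finally show ?case by (simp add: mult_single evalp_single plus_word_def)
  qed (simp_all add: evalp_zero evalp_add distrib_left tmult_add_right)
qed (simp_all add: evalp_zero evalp_add distrib_right tmult_add_left)

lemma evalp_gen: "g \<in> S \<Longrightarrow> evalp (gen g) = h g"
  using tmult_one_left[of "h g"] tmult_one_right[of "h g"] h_closed
  by (simp add: gen_def evalp_single eval_word_Cons eval_word_Nil)

lemma evalp_scalar: "evalp (scalar c) = mono 0 c"
  using tmult_one_right[OF scalar_in_carr]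
  by (simp add: scalar_def evalp_single zero_word_def eval_word_Nil)

lemma evalp_hom: "evalp \<in> ring_hom F tw_alg"
proof (rule ring_hom_memI)
  show "evalp \<one>\<^bsub>F\<^esub> = \<one>\<^bsub>tw_alg\<^esub>"
    using evalp_scalar[of 1] by (simp add: scalar_one tw_alg_simps free_algebra_simps(3))
qed (simp_all add: evalp_closed evalp_mult evalp_add tw_alg_simps(2-5) free_algebra_simps(2-5),
    use evalp_closed in \<open>simp add: tw_alg_simps\<close>)

sublocale ev: ring_hom_ring F tw_alg evalp
  by (rule ring_hom_ringI2[OF F.ring_axioms T.ring_axioms evalp_hom])

end

text \<open>Three facts together make the sorted words a basis of the presented algebra and the map
  injective: the relations hold in the target, sorted words span modulo the relations, and the
  trailing exponent of a word determines its letters with multiplicity. Injectivity of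
  \<open>key\<close> lets a sorted word be recovered from its multiset of letters.\<close>

locale faithful_evaluation = evaluation \<sigma> X S rels h
  for \<sigma> :: "'e::linordered_ab_group_add \<Rightarrow> 'e \<Rightarrow> 'k::field" and X
    and S :: "'g set" and rels :: "('g word \<Rightarrow>\<^sub>0 'k) set" and h +
  fixes key :: "'g \<Rightarrow> nat" and expo :: "'g \<Rightarrow> 'e"
  assumes rels_zero: "r \<in> rels \<Longrightarrow> evalp r = 0"
    and key_inj: "inj_on key S"
    and trailing_h: "g \<in> S \<Longrightarrow> trailing (h g) (expo g)"
    and expo_mset: "\<lbrakk>set l \<subseteq> S; set l' \<subseteq> S; sum_list (map expo l) = sum_list (map expo l')\<rbrakk> \<Longrightarrow> mset l = mset l'"
    and straighten: "set l \<subseteq> S \<Longrightarrow> monom_word l \<in> span_mod {l. set l \<subseteq> S \<and> sorted (map key l)}"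
begin

lemma trailing_eval_word: "set l \<subseteq> S \<Longrightarrow> trailing (eval_word l) (sum_list (map expo l))"
proof (induction l)
  case Nil
  then show ?case using trailing_mono[of 1 0] by (simp add: eval_word_Nil)
next
  case (Cons g l)
  then have "trailing (eval_word l) (sum_list (map expo l))" "g \<in> S" "set l \<subseteq> S" by simp_all
  then show ?case unfolding eval_word_Cons list.map sum_list.Cons
    by (intro trailing_mult trailing_h h_closed eval_word_closed)
qed

lemma sorted_eq:
  assumes "set l \<subseteq> S" "sorted (map key l)" "sorted (map key l')" "mset l = mset l'"
  shows "l = l'"
proof -
  have "inj_on key (set l)" using key_inj assms(1) by (rule inj_on_subset)
  then have "sort_key key l = l'" "sort_key key l = l"
    using sort_key_inj_key_eq[OF assms(4) _ assms(3)] sort_key_inj_key_eq[OF refl _ assms(2)] by simp_all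
  then show ?thesis by simp
qed

text \<open>Among the sorted words in g take one with the least trailing exponent. Other sorted
  words have other, hence strictly larger, trailing exponents, so none of them contributes at this
  exponent.\<close>

lemma evalp_std_nonzero:
  assumes g: "Poly_Mapping.keys g \<subseteq> Word ` {l. set l \<subseteq> S \<and> sorted (map key l)}" and "g \<noteq> 0"
  shows "evalp g \<noteq> 0"
proof -
  let ?K = "Poly_Mapping.keys g" and ?e = "\<lambda>w. sum_list (map expo (letters w))"
  have std: "set (letters w) \<subseteq> S" "sorted (map key (letters w))" if "w \<in> ?K" for w
  proof -
    obtain l where "w = Word l" "set l \<subseteq> S" "sorted (map key l)" using g \<open>w \<in> ?K\<close> by blast
    then show "set (letters w) \<subseteq> S" "sorted (map key (letters w))" by simp_all
  qed
  have "?K \<noteq> {}" using \<open>g \<noteq> 0\<close> by simp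
  then have "Min (?e ` ?K) \<in> ?e ` ?K" by (intro Min_in) simp_all
  then obtain w where w: "w \<in> ?K" "?e w = Min (?e ` ?K)" by auto
  have less: "?e w < ?e v" if v: "v \<in> ?K" "v \<noteq> w" for v
  proof -
    have "?e w \<le> ?e v" unfolding w(2) using v by (intro Min_le) simp_all
    moreover have "?e w \<noteq> ?e v"
    proof
      assume "?e w = ?e v"
      then have "mset (letters w) = mset (letters v)" by (rule expo_mset[OF std(1)[OF w(1)] std(1)[OF v(1)]])
      then have "letters w = letters v"
        by (rule sorted_eq[OF std(1)[OF w(1)] std(2)[OF w(1)] std(2)[OF v(1)]])
      then show False using v(2) word.expand[of w v] by blast
    qed
    ultimately show ?thesis by simp
  qed
  have "Poly_Mapping.lookup (evalp g) (?e w) =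
      (\<Sum>v\<in>?K. Poly_Mapping.lookup g v * Poly_Mapping.lookup (eval_word (letters v)) (?e w))"
    unfolding evalp_def lookup_sum by (intro sum.cong refl lookup_scalar eval_word_closed std)
  also have "\<dots> = (\<Sum>v\<in>?K. if v = w then Poly_Mapping.lookup g w * Poly_Mapping.lookup (eval_word (letters w)) (?e w) else 0)"
  proof (intro sum.cong refl)
    fix v assume v: "v \<in> ?K"
    have "Poly_Mapping.lookup (eval_word (letters v)) (?e w) = 0" if "v \<noteq> w"
    proof (rule ccontr)
      assume "Poly_Mapping.lookup (eval_word (letters v)) (?e w) \<noteq> 0"
      then have "?e v \<le> ?e w"
        using trailing_eval_word[OF std(1)[OF v]] by (simp add: trailing_def in_keys_iff)
      then show False using less[OF v that] by simp
    qed
    then show "Poly_Mapping.lookup g v * Poly_Mapping.lookup (eval_word (letters v)) (?e w) =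
      (if v = w then Poly_Mapping.lookup g w * Poly_Mapping.lookup (eval_word (letters w)) (?e w) else 0)"
      by simp
  qed
  also have "\<dots> = Poly_Mapping.lookup g w * Poly_Mapping.lookup (eval_word (letters w)) (?e w)"
    using w by (simp add: sum.delta)
  also have "\<dots> \<noteq> 0"
    using w trailing_eval_word[OF std(1)[OF w(1)]] by (simp add: trailing_def in_keys_iff)
  finally show ?thesis by auto
qed

text \<open>A kernel element differs from its straightened form by an element of the ideal. The
  straightened form therefore evaluates to zero as well, and being a combination of sorted words it
  is zero.\<close>

lemma kernel_evalp: "a_kernel F tw_alg evalp = I"
proof
  have ker: "f \<in> a_kernel F tw_alg evalp \<longleftrightarrow> f \<in> carrier F \<and> evalp f = 0" for f
    unfolding a_kernel_def' tw_alg_simps(4) by simp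
  have "rels \<subseteq> a_kernel F tw_alg evalp"
    using rels_zero rels_carrier unfolding subset_iff ker by blast
  then have sub: "I \<subseteq> a_kernel F tw_alg evalp"
    unfolding I_def by (rule F.genideal_minimal[OF ev.kernel_is_ideal])
  then show "I \<subseteq> a_kernel F tw_alg evalp" .
  show "a_kernel F tw_alg evalp \<subseteq> I"
  proof
    fix f assume "f \<in> a_kernel F tw_alg evalp"
    then have f: "f \<in> carrier F" "evalp f = 0" unfolding ker by simp_all
    have "f \<in> span_mod {l. set l \<subseteq> S \<and> sorted (map key l)}"
      by (rule carrier_in_span_mod[OF f(1) straighten])
    then obtain g where g: "Poly_Mapping.keys g \<subseteq> Word ` {l. set l \<subseteq> S \<and> sorted (map key l)}" "f - g \<in> I"
      unfolding span_mod_def cong_def by blast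
    have "evalp (f - g) = 0" using subsetD[OF sub g(2)] unfolding ker by simp
    then have "evalp g = 0" using f(2) by (simp add: evalp_diff)
    then have "g = 0" using evalp_std_nonzero[OF g(1)] by blast
    then show "f \<in> I" using g(2) by simp
  qed
qed

text \<open>An element of the presented algebra is a coset, and \<open>evalp\<close> is constant on
  it because the ideal is its kernel; the image of the coset is a singleton.\<close>

definition embedding where "embedding x = the_elem (evalp ` x)"

lemma embedding_proj: "f \<in> carrier F \<Longrightarrow> embedding (proj f) = evalp f"
  unfolding embedding_def proj_def kernel_evalp[symmetric] by (rule ev.the_elem_simp)

lemma embedding_image: "embedding ` carrier P = evalp ` carrier F"
proof -
  have "carrier P = proj ` carrier F" using P_rep proj_simps(1) by blast
  then have "embedding ` carrier P = (\<lambda>f. embedding (proj f)) ` carrier F" by (simp only: image_image)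
  also have "\<dots> = evalp ` carrier F" by (intro image_cong refl embedding_proj)
  finally show ?thesis .
qed

lemma embedding_hom: "embedding \<in> ring_hom P tw_alg"
proof -
  have "embedding = (\<lambda>x. the_elem (evalp ` x))" by (rule ext) (simp add: embedding_def)
  then have "embedding \<in> ring_hom (F Quot I) tw_alg" using ev.the_elem_hom[unfolded kernel_evalp] by simp
  then show ?thesis unfolding ring_hom_def P_simps .
qed

lemma embedding_inj: "inj_on embedding (carrier P)"
proof (rule inj_onI)
  fix x y assume "x \<in> carrier P" "y \<in> carrier P" "embedding x = embedding y"
  then show "x = y"
    unfolding embedding_def P_simps by (intro ev.the_elem_inj[unfolded kernel_evalp])
qed

lemma embedding_linear: "k_linear P tw_alg embedding"
  unfolding k_linear_def
proof (intro allI ballI)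
  fix c x assume "x \<in> carrier P"
  then obtain f where f: "f \<in> carrier F" "x = proj f" using P_rep by blast
  have "c \<odot>\<^bsub>P\<^esub> x = proj (scalar c * f)" using f proj_simps(4) by simp
  then show "embedding (c \<odot>\<^bsub>P\<^esub> x) = c \<odot>\<^bsub>tw_alg\<^esub> embedding x"
    using f free_algebra_carrier_closed(5)[of c S]
      free_algebra_carrier_closed(2)[OF free_algebra_carrier_closed(5)[of c S] f(1)]
    by (simp add: embedding_proj evalp_mult evalp_scalar tw_alg_simps(6))
qed

theorem embedding_dense:
  assumes cone: "\<And>e. e \<in> C \<Longrightarrow> mono e 1 \<in> evalp ` carrier F"
    and "\<And>K. \<lbrakk>finite K; K \<subseteq> X\<rbrakk> \<Longrightarrow> \<exists>e\<in>C. \<forall>k\<in>K. k + e \<in> C"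
    and "C \<subseteq> X"
  shows "dense_embedding P tw_alg embedding"
  by (rule dense_embedding_twistedI[OF twisted_monoid_algebra_axioms P_k_algebra embedding_hom
        embedding_linear embedding_inj _ assms(2,3)])
    (unfold embedding_image, rule cone)

end

section \<open>Monomials in the image of an evaluation\<close>

context evaluation
begin

lemma evalp_q_relation:
  assumes "a \<in> S" "b \<in> S" "h a \<star> h b = mono 0 c \<star> (h b \<star> h a)"
  shows "evalp (gen a * gen b - scalar c * gen b * gen a) = 0"
proof -
  note cl = free_algebra_carrier_closed[where S = S]
  have "mono 0 c \<star> h b \<star> h a = mono 0 c \<star> (h b \<star> h a)"
    by (rule tmult_assoc[OF scalar_in_carr h_closed h_closed]) (use assms in auto)
  then show ?thesis
    using assms by (simp add: evalp_diff evalp_mult cl evalp_gen evalp_scalar)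
qed

text \<open>A submonoid of \<open>X\<close>: the product of two monomials is a monomial up to a
  nonzero scalar, which can be divided out inside the image.\<close>

definition represented where
  "represented = {m \<in> X. mono m 1 \<in> evalp ` carrier F}"

lemma represented_scalar: 
  assumes "mono m c \<in> evalp ` carrier F" "c \<noteq> 0" "m \<in> X"
  shows "m \<in> represented"
proof -
  obtain f where f: "f \<in> carrier F" "mono m c = evalp f" using assms(1) by blast
  have "evalp (scalar (inverse c) * f) = mono m 1"
    using f assms(2,3) by (simp add: evalp_mult free_algebra_carrier_closed(5) evalp_scalar scalar_mono flip: f(2))
  moreover have "scalar (inverse c) * f \<in> carrier F"
    using f(1) by (intro free_algebra_carrier_closed)
  ultimately have "mono m 1 \<in> evalp ` carrier F" by (metis imageI)
  then show ?thesis using assms(3) by (simp add: represented_def)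
qed

lemma represented_zero: "0 \<in> represented"
  using evalp_scalar[of 1] free_algebra_carrier_closed(5)[of 1 S] X_zero
  unfolding represented_def by (auto simp: image_iff intro!: bexI[of _ "scalar 1"])

lemma represented_add:
  assumes "m \<in> represented" "m' \<in> represented"
  shows "m + m' \<in> represented"
proof -
  obtain f where f: "f \<in> carrier F" "mono m 1 = evalp f" using assms(1) unfolding represented_def by blast
  obtain g where g: "g \<in> carrier F" "mono m' 1 = evalp g" using assms(2) unfolding represented_def by blast
  have X: "m \<in> X" "m' \<in> X" using assms by (simp_all add: represented_def)
  have "evalp (f * g) = mono (m + m') (\<sigma> m m')"
    using evalp_mult[OF f(1) g(1)] unfolding f(2)[symmetric] g(2)[symmetric] tmult_mono by simp
  then have "mono (m + m') (\<sigma> m m') \<in> evalp ` carrier F"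
    using free_algebra_carrier_closed(2)[OF f(1) g(1)] by (metis imageI)
  then show ?thesis by (rule represented_scalar[OF _ \<sigma>_nonzero[OF X] X_add[OF X]])
qed

lemma represented_sum: "(\<And>i. i \<in> J \<Longrightarrow> m i \<in> represented) \<Longrightarrow> (\<Sum>i\<in>J. m i) \<in> represented"
  by (induction J rule: infinite_finite_induct) (simp_all add: represented_zero represented_add)

end

section \<open>Quantum affine space inside its torus\<close>

context quantum_torus
begin

lemma lookup_unit_exp: "Poly_Mapping.lookup (unit_exp i) k = (if k = i then 1 else 0)"
  by (simp add: unit_exp_def lookup_single when_def)

text \<open>The coordinate at \<open>pos g\<close> of such a sum counts the occurrences of the
  letter g.\<close>

lemma unit_exp_sum_mset:
  assumes pos: "inj_on pos S" and l: "set l \<subseteq> S" "set l' \<subseteq> S"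
    and eq: "sum_list (map (\<lambda>g. unit_exp (pos g)) l) = sum_list (map (\<lambda>g. unit_exp (pos g)) l')"
  shows "mset l = mset l'"
proof (rule multiset_eqI)
  fix g
  have c: "Poly_Mapping.lookup (sum_list (map (\<lambda>g. unit_exp (pos g)) l)) (pos g) = int (count (mset l) g)"
    if "set l \<subseteq> S" "g \<in> S" for l
    using that(1)
  proof (induction l)
    case (Cons x l)
    have "pos g = pos x \<longleftrightarrow> g = x" using inj_on_eq_iff[OF pos that(2), of x] Cons.prems by auto
    then show ?case using Cons by (auto simp: lookup_add lookup_unit_exp)
  qed simp
  show "count (mset l) g = count (mset l') g"
  proof (cases "g \<in> S")
    case True
    then show ?thesis using c[OF l(1)] c[OF l(2)] eq by simp
  next
    case False
    then have "g \<notin> set l" "g \<notin> set l'" using l by auto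
    then show ?thesis by (metis count_mset_0_iff)
  qed
qed

definition space_rels :: "(nat word \<Rightarrow>\<^sub>0 'k) set" where
  "space_rels = {gen i * gen j - scalar (L i j) * gen j * gen i | i j. i \<in> {1..N} \<and> j \<in> {1..N}}"

lemma quantum_space_eq: "quantum_space N L = presented_algebra {1..N} space_rels"
  by (simp add: quantum_space_def space_rels_def)

sublocale space: presentation "{1..N}" space_rels
  by unfold_locales (auto simp: space_rels_def intro!: free_algebra_carrier_closed)

sublocale space: evaluation cocycle "torus_exponents N" "{1..N}" space_rels "\<lambda>i. mono (unit_exp i) 1"
  by unfold_locales (use unit_exp_in in simp)

text \<open>Any two letters commute up to a scalar, so sorting alone straightens every word, and
  each generator is sent to a monomial.\<close>

lemma space_faithful:
  "faithful_evaluation cocycle (torus_exponents N) {1..N} space_rels (\<lambda>i. mono (unit_exp i) 1) id unit_exp"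
proof
  fix r assume "r \<in> space_rels"
  then obtain i j where ij: "i \<in> {1..N}" "j \<in> {1..N}"
    "r = gen i * gen j - scalar (L i j) * gen j * gen i" unfolding space_rels_def by blast
  show "space.evalp r = 0"
    unfolding ij(3)
  proof (rule space.evalp_q_relation[OF ij(1,2)], rule comm_factor_commute)
    show "mono (unit_exp i) 1 \<in> carr" "mono (unit_exp j) 1 \<in> carr" using unit_exp_in ij by simp_all
  qed (use comm_factor_unit[OF ij(1,2)] in simp)
next
  fix l l' assume "set l \<subseteq> {1..N}" "set l' \<subseteq> {1..N}" "sum_list (map unit_exp l) = sum_list (map unit_exp l')"
  then show "mset l = mset l'" using unit_exp_sum_mset[of id "{1..N}" l l'] by simp
next
  fix l :: "nat list" assume l: "set l \<subseteq> {1..N}"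
  have q: "\<exists>c. space.cong (gen a * gen b) (scalar c * (gen b * gen a))" if "a \<in> {1..N}" "b \<in> {1..N}" for a b
  proof
    have "gen a * gen b - scalar (L a b) * gen b * gen a \<in> space_rels"
      using that unfolding space_rels_def by blast
    then show "space.cong (gen a * gen b) (scalar (L a b) * (gen b * gen a))"
      unfolding space.cong_def mult.assoc[symmetric] by (rule space.rels_I)
  qed
  obtain c where "space.cong (monom_word l) (scalar c * monom_word (sort_key id l))"
    using space.sort_word[OF q subset_refl l] by blast
  moreover have "monom_word (sort_key id l) \<in> space.span_mod {l. set l \<subseteq> {1..N} \<and> sorted (map id l)}"
    by (intro space.span_mod_word CollectI conjI sorted_sort_key) (use l in simp)
  ultimately show "monom_word l \<in> space.span_mod {l. set l \<subseteq> {1..N} \<and> sorted (map id l)}"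
    using space.span_mod_cong space.span_mod_scalar by blast
qed (auto intro: trailing_mono)

end

section \<open>The algebra K\<close>

locale K_setup =
  fixes n :: nat and p q :: "nat \<Rightarrow> 'k::field" and \<gamma> :: "nat \<Rightarrow> nat \<Rightarrow> 'k"
  assumes p_nonzero: "i \<in> {1..n} \<Longrightarrow> p i \<noteq> 0"
    and q_nonzero: "i \<in> {1..n} \<Longrightarrow> q i \<noteq> 0"
    and p_neq_q: "i \<in> {1..n} \<Longrightarrow> p i \<noteq> q i"
    and \<gamma>_antisym: "mult_antisymmetric n \<gamma>"
begin

abbreviation \<Lambda> where "\<Lambda> \<equiv> Lambda_matrix p q \<gamma>"

lemma \<Lambda>_entries:
  assumes "i \<ge> 1" "j \<ge> 1"
  shows "\<Lambda> (2 * i - 1) (2 * j - 1) = B_block p q \<gamma> i j 1 1"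
    "\<Lambda> (2 * i - 1) (2 * j) = B_block p q \<gamma> i j 1 2"
    "\<Lambda> (2 * i) (2 * j - 1) = B_block p q \<gamma> i j 2 1"
    "\<Lambda> (2 * i) (2 * j) = B_block p q \<gamma> i j 2 2"
proof -
  have r: "(2 * k - 1 + 1) div 2 = k" "2 * k - 1 - 2 * (k - 1) = 1"
    "(2 * k + 1) div 2 = k" "2 * k - 2 * (k - 1) = 2" if "k \<ge> 1" for k :: nat
    using that by auto
  show "\<Lambda> (2 * i - 1) (2 * j - 1) = B_block p q \<gamma> i j 1 1"
    "\<Lambda> (2 * i - 1) (2 * j) = B_block p q \<gamma> i j 1 2"
    "\<Lambda> (2 * i) (2 * j - 1) = B_block p q \<gamma> i j 2 1"
    "\<Lambda> (2 * i) (2 * j) = B_block p q \<gamma> i j 2 2"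
    unfolding Lambda_matrix_def Let_def r[OF assms(1)] r[OF assms(2)] by (rule refl)+
qed

lemma index_cases:
  assumes "r \<in> {1..2 * n}"
  obtains i where "i \<in> {1..n}" "r = 2 * i - 1" | i where "i \<in> {1..n}" "r = 2 * i"
proof (cases "even r")
  case True
  then obtain i where "r = 2 * i" by (elim evenE)
  then show ?thesis using that(2)[of i] assms by auto
next
  case False
  then obtain i where "r = 2 * i + 1" by (elim oddE)
  then show ?thesis using that(1)[of "i + 1"] assms by auto
qed

lemma \<gamma>_rules:
  assumes "i \<in> {1..n}" "j \<in> {1..n}"
  shows "\<gamma> i j \<noteq> 0" "\<gamma> i i = 1" "\<gamma> i j * \<gamma> j i = 1"
  using mult_antisymmetricD[OF \<gamma>_antisym assms] by simp_all

lemma \<gamma>_inverse: "i \<in> {1..n} \<Longrightarrow> j \<in> {1..n} \<Longrightarrow> inverse (\<gamma> i j) = \<gamma> j i"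
  using \<gamma>_rules(3) inverse_unique by blast

lemma B_block_antisym:
  assumes ij: "i \<in> {1..n}" "j \<in> {1..n}" and ab: "a \<in> {1, 2}" "b \<in> {1, 2}"
  shows "B_block p q \<gamma> i j a b \<noteq> 0" "B_block p q \<gamma> j i b a = inverse (B_block p q \<gamma> i j a b)"
    "B_block p q \<gamma> i i a a = 1"
proof -
  note nz = p_nonzero[OF ij(1)] p_nonzero[OF ij(2)] q_nonzero[OF ij(1)] q_nonzero[OF ij(2)]
    \<gamma>_rules(1)[OF ij] \<gamma>_rules(1)[OF ij(2,1)]
  note inv = \<gamma>_inverse[OF ij] \<gamma>_inverse[OF ij(2,1)]
  show "B_block p q \<gamma> i j a b \<noteq> 0"
    using ab nz by (auto simp: B_block_def mat22_def)
  show "B_block p q \<gamma> j i b a = inverse (B_block p q \<gamma> i j a b)"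
    using ab nz by (cases i j rule: linorder_cases) (auto simp: B_block_def mat22_def inverse_mult_distrib inv)
  show "B_block p q \<gamma> i i a a = 1" using ab by (auto simp: B_block_def mat22_def)
qed

lemma \<Lambda>_antisym: "mult_antisymmetric (2 * n) \<Lambda>"
proof -
  \<comment> \<open>Writing r = 2i - 2 + a with a in {1, 2} treats odd and even rows alike, so that
    antisymmetry can be checked block by block.\<close>
  have rep: "\<exists>i\<in>{1..n}. \<exists>a\<in>{1, 2 :: nat}. r = 2 * i - 2 + a" if r: "r \<in> {1..2 * n}" for r
    using r
  proof (cases rule: index_cases)
    case (1 i)
    then have "r = 2 * i - 2 + 1" by auto
    then show ?thesis using 1(1) by blast
  next
    case (2 i)
    then have "r = 2 * i - 2 + 2" by auto
    then show ?thesis using 2(1) by blast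
  qed
  have entry: "\<Lambda> (2 * i - 2 + a) (2 * j - 2 + b) = B_block p q \<gamma> i j a b"
    if "i \<in> {1..n}" "j \<in> {1..n}" "a \<in> {1, 2}" "b \<in> {1, 2}" for i j a b
  proof -
    have "i \<ge> 1" "j \<ge> 1" "2 * i - 2 + 1 = 2 * i - 1" "2 * i - 2 + 2 = 2 * i" "2 * j - 2 + 1 = 2 * j - 1" "2 * j - 2 + 2 = 2 * j"
      using that by auto
    then show ?thesis using that(3,4) \<Lambda>_entries[of i j] by (elim insertE) (simp_all only: empty_iff)
  qed
  have "\<Lambda> r s \<noteq> 0 \<and> \<Lambda> s r = inverse (\<Lambda> r s)" if rs: "r \<in> {1..2 * n}" "s \<in> {1..2 * n}" for r s
  proof -
    obtain i a where i: "i \<in> {1..n}" "a \<in> {1, 2}" "r = 2 * i - 2 + a" using rep[OF rs(1)] by blast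
    obtain j b where j: "j \<in> {1..n}" "b \<in> {1, 2}" "s = 2 * j - 2 + b" using rep[OF rs(2)] by blast
    show ?thesis
      unfolding i(3) j(3) entry[OF i(1) j(1) i(2) j(2)] entry[OF j(1) i(1) j(2) i(2)]
      using B_block_antisym(1,2)[OF i(1) j(1) i(2) j(2)] by (intro conjI)
  qed
  moreover have "\<Lambda> r r = 1" if r: "r \<in> {1..2 * n}" for r
  proof -
    obtain i a where i: "i \<in> {1..n}" "a \<in> {1, 2}" "r = 2 * i - 2 + a" using rep[OF r] by blast
    show ?thesis unfolding i(3) entry[OF i(1,1,2,2)] by (rule B_block_antisym(3)[OF i(1,1,2,2)])
  qed
  ultimately show ?thesis unfolding mult_antisymmetric_def by blast
qed

end

sublocale K_setup \<subseteq> quantum_torus "2 * n" "Lambda_matrix p q \<gamma>"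
  by unfold_locales (rule \<Lambda>_antisym)

context K_setup
begin

notation tmult (infixl \<open>\<star>\<close> 70)

abbreviation X where "X \<equiv> torus_exponents (2 * n)"
text \<open>The exponents of y_i, of z_{2i} = y_i^-1 omega_i, of omega_i, and of y_i^-1 omega_{i-1},
  in this order.\<close>

definition ey where "ey i = unit_exp (2 * i - 1)"
definition ex where "ex i = unit_exp (2 * i)"
definition w where "w i = ey i + ex i"
definition v where "v i = w (i - 1) - ey i"
text \<open>The factor in omega_l y_j = c y_j omega_l. The entries of \<open>\<gamma>\<close>
  contributed by y_l and by z_{2l} cancel, so that only the position of j relative to l
  matters.\<close>

definition c where "c l j = (if j \<le> l then q j else p j)"

lemma X_diff: "a \<in> X \<Longrightarrow> b \<in> X \<Longrightarrow> a - b \<in> X"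
  using keys_diff[of a b] unfolding torus_exponents_def by blast

lemma exps_in:
  assumes "i \<in> {1..n}"
  shows "ey i \<in> X" "ex i \<in> X" "w i \<in> X" "i > 1 \<Longrightarrow> v i \<in> X"
proof -
  have e: "ey j \<in> X" "ex j \<in> X" if "j \<in> {1..n}" for j
    unfolding ey_def ex_def using that by (auto intro!: unit_exp_in)
  then show "ey i \<in> X" "ex i \<in> X" using assms by simp_all
  have W: "w j \<in> X" if "j \<in> {1..n}" for j unfolding w_def by (intro X_add e that)
  then show "w i \<in> X" using assms by simp
  show "i > 1 \<Longrightarrow> v i \<in> X" unfolding v_def using assms by (intro X_diff W e) auto
qed

section \<open>Commutation factors of the exponents\<close>

lemma comm_factor_units:
  assumes "i \<in> {1..n}" "j \<in> {1..n}"
  shows "comm_factor (ey i) (ey j) = B_block p q \<gamma> i j 1 1"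
    "comm_factor (ey i) (ex j) = B_block p q \<gamma> i j 1 2"
    "comm_factor (ex i) (ey j) = B_block p q \<gamma> i j 2 1"
    "comm_factor (ex i) (ex j) = B_block p q \<gamma> i j 2 2"
proof -
  have m: "2 * i - 1 \<in> {1..2 * n}" "2 * i \<in> {1..2 * n}" "2 * j - 1 \<in> {1..2 * n}" "2 * j \<in> {1..2 * n}"
    and ge: "i \<ge> 1" "j \<ge> 1" using assms by auto
  show "comm_factor (ey i) (ey j) = B_block p q \<gamma> i j 1 1"
    "comm_factor (ey i) (ex j) = B_block p q \<gamma> i j 1 2"
    "comm_factor (ex i) (ey j) = B_block p q \<gamma> i j 2 1"
    "comm_factor (ex i) (ex j) = B_block p q \<gamma> i j 2 2"
    unfolding ey_def ex_def
    by (subst comm_factor_unit; (intro m)?; rule \<Lambda>_entries[OF ge])+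
qed

lemma comm_factor_ey: "i \<in> {1..n} \<Longrightarrow> j \<in> {1..n} \<Longrightarrow> comm_factor (ey i) (ey j) = \<gamma> i j"
  using \<gamma>_rules(2)[of i j] by (auto simp: comm_factor_units B_block_def mat22_def)

lemma comm_factor_w_ey:
  assumes "l \<in> {1..n}" "j \<in> {1..n}"
  shows "comm_factor (w l) (ey j) = c l j"
  using \<gamma>_rules(3)[OF assms] \<gamma>_rules(2)[OF assms(2,2)]
  by (cases l j rule: linorder_cases)
    (simp_all add: w_def comm_factor_add comm_factor_units[OF assms] comm_factor_units[OF assms(2,2)] B_block_def mat22_def c_def mult.left_commute)

text \<open>The inverse of the factor with y_j. The two factors cancel in omega_j = y_j z_{2j},
  which is why the omegas commute with each other.\<close>

lemma comm_factor_w_ex: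
  assumes "l \<in> {1..n}" "j \<in> {1..n}"
  shows "comm_factor (w l) (ex j) = inverse (c l j)"
proof -
  have "inverse (q l) * \<gamma> j l * (q l * inverse (p j) * \<gamma> l j) = (inverse (q l) * q l) * (\<gamma> l j * \<gamma> j l) * inverse (p j)"
    "inverse (p l) * \<gamma> j l * (inverse (q j) * p l * \<gamma> l j) = (inverse (p l) * p l) * (\<gamma> l j * \<gamma> j l) * inverse (q j)"
    by (simp_all only: mult_ac)
  then have "inverse (q l) * \<gamma> j l * (q l * inverse (p j) * \<gamma> l j) = inverse (p j)"
    "inverse (p l) * \<gamma> j l * (inverse (q j) * p l * \<gamma> l j) = inverse (q j)"
    using \<gamma>_rules(3)[OF assms] p_nonzero[OF assms(1)] q_nonzero[OF assms(1)] by simp_all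
  then show ?thesis
    using \<gamma>_rules(2)[OF assms(2,2)]
    by (cases l j rule: linorder_cases)
      (simp_all add: w_def comm_factor_add comm_factor_units[OF assms] comm_factor_units[OF assms(2,2)] B_block_def mat22_def c_def)
qed

lemma c_nonzero: "j \<in> {1..n} \<Longrightarrow> c l j \<noteq> 0"
  by (simp add: c_def p_nonzero q_nonzero)

lemma comm_factor_w_w:
  assumes "l \<in> {1..n}" "m \<in> {1..n}"
  shows "comm_factor (w l) (w m) = 1"
  unfolding w_def[of m] comm_factor_add(2) comm_factor_w_ey[OF assms] comm_factor_w_ex[OF assms]
  by (rule right_inverse[OF c_nonzero[OF assms(2)]])

lemma comm_factor_swap: "comm_factor b a = inverse (comm_factor a b)"
  by (simp add: comm_factor_def)

text \<open>Both exponents in the image of x_i have the form \<open>w l - ey i\<close>, with l = i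
  for the first and l = i - 1 for the second, so one computation covers both terms.\<close>

lemma comm_factor_x_y:
  assumes "l \<in> {1..n}" "i \<in> {1..n}" "j \<in> {1..n}"
  shows "comm_factor (w l - ey i) (ey j) = c l j * \<gamma> j i"
  using comm_factor_add(1)[of "w l" "- ey i" "ey j"] assms
  by (simp add: comm_factor_w_ey comm_factor_minus comm_factor_ey \<gamma>_inverse)

lemma comm_factor_x_x:
  assumes "l \<in> {1..n}" "m \<in> {1..n}" "i \<in> {1..n}" "j \<in> {1..n}"
  shows "comm_factor (w l - ey i) (w m - ey j) = c m i * inverse (c l j) * \<gamma> i j"
proof -
  have "comm_factor (ey i) (w m) = inverse (c m i)"
    using comm_factor_swap[of "ey i" "w m"] comm_factor_w_ey[OF assms(2,3)] by simp
  moreover have "comm_factor (w l - ey i) (w m - ey j) = comm_factor (w l + - ey i) (w m + - ey j)" by simp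
  ultimately show ?thesis
    unfolding comm_factor_add comm_factor_minus comm_factor_w_w[OF assms(1,2)] comm_factor_w_ey[OF assms(1,4)]
      comm_factor_ey[OF assms(3,4)]
    by (simp add: mult.assoc mult.left_commute)
qed

section \<open>The homomorphism from K to the torus\<close>

text \<open>
  \<open>\<omega> i\<close> is the image of \<open>\<Sum>l\<le>i. (q l - p l) y l x l\<close>, and \<open>img (GenX i)\<close> equals
  \<open>(q i - p i)\<^sup>-\<^sup>1 (y i)\<^sup>-\<^sup>1 (\<omega> i - \<omega> (i - 1))\<close>. Since \<open>\<omega> 0 = 0\<close>, the second term is absent for \<open>i = 1\<close>,
  where \<open>v i\<close> is meaningless.
\<close>

definition \<omega> :: "nat \<Rightarrow> ((nat \<Rightarrow>\<^sub>0 int) \<Rightarrow>\<^sub>0 'k)" where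
  "\<omega> i = (if i = 0 then 0 else mono (w i) 1)"

definition \<alpha> where "\<alpha> i = inverse (q i - p i)"
text \<open>The inverse cocycle cancels the scalar that appears when y_i is multiplied by the
  monomial with exponent \<open>v i\<close>. The first term needs no such correction, since
  \<open>cocycle (ey i) (ex i) = 1\<close>: index 2i - 1 precedes 2i.\<close>

definition \<beta> where "\<beta> i = (if i = 1 then 0 else \<alpha> i * inverse (cocycle (ey i) (v i)))"

fun img :: "xy_gen \<Rightarrow> ((nat \<Rightarrow>\<^sub>0 int) \<Rightarrow>\<^sub>0 'k)" where
  "img (GenY i) = mono (ey i) 1"
| "img (GenX i) = mono (ex i) (\<alpha> i) - mono (v i) (\<beta> i)"

definition gens where "gens = GenX ` {1..n} \<union> GenY ` {1..n}"

lemma second_term_in: "i \<in> {1..n} \<Longrightarrow> mono (v i) (\<beta> i) \<in> carr"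
  using exps_in(4)[of i] by (cases "i = 1") (simp_all add: \<beta>_def)

lemma img_closed: "g \<in> gens \<Longrightarrow> img g \<in> carr"
proof -
  assume "g \<in> gens"
  then consider i where "g = GenY i" "i \<in> {1..n}" | i where "g = GenX i" "i \<in> {1..n}"
    unfolding gens_def by blast
  then show ?thesis
  proof cases
    case 1
    then show ?thesis using exps_in(1)[OF 1(2)] by simp
  next
    case 2
    show ?thesis unfolding 2(1) img.simps
      by (intro diff_in_carr mono_in_carr exps_in second_term_in 2)
  qed
qed

lemma y_x_terms:
  assumes "i \<in> {1..n}"
  shows "img (GenY i) \<star> mono (ex i) (\<alpha> i) = mono 0 (\<alpha> i) \<star> \<omega> i"
    "img (GenY i) \<star> mono (v i) (\<beta> i) = mono 0 (\<alpha> i) \<star> \<omega> (i - 1)"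
proof -
  have 1: "cocycle (ey i) (ex i) = 1"
    unfolding ey_def ex_def using assms by (subst cocycle_unit) auto
  show "img (GenY i) \<star> mono (ex i) (\<alpha> i) = mono 0 (\<alpha> i) \<star> \<omega> i"
    using assms unfolding \<omega>_def img.simps tmult_mono[of "ey i"] 1 w_def[symmetric]
    by (simp add: scalar_mono[OF exps_in(3)[OF assms]])
  show "img (GenY i) \<star> mono (v i) (\<beta> i) = mono 0 (\<alpha> i) \<star> \<omega> (i - 1)"
  proof (cases "i = 1")
    case True
    then show ?thesis by (simp add: \<beta>_def \<omega>_def)
  next
    case False
    then have i: "i - 1 \<in> {1..n}" "i - 1 \<noteq> 0" using assms by auto
    have "ey i + v i = w (i - 1)" by (simp add: v_def)
    then have "img (GenY i) \<star> mono (v i) (\<beta> i) = mono (w (i - 1)) (\<alpha> i)"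
      using False cocycle_nonzero[of "ey i" "v i"] by (simp add: \<beta>_def tmult_mono mult.assoc)
    then show ?thesis using i(2) scalar_mono[OF exps_in(3)[OF i(1)], of "\<alpha> i" 1] by (simp add: \<omega>_def)
  qed
qed

lemma \<omega>_closed: "i \<le> n \<Longrightarrow> \<omega> i \<in> carr"
  using exps_in(3)[of i] by (simp add: \<omega>_def)

lemma y_x_product:
  assumes "i \<in> {1..n}"
  shows "mono 0 (q i - p i) \<star> (img (GenY i) \<star> img (GenX i)) = \<omega> i - \<omega> (i - 1)"
proof -
  have w: "\<omega> i - \<omega> (i - 1) \<in> carr" using assms by (intro diff_in_carr \<omega>_closed) auto
  have "img (GenY i) \<star> img (GenX i) = mono 0 (\<alpha> i) \<star> (\<omega> i - \<omega> (i - 1))"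
    unfolding img.simps(2) tmult_diff_right y_x_terms[OF assms] ..
  then have "mono 0 (q i - p i) \<star> (img (GenY i) \<star> img (GenX i))
      = mono 0 (q i - p i) \<star> mono 0 (\<alpha> i) \<star> (\<omega> i - \<omega> (i - 1))"
    using tmult_assoc[OF scalar_in_carr scalar_in_carr w] by simp
  also have "mono 0 (q i - p i) \<star> mono 0 (\<alpha> i) = 1"
    using p_neq_q[OF assms] by (simp add: scalar_mono X_zero \<alpha>_def)
  finally show ?thesis using tmult_one_left[OF w] by simp
qed

text \<open>At i - 1 the left side is the image of the extra sum in the relation for x_i y_i; at i
  the equation exhibits \<open>\<omega> i\<close> as the image of an element of K.\<close>

lemma telescope: "i \<le> n \<Longrightarrow> (\<Sum>l\<in>{1..<Suc i}. mono 0 (q l - p l) \<star> (img (GenY l) \<star> img (GenX l))) = \<omega> i"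
proof (induction i)
  case 0
  then show ?case by (simp add: \<omega>_def)
next
  case (Suc i)
  then show ?case using y_x_product[of "Suc i"] by (simp del: img.simps)
qed

lemma keys_x:
  assumes "a \<in> Poly_Mapping.keys (img (GenX i))" "i \<in> {1..n}"
  shows "\<exists>l\<in>{1..n}. (l = i \<or> l = i - 1) \<and> a = w l - ey i"
proof -
  have "a = ex i \<or> (i > 1 \<and> a = v i)"
    using assms keys_diff[of "mono (ex i) (\<alpha> i)" "mono (v i) (\<beta> i)"]
    by (auto simp: \<beta>_def split: if_splits)
  then show ?thesis
  proof
    assume "a = ex i"
    then show ?thesis using assms(2) by (intro bexI[of _ i]) (simp_all add: w_def)
  next
    assume "i > 1 \<and> a = v i"
    then show ?thesis using assms(2) by (intro bexI[of _ "i - 1"]) (auto simp: v_def)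
  qed
qed

lemma gens_in: "i \<in> {1..n} \<Longrightarrow> GenX i \<in> gens" "i \<in> {1..n} \<Longrightarrow> GenY i \<in> gens"
  by (simp_all add: gens_def)

lemma relation_yy:
  assumes "i \<in> {1..n}" "j \<in> {1..n}"
  shows "img (GenY i) \<star> img (GenY j) = mono 0 (\<gamma> i j) \<star> (img (GenY j) \<star> img (GenY i))"
  by (rule comm_factor_commute[OF img_closed img_closed])
    (use assms gens_in comm_factor_ey in \<open>simp_all\<close>)

lemma relation_xx:
  assumes "i \<in> {1..n}" "j \<in> {1..n}" "i < j"
  shows "img (GenX i) \<star> img (GenX j) = mono 0 (q i * inverse (p j) * \<gamma> i j) \<star> (img (GenX j) \<star> img (GenX i))"
proof (rule comm_factor_commute[OF img_closed[OF gens_in(1)[OF assms(1)]] img_closed[OF gens_in(1)[OF assms(2)]]])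
  fix a b assume "a \<in> Poly_Mapping.keys (img (GenX i))" "b \<in> Poly_Mapping.keys (img (GenX j))"
  then obtain l m where lm: "l \<in> {1..n}" "l = i \<or> l = i - 1" "a = w l - ey i"
    "m \<in> {1..n}" "m = j \<or> m = j - 1" "b = w m - ey j" using keys_x assms(1,2) by meson
  \<comment> \<open>From i < j follow i \<le> j - 1 \<le> m and l \<le> i < j, so each choice of
    terms gives the same factor.\<close>
  have "c m i = q i" "c l j = p j" using lm assms(3) by (auto simp: c_def)
  then show "comm_factor a b = q i * inverse (p j) * \<gamma> i j"
    unfolding lm(3,6) comm_factor_x_x[OF lm(1,4) assms(1,2)] by simp
qed

text \<open>For i > j both i and i - 1 are at least j, for i < j both are below j; hence the two
  terms of x_i pass y_j with the same factor. Only i = j separates them.\<close>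

lemma relation_xy:
  assumes "i \<in> {1..n}" "j \<in> {1..n}" "i \<noteq> j"
  shows "img (GenX i) \<star> img (GenY j) = mono 0 ((if i < j then p j else q j) * \<gamma> j i) \<star> (img (GenY j) \<star> img (GenX i))"
proof (rule comm_factor_commute[OF img_closed[OF gens_in(1)[OF assms(1)]] img_closed[OF gens_in(2)[OF assms(2)]]])
  fix a b assume a: "a \<in> Poly_Mapping.keys (img (GenX i))" and "b \<in> Poly_Mapping.keys (img (GenY j))"
  then have b: "b = ey j" by simp
  obtain l where l: "l \<in> {1..n}" "l = i \<or> l = i - 1" "a = w l - ey i" using keys_x[OF a assms(1)] by blast
  have "c l j = (if i < j then p j else q j)" using l assms(3) by (auto simp: c_def)
  then show "comm_factor a b = (if i < j then p j else q j) * \<gamma> j i"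
    unfolding l(3) b comm_factor_x_y[OF l(1) assms(1,2)] by simp
qed

text \<open>Now the two terms have different factors, q_i for the first and p_i for the second. The
  discrepancy, (q_i - p_i) y_i times the second term, equals \<open>\<omega> (i - 1)\<close> and is
  the source of the inhomogeneous part of the relation.\<close>

lemma relation_xy_same:
  assumes "i \<in> {1..n}"
  shows "img (GenX i) \<star> img (GenY i) = mono 0 (q i) \<star> (img (GenY i) \<star> img (GenX i)) + \<omega> (i - 1)"
proof -
  let ?y = "img (GenY i)" and ?a = "mono (ex i) (\<alpha> i)" and ?b = "mono (v i) (\<beta> i)"
  have cl: "?y \<in> carr" "?a \<in> carr" "?b \<in> carr" "\<omega> (i - 1) \<in> carr"
    by (rule img_closed[OF gens_in(2)[OF assms]], rule mono_in_carr[OF exps_in(2)[OF assms]],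
        rule second_term_in[OF assms], rule \<omega>_closed) (use assms in auto)
  have 1: "?a \<star> ?y = mono 0 (q i) \<star> (?y \<star> ?a)"
  proof (rule comm_factor_commute[OF cl(2,1)])
    fix a b assume "a \<in> Poly_Mapping.keys ?a" "b \<in> Poly_Mapping.keys ?y"
    then have "a = w i - ey i" "b = ey i" by (simp_all add: w_def split: if_splits)
    then show "comm_factor a b = q i"
      using comm_factor_x_y[OF assms assms assms] \<gamma>_rules(2)[OF assms assms] by (simp add: c_def)
  qed
  have 2: "?b \<star> ?y = mono 0 (p i) \<star> (?y \<star> ?b)"
  proof (rule comm_factor_commute[OF cl(3,1)])
    fix a b assume "a \<in> Poly_Mapping.keys ?b" "b \<in> Poly_Mapping.keys ?y"
    then have ab: "a = w (i - 1) - ey i" "b = ey i" "i \<noteq> 1" by (auto simp: v_def \<beta>_def split: if_splits)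
    then have "i - 1 \<in> {1..n}" using assms by auto
    from comm_factor_x_y[OF this assms assms] show "comm_factor a b = p i"
      using ab assms \<gamma>_rules(2)[OF assms assms] by (auto simp: c_def)
  qed
  have "mono 0 (q i) \<star> (?y \<star> ?b) - mono 0 (p i) \<star> (?y \<star> ?b) = mono 0 (q i - p i) \<star> (?y \<star> ?b)"
    by (simp only: single_diff tmult_diff_left)
  also have "\<dots> = mono 0 (q i - p i) \<star> mono 0 (\<alpha> i) \<star> \<omega> (i - 1)"
    unfolding y_x_terms(2)[OF assms] by (rule tmult_assoc[OF scalar_in_carr scalar_in_carr cl(4), symmetric])
  also have "mono 0 (q i - p i) \<star> mono 0 (\<alpha> i) = 1"
    using p_neq_q[OF assms] by (simp add: scalar_mono X_zero \<alpha>_def)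
  also have "1 \<star> \<omega> (i - 1) = \<omega> (i - 1)" by (rule tmult_one_left[OF cl(4)])
  finally have 3: "mono 0 (q i) \<star> (?y \<star> ?b) - mono 0 (p i) \<star> (?y \<star> ?b) = \<omega> (i - 1)" .
  show ?thesis
    unfolding img.simps(2) tmult_diff_left tmult_diff_right 1 2 3[symmetric] by simp
qed

sublocale Kp: presentation gens "K_relations n p q \<gamma>"
proof
  show "K_relations n p q \<gamma> \<subseteq> carrier (free_algebra gens)"
    unfolding K_relations_def
    by (auto intro!: free_algebra_carrier_closed free_algebra_sum_closed gens_in)
qed

lemma K_algebra_eq: "K_algebra n p q \<gamma> = presented_algebra gens (K_relations n p q \<gamma>)"
  by (simp add: K_algebra_def gens_def)

sublocale Kp: evaluation cocycle X gens "K_relations n p q \<gamma>" img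
  by unfold_locales (rule img_closed)

lemma K_relations_cases:
  assumes "r \<in> K_relations n p q \<gamma>"
  obtains (yy) i j where "i \<in> {1..n}" "j \<in> {1..n}" "r = \<y> i * \<y> j - scalar (\<gamma> i j) * \<y> j * \<y> i"
  | (xx) i j where "i \<in> {1..n}" "j \<in> {1..n}" "i < j"
      "r = \<x> i * \<x> j - scalar (q i * inverse (p j) * \<gamma> i j) * \<x> j * \<x> i"
  | (xy) i j where "i \<in> {1..n}" "j \<in> {1..n}" "i \<noteq> j"
      "r = \<x> i * \<y> j - scalar ((if i < j then p j else q j) * \<gamma> j i) * \<y> j * \<x> i"
  | (same) i where "i \<in> {1..n}"
      "r = \<x> i * \<y> i - (scalar (q i) * \<y> i * \<x> i + (\<Sum>l\<in>{1..<i}. scalar (q l - p l) * \<y> l * \<x> l))"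
  using assms unfolding K_relations_def
proof (elim UnE CollectE exE conjE, goal_cases)
  case (3 i j) then show ?case using xy[of i j] by simp
next
  case (4 i j) then show ?case using xy[of i j] by simp
qed (rule yy xx same; assumption)+

lemma K_relationsI:
  "\<lbrakk>i \<in> {1..n}; j \<in> {1..n}\<rbrakk> \<Longrightarrow> \<y> i * \<y> j - scalar (\<gamma> i j) * \<y> j * \<y> i \<in> K_relations n p q \<gamma>"
  "\<lbrakk>i \<in> {1..n}; j \<in> {1..n}; i < j\<rbrakk> \<Longrightarrow>
    \<x> i * \<x> j - scalar (q i * inverse (p j) * \<gamma> i j) * \<x> j * \<x> i \<in> K_relations n p q \<gamma>"
  "\<lbrakk>i \<in> {1..n}; j \<in> {1..n}; i \<noteq> j\<rbrakk> \<Longrightarrow>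
    \<x> i * \<y> j - scalar ((if i < j then p j else q j) * \<gamma> j i) * \<y> j * \<x> i \<in> K_relations n p q \<gamma>"
  "i \<in> {1..n} \<Longrightarrow> \<x> i * \<y> i - (scalar (q i) * \<y> i * \<x> i
     + (\<Sum>l\<in>{1..<i}. scalar (q l - p l) * \<y> l * \<x> l)) \<in> K_relations n p q \<gamma>"
proof -
  note ex2 = CollectI exI[of _ i] exI[of _ j] conjI refl
  show "\<lbrakk>i \<in> {1..n}; j \<in> {1..n}\<rbrakk> \<Longrightarrow> \<y> i * \<y> j - scalar (\<gamma> i j) * \<y> j * \<y> i \<in> K_relations n p q \<gamma>"
    unfolding K_relations_def by (rule UnI1, rule UnI1, rule UnI1, rule UnI1, intro ex2)
  show "\<lbrakk>i \<in> {1..n}; j \<in> {1..n}; i < j\<rbrakk> \<Longrightarrow>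
    \<x> i * \<x> j - scalar (q i * inverse (p j) * \<gamma> i j) * \<x> j * \<x> i \<in> K_relations n p q \<gamma>"
    unfolding K_relations_def by (rule UnI1, rule UnI1, rule UnI1, rule UnI2, intro ex2)
  assume ij: "i \<in> {1..n}"
  show "\<x> i * \<y> i - (scalar (q i) * \<y> i * \<x> i
     + (\<Sum>l\<in>{1..<i}. scalar (q l - p l) * \<y> l * \<x> l)) \<in> K_relations n p q \<gamma>"
    unfolding K_relations_def by (rule UnI2, intro CollectI exI[of _ i] conjI refl ij)
  assume ij: "i \<in> {1..n}" "j \<in> {1..n}" "i \<noteq> j"
  show "\<x> i * \<y> j - scalar ((if i < j then p j else q j) * \<gamma> j i) * \<y> j * \<x> i \<in> K_relations n p q \<gamma>"
  proof (cases "i < j")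
    case True
    show ?thesis
      unfolding K_relations_def if_P[OF True] by (intro UnI1[OF UnI1[OF UnI2]] ex2 ij True)
  next
    case False
    then have gt: "i > j" using ij(3) by simp
    show ?thesis
      unfolding K_relations_def if_not_P[OF False] by (rule UnI1, rule UnI2, intro ex2 ij gt)
  qed
qed

lemma K_rels_zero: "r \<in> K_relations n p q \<gamma> \<Longrightarrow> Kp.evalp r = 0"
proof (erule K_relations_cases)
  fix i assume i: "i \<in> {1..n}"
    and r: "r = \<x> i * \<y> i - (scalar (q i) * \<y> i * \<x> i + (\<Sum>l\<in>{1..<i}. scalar (q l - p l) * \<y> l * \<x> l))"
  note cl = free_algebra_carrier_closed[where S = gens]
  have e: "Kp.evalp (scalar d * \<y> l * \<x> l) = mono 0 d \<star> (img (GenY l) \<star> img (GenX l))" if "l \<in> {1..n}" for d l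
    using tmult_assoc[OF scalar_in_carr img_closed[OF gens_in(2)[OF that]] img_closed[OF gens_in(1)[OF that]]]
      that by (simp add: Kp.evalp_mult cl Kp.evalp_gen Kp.evalp_scalar gens_in del: img.simps)
  have "Kp.evalp (\<Sum>l\<in>{1..<i}. scalar (q l - p l) * \<y> l * \<x> l) =
      (\<Sum>l\<in>{1..<i}. mono 0 (q l - p l) \<star> (img (GenY l) \<star> img (GenX l)))"
    unfolding Kp.evalp_sum using i by (intro sum.cong refl e) auto
  also have "\<dots> = \<omega> (i - 1)"
  proof -
    have "Suc (i - 1) = i" "i - 1 \<le> n" using i by auto
    then show ?thesis using telescope[of "i - 1"] by (simp only:)
  qed
  finally have s: "Kp.evalp (\<Sum>l\<in>{1..<i}. scalar (q l - p l) * \<y> l * \<x> l) = \<omega> (i - 1)" .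
  have "Kp.evalp (\<x> i * \<y> i) = img (GenX i) \<star> img (GenY i)"
    using i by (simp add: Kp.evalp_mult cl Kp.evalp_gen gens_in del: img.simps)
  then show "Kp.evalp r = 0"
    unfolding r Kp.evalp_diff Kp.evalp_add s e[OF i] using relation_xy_same[OF i] by simp
qed (simp_all only:, (rule Kp.evalp_q_relation; (intro gens_in relation_yy relation_xx relation_xy)?; assumption)+)

text \<open>
  Exponents are ordered lexicographically, the smallest index being the most significant one.
\<close>

lemma trailing_img: "g \<in> gens \<Longrightarrow> trailing (img g) (case g of GenY i \<Rightarrow> ey i | GenX i \<Rightarrow> ex i)"
proof -
  assume "g \<in> gens"
  then consider i where "g = GenY i" "i \<in> {1..n}" | i where "g = GenX i" "i \<in> {1..n}"
    unfolding gens_def by blast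
  then show ?thesis
  proof cases
    case 1
    then show ?thesis by (simp add: trailing_mono)
  next
    case 2
    have a: "\<alpha> i \<noteq> 0" using p_neq_q[OF 2(2)] by (simp add: \<alpha>_def)
    have less: "ex i < v i" if "i \<noteq> 1"
    proof -
      have i: "i \<ge> 2" using that 2(2) by auto
      show ?thesis
        unfolding less_poly_mapping.rep_eq less_fun_def
      \<comment> \<open>The position of y_{i-1}: it is the first nonzero coordinate of
        \<open>v i\<close>, with value 1, while \<open>ex i\<close> vanishes up to and including
        it.\<close>
      proof (rule exI[of _ "2 * (i - 1) - 1"], intro conjI allI impI)
        show "Poly_Mapping.lookup (ex i) (2 * (i - 1) - 1) < Poly_Mapping.lookup (v i) (2 * (i - 1) - 1)"
          using i by (auto simp: v_def w_def ex_def ey_def lookup_minus lookup_add lookup_unit_exp)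
        fix k assume "k < 2 * (i - 1) - 1"
        then show "Poly_Mapping.lookup (ex i) k = Poly_Mapping.lookup (v i) k"
          using i by (auto simp: v_def w_def ex_def ey_def lookup_minus lookup_add lookup_unit_exp)
      qed
    qed
    have "Poly_Mapping.lookup (img (GenX i)) (ex i) = \<alpha> i"
      using less[THEN less_imp_neq] by (cases "i = 1") (auto simp: \<beta>_def lookup_minus lookup_single when_def)
    then have "ex i \<in> Poly_Mapping.keys (img (GenX i))" using a by (simp add: in_keys_iff del: img.simps)
    moreover have "ex i \<le> b" if "b \<in> Poly_Mapping.keys (img (GenX i))" for b
    proof -
      have "b = ex i \<or> (i \<noteq> 1 \<and> b = v i)"
        using that keys_diff[of "mono (ex i) (\<alpha> i)" "mono (v i) (\<beta> i)"]
        by (auto simp: \<beta>_def split: if_splits)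
      then show ?thesis using less by auto
    qed
    ultimately show ?thesis unfolding 2(1) trailing_def by (simp del: img.simps)
  qed
qed

section \<open>Spanning of K by ordered monomials\<close>

abbreviation Kkey :: "xy_gen \<Rightarrow> nat" where
  "Kkey g \<equiv> (case g of GenY i \<Rightarrow> i | GenX i \<Rightarrow> n + i)"

text \<open>A halfway normal form: every y stands before every x, without order inside the two
  blocks. The inhomogeneous relation is used up in reaching it; sorting each block afterwards costs
  only scalars.\<close>

definition pure_words where
  "pure_words = {ys @ xs | ys xs. set ys \<subseteq> GenY ` {1..n} \<and> set xs \<subseteq> GenX ` {1..n}}"

lemma Y_times_pure:
  assumes "f \<in> Kp.span_mod pure_words" "i \<in> {1..n}"
  shows "\<y> i * f \<in> Kp.span_mod pure_words"
proof (rule Kp.span_mod_mult_trans[OF assms(1)])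
  show "\<y> i \<in> carrier (free_algebra gens)" by (intro free_algebra_carrier_closed gens_in assms)
  fix l assume "l \<in> pure_words"
  then obtain ys xs where "l = ys @ xs" "set ys \<subseteq> GenY ` {1..n}" "set xs \<subseteq> GenX ` {1..n}"
    unfolding pure_words_def by blast
  then have "GenY i # l = (GenY i # ys) @ xs" "set (GenY i # ys) \<subseteq> GenY ` {1..n}" "set xs \<subseteq> GenX ` {1..n}"
    using assms(2) by simp_all
  then have "GenY i # l \<in> pure_words" unfolding pure_words_def by blast
  then show "\<y> i * monom_word l \<in> Kp.span_mod pure_words"
    unfolding monom_word_Cons[symmetric] by (rule Kp.span_mod_word)
qed

text \<open>Moving x_i past the first y shortens the block of y's still to be passed. The relation
  for x_i y_i replaces x_i by other x_l with l < i, so the induction must run over all i at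
  once.\<close>

lemma X_times_pure_word:
  assumes "set ys \<subseteq> GenY ` {1..n}" "set xs \<subseteq> GenX ` {1..n}" "i \<in> {1..n}"
  shows "\<x> i * monom_word (ys @ xs) \<in> Kp.span_mod pure_words"
  using assms(1,3)
proof (induction ys arbitrary: i)
  case Nil
  have "GenX i # xs = [] @ (GenX i # xs)" "set [] \<subseteq> GenY ` {1..n}" "set (GenX i # xs) \<subseteq> GenX ` {1..n}"
    using assms(2) Nil by simp_all
  then have "GenX i # xs \<in> pure_words" unfolding pure_words_def by blast
  then show ?case unfolding append_Nil monom_word_Cons[symmetric] by (rule Kp.span_mod_word)
next
  case (Cons g ys)
  then obtain j where j: "g = GenY j" "j \<in> {1..n}" by auto
  let ?m = "monom_word (ys @ xs)"
  have m: "?m \<in> carrier (free_algebra gens)"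
    using Cons.prems assms(2) by (intro free_algebra_carrier_closed) (auto simp: gens_def)
  have IH: "\<x> i * ?m \<in> Kp.span_mod pure_words" if "i \<in> {1..n}" for i using Cons that by simp
  have yx: "scalar d * \<y> l * \<x> i * ?m \<in> Kp.span_mod pure_words" if "l \<in> {1..n}" "i \<in> {1..n}" for d l i
    unfolding mult.assoc by (intro Kp.span_mod_scalar Y_times_pure IH that)
  have "\<x> i * monom_word ((g # ys) @ xs) = \<x> i * \<y> j * ?m"
    by (simp add: j(1) monom_word_Cons mult.assoc)
  also have "\<dots> \<in> Kp.span_mod pure_words"
  proof (cases "i = j")
    case False
    have "Kp.cong (\<x> i * \<y> j * ?m) (scalar ((if i < j then p j else q j) * \<gamma> j i) * \<y> j * \<x> i * ?m)"
      by (rule Kp.cong_rmult[OF _ m], unfold Kp.cong_def)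
        (rule Kp.rels_I[OF K_relationsI(3)[OF Cons.prems(2) j(2) False]])
    then show ?thesis by (rule Kp.span_mod_cong) (rule yx[OF j(2) Cons.prems(2)])
  next
    case True
    let ?r = "scalar (q i) * \<y> i * \<x> i + (\<Sum>l\<in>{1..<i}. scalar (q l - p l) * \<y> l * \<x> l)"
    have "Kp.cong (\<x> i * \<y> j * ?m) (?r * ?m)"
      unfolding True[symmetric]
      by (rule Kp.cong_rmult[OF _ m], unfold Kp.cong_def)
        (rule Kp.rels_I[OF K_relationsI(4)[OF Cons.prems(2)]])
    moreover have "?r * ?m \<in> Kp.span_mod pure_words"
      unfolding distrib_right sum_distrib_right using Cons.prems(2)
      by (intro Kp.span_mod_add Kp.span_mod_sum yx) auto
    ultimately show ?thesis by (rule Kp.span_mod_cong)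
  qed
  finally show ?case .
qed

lemma words_pure: "set l \<subseteq> gens \<Longrightarrow> monom_word l \<in> Kp.span_mod pure_words"
proof (induction l)
  case Nil
  have "[] \<in> pure_words" unfolding pure_words_def by simp
  then show ?case by (rule Kp.span_mod_word)
next
  case (Cons g l)
  then have IH: "monom_word l \<in> Kp.span_mod pure_words" and "g \<in> gens" by simp_all
  then consider i where "g = GenY i" "i \<in> {1..n}" | i where "g = GenX i" "i \<in> {1..n}"
    unfolding gens_def by blast
  then show ?case
  proof cases
    case 1
    then show ?thesis unfolding monom_word_Cons using Y_times_pure[OF IH 1(2)] by simp
  next
    case 2
    show ?thesis unfolding monom_word_Cons 2(1)
    proof (rule Kp.span_mod_mult_trans[OF IH])
      show "\<x> i \<in> carrier (free_algebra gens)" by (intro free_algebra_carrier_closed gens_in 2)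
      fix l assume "l \<in> pure_words"
      then obtain ys xs where "l = ys @ xs" "set ys \<subseteq> GenY ` {1..n}" "set xs \<subseteq> GenX ` {1..n}"
        unfolding pure_words_def by blast
      then show "\<x> i * monom_word l \<in> Kp.span_mod pure_words"
        using X_times_pure_word[OF _ _ 2(2)] by simp
    qed
  qed
qed

lemma y_q_commute:
  assumes "a \<in> GenY ` {1..n}" "b \<in> GenY ` {1..n}"
  shows "\<exists>d. Kp.cong (gen a * gen b) (scalar d * (gen b * gen a))"
proof -
  obtain i j where ij: "a = GenY i" "b = GenY j" "i \<in> {1..n}" "j \<in> {1..n}" using assms by blast
  show ?thesis
    unfolding ij(1,2) Kp.cong_def mult.assoc[symmetric]
    by (rule exI, rule Kp.rels_I[OF K_relationsI(1)[OF ij(3,4)]])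
qed

lemma x_q_commute:
  assumes "a \<in> GenX ` {1..n}" "b \<in> GenX ` {1..n}"
  shows "\<exists>d. Kp.cong (gen a * gen b) (scalar d * (gen b * gen a))"
proof -
  obtain i j where ij: "a = GenX i" "b = GenX j" "i \<in> {1..n}" "j \<in> {1..n}" using assms by blast
  have lt: "Kp.cong (\<x> i * \<x> j) (scalar (q i * inverse (p j) * \<gamma> i j) * (\<x> j * \<x> i))"
    if "i \<in> {1..n}" "j \<in> {1..n}" "i < j" for i j
    unfolding Kp.cong_def mult.assoc[symmetric]
    using Kp.rels_I[OF K_relationsI(2)[OF that]] by (simp only: mult.assoc)
  show ?thesis
  proof (cases i j rule: linorder_cases)
    case less
    then show ?thesis unfolding ij(1,2) using lt[OF ij(3,4)] by blast
  next
    case equal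
    then show ?thesis unfolding ij(1,2) by (intro exI[of _ 1]) (simp add: scalar_one Kp.cong_refl)
  next
    case greater
    \<comment> \<open>The relations cover only increasing indices; the reverse order is obtained by
      dividing by the scalar, which is nonzero.\<close>
    let ?d = "q j * inverse (p i) * \<gamma> j i"
    have d: "?d \<noteq> 0" using ij p_nonzero q_nonzero \<gamma>_rules(1) by simp
    have "Kp.cong (scalar (inverse ?d) * (\<x> j * \<x> i)) (scalar (inverse ?d) * (scalar ?d * (\<x> i * \<x> j)))"
      by (intro Kp.cong_lmult lt ij greater free_algebra_carrier_closed)
    also have "\<dots> = (scalar (inverse ?d) * scalar ?d) * (\<x> i * \<x> j)" by (rule mult.assoc[symmetric])
    also have "\<dots> = \<x> i * \<x> j"
      by (simp only: scalar_mult[symmetric] left_inverse[OF d] scalar_one mult_1_left)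
    finally have "Kp.cong (\<x> i * \<x> j) (scalar (inverse ?d) * (\<x> j * \<x> i))" by (rule Kp.cong_sym)
    then show ?thesis unfolding ij(1,2) by blast
  qed
qed

lemma K_straighten:
  assumes "set l \<subseteq> gens"
  shows "monom_word l \<in> Kp.span_mod {l. set l \<subseteq> gens \<and> sorted (map Kkey l)}"
proof (rule Kp.span_mod_trans[OF words_pure[OF assms]])
  fix l assume "l \<in> pure_words"
  then obtain ys xs where l: "l = ys @ xs" "set ys \<subseteq> GenY ` {1..n}" "set xs \<subseteq> GenX ` {1..n}"
    unfolding pure_words_def by blast
  note cl = free_algebra_carrier_closed[where S = gens]
  have sub: "GenY ` {1..n} \<subseteq> gens" "GenX ` {1..n} \<subseteq> gens" by (auto simp: gens_def)
  have g: "set ys \<subseteq> gens" "set xs \<subseteq> gens" using l(2,3) sub by blast+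
  obtain d where d: "Kp.cong (monom_word ys) (scalar d * monom_word (sort_key Kkey ys))"
    using Kp.sort_word[OF y_q_commute sub(1) l(2)] by blast
  obtain d' where d': "Kp.cong (monom_word xs) (scalar d' * monom_word (sort_key Kkey xs))"
    using Kp.sort_word[OF x_q_commute sub(2) l(3)] by blast
  have "Kp.cong (monom_word ys * monom_word xs)
      ((scalar d * monom_word (sort_key Kkey ys)) * (scalar d' * monom_word (sort_key Kkey xs)))"
    by (rule Kp.cong_mult[OF d d']) (use g in \<open>simp_all add: cl\<close>)
  also have "\<dots> = scalar d * (scalar d' * monom_word (sort_key Kkey ys @ sort_key Kkey xs))"
    by (simp only: monom_word_append mult.assoc scalar_left_commute[of "monom_word (sort_key Kkey ys)"])
  finally have eq: "Kp.cong (monom_word l) (scalar d * (scalar d' * monom_word (sort_key Kkey ys @ sort_key Kkey xs)))"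
    by (simp add: l(1) monom_word_append)
  have "sort_key Kkey ys @ sort_key Kkey xs \<in> {l. set l \<subseteq> gens \<and> sorted (map Kkey l)}"
  proof -
    have "Kkey a \<le> Kkey b" if "a \<in> set ys" "b \<in> set xs" for a b
      using l(2,3) that by fastforce
    then show ?thesis using g by (simp add: sorted_append)
  qed
  then show "monom_word l \<in> Kp.span_mod {l. set l \<subseteq> gens \<and> sorted (map Kkey l)}"
    by (intro Kp.span_mod_cong[OF eq] Kp.span_mod_scalar Kp.span_mod_word)
qed

text \<open>The index of the torus generator whose exponent is the trailing one of the image of
  g.\<close>

definition Kpos :: "xy_gen \<Rightarrow> nat" where
  "Kpos g = (case g of GenY i \<Rightarrow> 2 * i - 1 | GenX i \<Rightarrow> 2 * i)"

lemma K_faithful: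
  "faithful_evaluation cocycle X gens (K_relations n p q \<gamma>) img Kkey (\<lambda>g. unit_exp (Kpos g))"
proof
  show "r \<in> K_relations n p q \<gamma> \<Longrightarrow> Kp.evalp r = 0" for r by (rule K_rels_zero)
  show "inj_on Kkey gens" by (auto simp: inj_on_def gens_def)
  show "trailing (img g) (unit_exp (Kpos g))" if "g \<in> gens" for g
    using trailing_img[OF that] by (cases g) (simp_all add: Kpos_def ey_def ex_def)
  have "inj_on Kpos gens" by (auto simp: inj_on_def gens_def Kpos_def, presburger+)
  then show "set l \<subseteq> gens \<Longrightarrow> set l' \<subseteq> gens \<Longrightarrow> sum_list (map (\<lambda>g. unit_exp (Kpos g)) l)
      = sum_list (map (\<lambda>g. unit_exp (Kpos g)) l') \<Longrightarrow> mset l = mset l'" for l l'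
    by (rule unit_exp_sum_mset)
qed (rule K_straighten)

section \<open>A cone of monomials common to both algebras\<close>

text \<open>
  The exponents generated by those of \<open>y i\<close> and \<open>\<omega> i\<close>; the corresponding monomials lie in both algebras.
\<close>

definition cone where
  "cone = {m \<in> X. \<forall>i\<in>{1..n}. 0 \<le> Poly_Mapping.lookup m (2 * i) \<and> Poly_Mapping.lookup m (2 * i) \<le> Poly_Mapping.lookup m (2 * i - 1)}"

lemma lookup_exps:
  assumes "i \<ge> 1" "j \<ge> 1"
  shows "Poly_Mapping.lookup (ey i) (2 * j - Suc 0) = (if i = j then 1 else 0)" "Poly_Mapping.lookup (ey i) (2 * j) = 0"
    "Poly_Mapping.lookup (w i) (2 * j - Suc 0) = (if i = j then 1 else 0)"
    "Poly_Mapping.lookup (w i) (2 * j) = (if i = j then 1 else 0)"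
proof -
  have "2 * j - 1 \<noteq> 2 * i" "2 * j \<noteq> 2 * i - 1" "2 * j - 1 = 2 * i - 1 \<longleftrightarrow> i = j" using assms by presburger+
  then show "Poly_Mapping.lookup (ey i) (2 * j - Suc 0) = (if i = j then 1 else 0)" "Poly_Mapping.lookup (ey i) (2 * j) = 0"
    "Poly_Mapping.lookup (w i) (2 * j - Suc 0) = (if i = j then 1 else 0)"
    "Poly_Mapping.lookup (w i) (2 * j) = (if i = j then 1 else 0)"
    using assms by (simp_all add: w_def ey_def ex_def lookup_add lookup_unit_exp)
qed

lemma exponent_eqI:
  assumes "a \<in> X" "b \<in> X"
    and "\<And>j. j \<in> {1..n} \<Longrightarrow> Poly_Mapping.lookup a (2 * j - 1) = Poly_Mapping.lookup b (2 * j - 1)"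
    and "\<And>j. j \<in> {1..n} \<Longrightarrow> Poly_Mapping.lookup a (2 * j) = Poly_Mapping.lookup b (2 * j)"
  shows "a = b"
proof (rule poly_mapping_eqI)
  fix k
  show "Poly_Mapping.lookup a k = Poly_Mapping.lookup b k"
  proof (cases "k \<in> {1..2 * n}")
    case True
    then show ?thesis by (cases rule: index_cases) (use assms(3,4) in simp_all)
  next
    case False
    then show ?thesis using lookup_outside[OF assms(1)] lookup_outside[OF assms(2)] by simp
  qed
qed

lemma X_sum: "(\<And>i. i \<in> J \<Longrightarrow> f i \<in> X) \<Longrightarrow> (\<Sum>i\<in>J. f i) \<in> X"
  by (induction J rule: infinite_finite_induct) (simp_all add: X_zero X_add)

text \<open>Only \<open>w i\<close> involves the coordinate 2i, so m(2i) is its multiplicity; what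
  remains at 2i - 1 is the multiplicity of \<open>ey i\<close>, and it is nonnegative by the
  definition of the cone. The constant sums stand for natural multiples.\<close>

lemma cone_decomposition:
  assumes "m \<in> cone"
  shows "m = (\<Sum>i\<in>{1..n}. (\<Sum>_\<in>{..<nat (Poly_Mapping.lookup m (2 * i - 1) - Poly_Mapping.lookup m (2 * i))}. ey i)
      + (\<Sum>_\<in>{..<nat (Poly_Mapping.lookup m (2 * i))}. w i))"
    (is "m = (\<Sum>i\<in>{1..n}. ?t i)")
proof (rule exponent_eqI)
  show "m \<in> X" using assms by (simp add: cone_def)
  show "(\<Sum>i\<in>{1..n}. ?t i) \<in> X" by (intro X_sum X_add exps_in)
  fix j assume j: "j \<in> {1..n}"
  have m: "0 \<le> Poly_Mapping.lookup m (2 * j)" "Poly_Mapping.lookup m (2 * j) \<le> Poly_Mapping.lookup m (2 * j - 1)"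
    using assms j by (simp_all add: cone_def)
  have "Poly_Mapping.lookup (\<Sum>i\<in>{1..n}. ?t i) (2 * j - 1) =
      (\<Sum>i\<in>{1..n}. if i = j then Poly_Mapping.lookup m (2 * j - 1) else 0)"
    unfolding lookup_sum lookup_add using j m by (intro sum.cong refl) (auto simp: lookup_exps)
  then show "Poly_Mapping.lookup m (2 * j - 1) = Poly_Mapping.lookup (\<Sum>i\<in>{1..n}. ?t i) (2 * j - 1)"
    using j by (simp add: sum.delta)
  have "Poly_Mapping.lookup (\<Sum>i\<in>{1..n}. ?t i) (2 * j) =
      (\<Sum>i\<in>{1..n}. if i = j then Poly_Mapping.lookup m (2 * j) else 0)"
    unfolding lookup_sum lookup_add using j m by (intro sum.cong refl) (auto simp: lookup_exps)
  then show "Poly_Mapping.lookup m (2 * j) = Poly_Mapping.lookup (\<Sum>i\<in>{1..n}. ?t i) (2 * j)"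
    using j by (simp add: sum.delta)
qed

lemma cone_shift:
  assumes "finite K" "K \<subseteq> X"
  shows "\<exists>e\<in>cone. \<forall>k\<in>K. k + e \<in> cone"
proof -
  have "finite (\<Union>k\<in>K. (\<lambda>i. nat \<bar>Poly_Mapping.lookup k i\<bar>) ` {1..2 * n})" using assms(1) by simp
  then obtain d :: nat where "\<forall>x\<in>(\<Union>k\<in>K. (\<lambda>i. nat \<bar>Poly_Mapping.lookup k i\<bar>) ` {1..2 * n}). x \<le> d"
    unfolding finite_nat_set_iff_bounded_le by (elim exE)
  then have d: "nat \<bar>Poly_Mapping.lookup k i\<bar> \<le> d" if "k \<in> K" "i \<in> {1..2 * n}" for k i
    using that by simp
  \<comment> \<open>In each block e has the coordinates 3d and d. The even coordinate d absorbs a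
    change by at most d, and the gap 2d between the two absorbs opposite changes of both.\<close>
  define e where "e = (\<Sum>i\<in>{1..n}. (\<Sum>_\<in>{..<2 * d}. ey i) + (\<Sum>_\<in>{..<d}. w i))"
  have eX: "e \<in> X" unfolding e_def by (intro X_sum X_add exps_in)
  have "Poly_Mapping.lookup e (2 * j - 1) = (\<Sum>i\<in>{1..n}. if i = j then 3 * int d else 0)"
    "Poly_Mapping.lookup e (2 * j) = (\<Sum>i\<in>{1..n}. if i = j then int d else 0)" if "j \<in> {1..n}" for j
    unfolding e_def lookup_sum lookup_add using that
    by (intro sum.cong refl; simp add: lookup_exps)+
  then have le: "Poly_Mapping.lookup e (2 * j - 1) = 3 * int d" "Poly_Mapping.lookup e (2 * j) = int d"
    if "j \<in> {1..n}" for j using that by (simp_all add: sum.delta)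
  have "e \<in> cone"
    unfolding cone_def
  proof (intro CollectI conjI ballI eX)
    fix j assume j: "j \<in> {1..n}"
    show "0 \<le> Poly_Mapping.lookup e (2 * j)" "Poly_Mapping.lookup e (2 * j) \<le> Poly_Mapping.lookup e (2 * j - 1)"
      unfolding le[OF j] by simp_all
  qed
  moreover have "k + e \<in> cone" if k: "k \<in> K" for k
    unfolding cone_def
  proof (intro CollectI conjI ballI)
    show "k + e \<in> X" using k assms(2) eX by (intro X_add) auto
    fix j assume j: "j \<in> {1..n}"
    have r: "2 * j \<in> {1..2 * n}" "2 * j - 1 \<in> {1..2 * n}" using j by auto
    have "\<bar>Poly_Mapping.lookup k (2 * j)\<bar> \<le> int d" "\<bar>Poly_Mapping.lookup k (2 * j - 1)\<bar> \<le> int d"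
      using d[OF k r(1)] d[OF k r(2)] by linarith+
    then show "0 \<le> Poly_Mapping.lookup (k + e) (2 * j)"
      "Poly_Mapping.lookup (k + e) (2 * j) \<le> Poly_Mapping.lookup (k + e) (2 * j - 1)"
      unfolding lookup_add le[OF j] by linarith+
  qed
  ultimately show ?thesis by blast
qed

lemma cone_in_X: "cone \<subseteq> X"
  by (auto simp: cone_def)

lemma cone_represented_space:
  assumes "m \<in> cone"
  shows "mono m 1 \<in> space.evalp ` carrier (free_algebra {1..2 * n})"
proof -
  have u: "unit_exp k \<in> space.represented" if "k \<in> {1..2 * n}" for k
  proof -
    have "gen k \<in> carrier (free_algebra {1..2 * n})" by (rule free_algebra_carrier_closed(7)[OF that])
    then have "mono (unit_exp k) 1 \<in> space.evalp ` carrier (free_algebra {1..2 * n})"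
      by (rule image_eqI[rotated]) (rule space.evalp_gen[OF that, symmetric])
    then show ?thesis unfolding space.represented_def using unit_exp_in[OF that] by (intro CollectI conjI)
  qed
  have y: "ey i \<in> space.represented" and x: "ex i \<in> space.represented" if "i \<in> {1..n}" for i
    unfolding ey_def ex_def by (rule u; use that in force)+
  have "m \<in> space.represented"
    by (subst cone_decomposition[OF assms], unfold w_def)
      (intro space.represented_sum space.represented_add y x; assumption)
  then show ?thesis unfolding space.represented_def mem_Collect_eq by (rule conjunct2)
qed

text \<open>The image of x_i is in general not a monomial, but \<open>\<omega> i\<close> is one and
  comes from a sum of multiples of the y_l x_l by \<open>telescope\<close>. This explains why the
  cone is generated by \<open>ey i\<close> and \<open>w i\<close> and not by all unit
  exponents.\<close>

lemma cone_represented_K: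
  assumes "m \<in> cone"
  shows "mono m 1 \<in> Kp.evalp ` carrier (free_algebra gens)"
proof -
  note cl = free_algebra_carrier_closed[where S = gens]
  have y: "ey i \<in> Kp.represented" if "i \<in> {1..n}" for i
  proof -
    have "\<y> i \<in> carrier (free_algebra gens)" by (rule cl(7)[OF gens_in(2)[OF that]])
    then have "img (GenY i) \<in> Kp.evalp ` carrier (free_algebra gens)"
      by (rule image_eqI[rotated]) (rule Kp.evalp_gen[OF gens_in(2)[OF that], symmetric])
    then show ?thesis unfolding Kp.represented_def img.simps(1) using exps_in(1)[OF that] by (intro CollectI conjI)
  qed
  have om: "\<omega> i \<in> Kp.evalp ` carrier (free_algebra gens)" if "i \<le> n" for i
  proof -
    let ?s = "\<Sum>l\<in>{1..<Suc i}. scalar (q l - p l) * (\<y> l * \<x> l)"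
    have "Kp.evalp ?s = (\<Sum>l\<in>{1..<Suc i}. mono 0 (q l - p l) \<star> (img (GenY l) \<star> img (GenX l)))"
      unfolding Kp.evalp_sum using that
      by (intro sum.cong refl) (simp add: Kp.evalp_mult cl Kp.evalp_gen Kp.evalp_scalar gens_in del: img.simps)
    also have "\<dots> = \<omega> i" by (rule telescope[OF that])
    finally have s: "Kp.evalp ?s = \<omega> i" .
    have "?s \<in> carrier (free_algebra gens)"
    proof (rule free_algebra_sum_closed)
      fix l assume "l \<in> {1..<Suc i}"
      then have "l \<in> {1..n}" using that by auto
      then show "scalar (q l - p l) * (\<y> l * \<x> l) \<in> carrier (free_algebra gens)"
        by (intro cl gens_in)
    qed
    then show ?thesis by (rule image_eqI[rotated]) (rule s[symmetric])
  qed
  have ww: "w i \<in> Kp.represented" if "i \<in> {1..n}" for i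
  proof -
    have "\<omega> i = mono (w i) 1" "i \<le> n" using that by (auto simp: \<omega>_def)
    then show ?thesis using om[of i] exps_in(3)[OF that] unfolding Kp.represented_def by simp
  qed
  have "m \<in> Kp.represented"
    by (subst cone_decomposition[OF assms])
      (intro Kp.represented_sum Kp.represented_add y ww; assumption)
  then show ?thesis unfolding Kp.represented_def mem_Collect_eq by (rule conjunct2)
qed

section \<open>Comparison of the two division rings\<close>

theorem Frac_K_isomorphic:
  "has_division_ring_of_fractions (K_algebra n p q \<gamma>) \<and>
    has_division_ring_of_fractions (quantum_space (2 * n) \<Lambda>) \<and>
    Frac (K_algebra n p q \<gamma>) \<simeq>\<^sub>k Frac (quantum_space (2 * n) \<Lambda>)"
proof -
  interpret Kf: faithful_evaluation cocycle X gens "K_relations n p q \<gamma>" img Kkey "\<lambda>g. unit_exp (Kpos g)"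
    by (rule K_faithful)
  interpret sf: faithful_evaluation cocycle X "{1..2 * n}" space_rels "\<lambda>i. mono (unit_exp i) 1" id unit_exp
    by (rule space_faithful)
  interpret KD: dense_embedding "presented_algebra gens (K_relations n p q \<gamma>)" tw_alg Kf.embedding
    by (rule Kf.embedding_dense[OF cone_represented_K cone_shift cone_in_X])
  interpret sD: dense_embedding "presented_algebra {1..2 * n} space_rels" tw_alg sf.embedding
    by (rule sf.embedding_dense[OF cone_represented_space cone_shift cone_in_X])
  have "Frac tw_alg \<simeq>\<^sub>k Frac (presented_algebra {1..2 * n} space_rels)"
    by (rule k_algebra_isomorphic_sym[OF sD.Frac_isomorphic sD.A.Frac_k_algebra])
  then show ?thesis
    unfolding K_algebra_eq quantum_space_eq
    by (intro conjI KD.A.has_division_ring_of_fractions sD.A.has_division_ring_of_fractions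
        k_algebra_isomorphic_trans[OF KD.Frac_isomorphic])
qed

end

theorem mainTheorem11:
  fixes n :: nat
    and p q :: "nat \<Rightarrow> 'k::field"
    and \<gamma> :: "nat \<Rightarrow> nat \<Rightarrow> 'k"
  assumes "n \<ge> 1"
    and "\<And>i. i \<in> {1..n} \<Longrightarrow> p i \<noteq> 0"
    and "\<And>i. i \<in> {1..n} \<Longrightarrow> q i \<noteq> 0"
    and "\<And>i. i \<in> {1..n} \<Longrightarrow> p i \<noteq> q i"
    and "mult_antisymmetric n \<gamma>"
  shows "has_division_ring_of_fractions (K_algebra n p q \<gamma>) \<and>
    has_division_ring_of_fractions (quantum_space (2 * n) (Lambda_matrix p q \<gamma>)) \<and>
    Frac (K_algebra n p q \<gamma>) \<simeq>\<^sub>k Frac (quantum_space (2 * n) (Lambda_matrix p q \<gamma>))"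
proof -
  interpret K_setup n p q \<gamma> by unfold_locales (use assms(2-5) in auto)
  show ?thesis by (rule Frac_K_isomorphic)
qed

end
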